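(* For every $n\ge2$, the set $\mathcal A^s_n$ of signed arc permutations, endowed with the map $w\mapsto\mathrm{sDes}(w)$, is a fine set for the $B_n$-character induced from the $B_{n-1}$-representation on the exterior algebra $\bigwedge V_{n-1}$. Equivalently, $$\sum_{w\in\mathcal A^s_n}F_{\mathrm{sDes}(w)}(x,y)=\mathrm{ch}\Big(\sum_{k=0}^{n-1}\chi^{(k),(1^{n-k-1})}\big\uparrow^{B_n}_{B_{n-1}}\Big).$$
   Context: $B_n$: signed permutations $w=(w(1),\dots,w(n))$; $|a|$ denotes the absolute value (bar removed). $w\in B_n$ is a signed arc permutation if for each $i\in\{2,\dots,n-1\}$: the set $\{|w(1)|,\dots,|w(i-1)|\}$ is an interval in $\mathbb Z_n$ (cyclically consecutive residues, $n$ identified with $0$), and $w(i)$ is unbarred if $|w(i)|-1\in\{|w(1)|,\dots,|w(i-1)|\}$ and barred if $|w(i)|+1\in\{|w(1)|,\dots,|w(i-1)|\}$ (arithmetic in $\mathbb Z_n$). $V_{n-1}$ is an $(n-1)$-dimensional complex vector space on which $B_{n-1}$ acts by permuting coordinates and switching their signs; $B_{n-1}\le B_n$ is the subgroup fixing $n$; $\uparrow^{B_n}_{B_{n-1}}$ is induction. $\chi^{\lambda,\mu}$ is the irreducible $B_{n-1}$-character with Frobenius characteristic $s_\lambda(x)s_\mu(y)$; $\mathrm{ch}(\chi)=\frac{1}{2^nn!}\sum_w\chi(w)p^+_\alpha p^-_\beta$ with $(\alpha,\beta)$ the signed cycle type of $w$ (lengths of positive cycles — pairs of disjoint cycles $c,\bar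 c$ on $\{1,\dots,n,\bar1,\dots,\bar n\}$ — and negative cycles $c=\bar c$, counted with half length), $p^\pm_j=\sum_i(x_i^j\pm y_i^j)$. $\mathrm{sDes}(w)=(S,\varepsilon)$: with $\bar1<_r\cdots<_r\bar n<_r1<_r\cdots<_rn$, $S$ consists of $n$ and all $s\in[n-1]$ with $w(s)>_rw(s+1)$ or with $w(s)$ barred and $w(s+1)$ unbarred; $\varepsilon(s)=-$ iff $w(s)$ barred. For $\sigma=(S,\varepsilon)$ with $S=\{s_1<\dots<s_m=n\}$, $s_0=0$: sign vector $\tilde\varepsilon(j)=\varepsilon(s_i)$ for $s_{i-1}<j\le s_i$; ${\rm wDes}(\sigma)$ the set of $s_i$, $i<m$, with $\varepsilon(s_i)=\varepsilon(s_{i+1})$ or ($\varepsilon(s_i)=+$, $\varepsilon(s_{i+1})=-$); $F_\sigma(x,y)=\sum z_{i_1}\cdots z_{i_n}$ over $i_1\le\dots\le i_n$ with $i_j<i_{j+1}$ for $j\in{\rm wDes}(\sigma)$, $z_{i_j}=x_{i_j}$ if $\tilde\varepsilon(j)=+$, else $y_{i_j}$. Fine sets: for a signed composition $\gamma=(\gamma_1,\dots,\gamma_m)$ of $n$ (some parts barred), partial sums $r_i$, $r_0=0$, $S(\gamma)=\{r_1,\dots,r_m\}$, blocks $I_i=\{r_{i-1}+1,\dots,r_i\}$: $\mathrm{wt}_\gamma(\sigma)=0$ if for some $i$, $S\cap\{r_{i-1}+1,\dots,r_i-1\}$ is not an initial segment of $\{r_{i-1}+1,\dots,r_i-1\}$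 or $\tilde\varepsilon$ is not constant on $I_i$; else $(-1)^{|S\setminus S(\gamma)|+n_\gamma(\sigma)}$, $n_\gamma(\sigma)$ the number of $i$ with $\tilde\varepsilon=-$ on $I_i$ and $\gamma_i$ barred. A finite set $\mathcal B$ with map $\mathrm{sDes}$ is fine for a class function $\chi$ of $B_n$ if $\chi(\gamma)=\sum_{b\in\mathcal B}\mathrm{wt}_\gamma(\mathrm{sDes}(b))$ for all $\gamma$, $\chi(\gamma)$ being the value at elements of signed cycle type (sorted unbarred parts; sorted barred parts of $\gamma$). *)

theory Defs
  imports
    "HOL-Library.Multiset"
    "HOL-Library.FuncSet"
    "HOL-Number_Theory.Cong"
    "HOL-Combinatorics.Permutations"
    "HOL-Combinatorics.Orbits"
    "Jordan_Normal_Form.Matrix"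
begin

section \<open>Formal power series in an arbitrary set of variables\<close>

text \<open>A monomial is the finite multiset of its variables; a series is its coefficient function.\<close>

typedef 'v mseries = "UNIV :: ('v multiset \<Rightarrow> complex) set"
  morphisms mcoeff Abs_mseries
  by simp

setup_lifting type_definition_mseries

lemma mseries_eqI: "(\<And>M. mcoeff f M = mcoeff g M) \<Longrightarrow> f = g"
  by transfer auto

instantiation mseries :: (type) comm_ring_1
begin

lift_definition zero_mseries :: "'a mseries" is "\<lambda>_. 0" .
lift_definition one_mseries :: "'a mseries" is "\<lambda>M. if M = {#} then 1 else 0" .
lift_definition plus_mseries :: "'a mseries \<Rightarrow> 'a mseries \<Rightarrow> 'a mseries"
  is "\<lambda>f g M. f M + g M" .
lift_definition uminus_mseries :: "'a mseries \<Rightarrow> 'a mseries" is "\<lambda>f M. - f M" .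
lift_definition minus_mseries :: "'a mseries \<Rightarrow> 'a mseries \<Rightarrow> 'a mseries"
  is "\<lambda>f g M. f M - g M" .
lift_definition times_mseries :: "'a mseries \<Rightarrow> 'a mseries \<Rightarrow> 'a mseries"
  is "\<lambda>f g M. \<Sum>A | A \<subseteq># M. f A * g (M - A)" .

instance
proof
  have fin: "finite {A. A \<subseteq># M}" for M :: "'a multiset"
  proof -
    have "{A. A \<subseteq># M} \<subseteq> mset ` {xs. set xs \<subseteq> set_mset M \<and> length xs \<le> size M}"
    proof
      fix A assume "A \<in> {A. A \<subseteq># M}"
      then have A: "A \<subseteq># M" by simp
      obtain xs where xs: "mset xs = A" using ex_mset by blast
      have "set xs \<subseteq> set_mset M" using A xs by (metis set_mset_mono set_mset_mset)
      moreover have "length xs \<le> size M" using A xs by (metis size_mset size_mset_mono)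
      ultimately show "A \<in> mset ` {xs. set xs \<subseteq> set_mset M \<and> length xs \<le> size M}"
        using xs by blast
    qed
    moreover have "finite (mset ` {xs. set xs \<subseteq> set_mset M \<and> length xs \<le> size M})"
      by (intro finite_imageI finite_lists_length_le finite_set_mset)
    ultimately show ?thesis by (rule finite_subset)
  qed
  fix a b c :: "'a mseries"
  show "a * b * c = a * (b * c)"
  proof (transfer, rule ext)
    fix f g h :: "'a multiset \<Rightarrow> complex" and M
    have "(\<Sum>A | A \<subseteq># M. (\<Sum>B | B \<subseteq># A. f B * g (A - B)) * h (M - A))
      = (\<Sum>(A, B) \<in> (SIGMA A:{A. A \<subseteq># M}. {B. B \<subseteq># A}). f B * g (A - B) * h (M - A))"
      by (subst sum.Sigma[symmetric]) (auto simp: fin sum_distrib_right)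
    also have "\<dots> = (\<Sum>(B, C) \<in> (SIGMA B:{B. B \<subseteq># M}. {C. C \<subseteq># M - B}).
        f B * g C * h (M - B - C))"
    proof (rule sum.reindex_bij_witness[of _ "\<lambda>(B, C). (B + C, B)" "\<lambda>(A, B). (B, A - B)"], goal_cases)
      case (1 p)
      then show ?case by (cases p) (simp add: subset_mset.add_diff_inverse)
    next
      case (2 p)
      then obtain A B where p: "p = (A, B)" "A \<subseteq># M" "B \<subseteq># A" by (cases p) simp
      then have "B \<subseteq># M" by (meson subset_mset.order_trans)
      moreover have "A - B \<subseteq># M - B"
        using p(2) by (simp add: subseteq_mset_def diff_le_mono)
      ultimately show ?case using p(1) by simp
    next
      case (3 p)
      then show ?case by (cases p) simp
    next
      case (4 p)
      then obtain B C where p: "p = (B, C)" "B \<subseteq># M" "C \<subseteq># M - B" by (cases p) simp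
      have "B + C \<subseteq># M"
      proof (rule mset_subset_eqI)
        fix a
        have "count B a \<le> count M a" "count C a \<le> count M a - count B a"
          using p(2,3) by (simp_all add: subseteq_mset_def)
        then show "count (B + C) a \<le> count M a" by simp
      qed
      then show ?case using p(1) by simp
    next
      case (5 p)
      then obtain A B where p: "p = (A, B)" "A \<subseteq># M" "B \<subseteq># A" by (cases p) simp
      have "M - B - (A - B) = M - A"
        using p(3) by (simp add: subset_mset.add_diff_inverse)
      then show ?case using p(1) by simp
    qed
    also have "\<dots> = (\<Sum>A | A \<subseteq># M. f A * (\<Sum>B | B \<subseteq># M - A. g B * h (M - A - B)))"
      by (subst sum.Sigma[symmetric]) (auto simp: fin sum_distrib_left mult.assoc)
    finally show "(\<Sum>A | A \<subseteq># M. (\<Sum>B | B \<subseteq># A. f B * g (A - B)) * h (M - A))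
      = (\<Sum>A | A \<subseteq># M. f A * (\<Sum>B | B \<subseteq># M - A. g B * h (M - A - B)))" .
  qed
  show "a * b = b * a"
  proof (transfer, rule ext)
    fix f g :: "'a multiset \<Rightarrow> complex" and M
    show "(\<Sum>A | A \<subseteq># M. f A * g (M - A)) = (\<Sum>A | A \<subseteq># M. g A * f (M - A))"
    proof (rule sum.reindex_bij_witness[of _ "\<lambda>A. M - A" "\<lambda>A. M - A"], goal_cases)
      case (3 A)
      then have "M - (M - A) = A" by (simp add: multiset_eq_iff subseteq_mset_def)
      then show ?case by simp
    next
      case (5 A)
      then have "M - (M - A) = A" by (simp add: multiset_eq_iff subseteq_mset_def)
      then show ?case by (simp add: mult.commute)
    qed (simp_all add: multiset_eq_iff subseteq_mset_def)
  qed
  show "1 * a = a"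
  proof (transfer, rule ext)
    fix f :: "'a multiset \<Rightarrow> complex" and M
    have "(\<Sum>A | A \<subseteq># M. (if A = {#} then 1 else 0) * f (M - A))
      = (\<Sum>A \<in> {{#}}. (if A = {#} then 1 else 0) * f (M - A))"
      by (rule sum.mono_neutral_right) (auto simp: fin)
    then show "(\<Sum>A | A \<subseteq># M. (if A = {#} then 1 else 0) * f (M - A)) = f M" by simp
  qed
  show "a + b + c = a + (b + c)" by transfer (simp add: add.assoc)
  show "a + b = b + a" by transfer (simp add: add.commute)
  show "0 + a = a" by transfer simp
  show "- a + a = 0" by transfer simp
  show "a - b = a + - b" by transfer simp
  show "(a + b) * c = a * c + b * c"
    by transfer (simp add: distrib_right sum.distrib)
  show "(0 :: 'a mseries) \<noteq> 1" by transfer (metis zero_neq_one)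
qed

end

lift_definition mconst :: "complex \<Rightarrow> 'v mseries" is "\<lambda>c M. if M = {#} then c else 0" .

datatype var = X nat | Y nat

lift_definition power_sum :: "(nat \<Rightarrow> var) \<Rightarrow> nat \<Rightarrow> var mseries"
  is "\<lambda>z j M. if \<exists>i. M = replicate_mset j (z i) then 1 else 0" .

definition p_plus :: "nat \<Rightarrow> var mseries" where
  "p_plus j = power_sum X j + power_sum Y j"

definition p_minus :: "nat \<Rightarrow> var mseries" where
  "p_minus j = power_sum X j - power_sum Y j"

text \<open>Rows and columns are numbered from 0; a partition may have trailing zeros, so that
  \<open>[0]\<close> is the empty partition.\<close>

definition young_diagram :: "nat list \<Rightarrow> (nat \<times> nat) set" where
  "young_diagram lam = {(i, j). i < length lam \<and> j < lam ! i}"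

definition ssyt :: "nat list \<Rightarrow> (nat \<times> nat \<Rightarrow> nat) set" where
  "ssyt lam = {T \<in> young_diagram lam \<rightarrow>\<^sub>E UNIV.
     (\<forall>i j. (i, Suc j) \<in> young_diagram lam \<longrightarrow> T (i, j) \<le> T (i, Suc j)) \<and>
     (\<forall>i j. (Suc i, j) \<in> young_diagram lam \<longrightarrow> T (i, j) < T (Suc i, j))}"

lift_definition schur :: "(nat \<Rightarrow> var) \<Rightarrow> nat list \<Rightarrow> var mseries"
  is "\<lambda>z lam M. of_nat (card {T \<in> ssyt lam.
        image_mset (\<lambda>c. z (T c)) (mset_set (young_diagram lam)) = M})" .


section \<open>Signed permutations\<close>

text \<open>The barred letter \<open>i\<close> is \<open>- i\<close>. Elements of all the groups are functions on the integers,
  so the subgroup of \<open>signed_perms n\<close> fixing \<open>n\<close> is literally \<open>signed_perms (n - 1)\<close>.\<close>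

definition signed_perms :: "nat \<Rightarrow> (int \<Rightarrow> int) set" where
  "signed_perms n = {w. w permutes ({- int n..int n} - {0}) \<and> (\<forall>i. w (- i) = - w i)}"

definition cycles :: "nat \<Rightarrow> (int \<Rightarrow> int) \<Rightarrow> int set set" where
  "cycles n w = orbit w ` ({- int n..int n} - {0})"

text \<open>A positive pair of cycles is represented by the union of the two cycles, so that half of the
  cardinality is the length for both kinds.\<close>

definition pos_cycles :: "nat \<Rightarrow> (int \<Rightarrow> int) \<Rightarrow> int set set" where
  "pos_cycles n w = {c \<union> uminus ` c | c. c \<in> cycles n w \<and> uminus ` c \<noteq> c}"

definition neg_cycles :: "nat \<Rightarrow> (int \<Rightarrow> int) \<Rightarrow> int set set" where
  "neg_cycles n w = {c \<in> cycles n w. uminus ` c = c}"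

definition signed_cycle_type :: "nat \<Rightarrow> (int \<Rightarrow> int) \<Rightarrow> nat multiset \<times> nat multiset" where
  "signed_cycle_type n w =
     (image_mset (\<lambda>c. card c div 2) (mset_set (pos_cycles n w)),
      image_mset (\<lambda>c. card c div 2) (mset_set (neg_cycles n w)))"

definition cyclic_interval :: "nat \<Rightarrow> int set \<Rightarrow> bool" where
  "cyclic_interval n A \<longleftrightarrow>
     (\<exists>a::int. \<exists>k::nat. (\<lambda>x. x mod int n) ` A = (\<lambda>j. (a + int j) mod int n) ` {..<k})"

definition signed_arc_perms :: "nat \<Rightarrow> (int \<Rightarrow> int) set" where
  "signed_arc_perms n = {w \<in> signed_perms n. \<forall>i \<in> {2..int n - 1}.
     (let A = (\<lambda>j. \<bar>w j\<bar>) ` {1..i - 1} in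
        cyclic_interval n A \<and>
        ((\<exists>a\<in>A. [\<bar>w i\<bar> - 1 = a] (mod int n)) \<longrightarrow> w i > 0) \<and>
        ((\<exists>a\<in>A. [\<bar>w i\<bar> + 1 = a] (mod int n)) \<longrightarrow> w i < 0))}"


section \<open>Signed descent sets, quasisymmetric functions and fine sets\<close>

definition less_r :: "int \<Rightarrow> int \<Rightarrow> bool" where
  "less_r a b \<longleftrightarrow> (a < 0 \<and> b < 0 \<and> \<bar>a\<bar> < \<bar>b\<bar>) \<or> (a < 0 \<and> 0 < b) \<or> (0 < a \<and> 0 < b \<and> a < b)"

text \<open>A signed set is a pair of a set and a sign function with values \<open>1\<close> and \<open>-1\<close>;
  only the values on the set are ever used.\<close>

type_synonym signed_set = "nat set \<times> (nat \<Rightarrow> int)"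

definition sDes :: "nat \<Rightarrow> (int \<Rightarrow> int) \<Rightarrow> signed_set" where
  "sDes n w =
     ({n} \<union> {s \<in> {1..n - 1}. less_r (w (int s + 1)) (w (int s)) \<or>
                              (w (int s) < 0 \<and> w (int s + 1) > 0)},
      \<lambda>s. if w (int s) < 0 then - 1 else 1)"

definition sign_vector :: "signed_set \<Rightarrow> nat \<Rightarrow> int" where
  "sign_vector \<sigma> j = snd \<sigma> (LEAST s. s \<in> fst \<sigma> \<and> j \<le> s)"

definition wDes :: "signed_set \<Rightarrow> nat set" where
  "wDes \<sigma> = {s \<in> fst \<sigma>. (\<exists>t \<in> fst \<sigma>. s < t) \<and>
     (let t = (LEAST t. t \<in> fst \<sigma> \<and> s < t) in
        snd \<sigma> s = snd \<sigma> t \<or> (snd \<sigma> s = 1 \<and> snd \<sigma> t = - 1))}"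

text \<open>The set of sequences counted here is finite, since the monomial bounds the indices.\<close>

lift_definition F_fun :: "nat \<Rightarrow> signed_set \<Rightarrow> var mseries"
  is "\<lambda>n \<sigma> M. of_nat (card {i \<in> {1..n} \<rightarrow>\<^sub>E (UNIV :: nat set).
        (\<forall>j \<in> {1..<n}. i j \<le> i (j + 1)) \<and>
        (\<forall>j \<in> wDes \<sigma>. i j < i (j + 1)) \<and>
        image_mset (\<lambda>j. if sign_vector \<sigma> j = 1 then X (i j) else Y (i j)) (mset_set {1..n}) = M})" .

text \<open>Barred parts are negative.\<close>

definition signed_compositions :: "nat \<Rightarrow> int list set" where
  "signed_compositions n = {\<gamma>. 0 \<notin> set \<gamma> \<and> (\<Sum>c\<leftarrow>\<gamma>. \<bar>c\<bar>) = int n}"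

definition composition_type :: "int list \<Rightarrow> nat multiset \<times> nat multiset" where
  "composition_type \<gamma> =
     (mset (map nat (filter (\<lambda>c. c > 0) \<gamma>)), mset (map (\<lambda>c. nat \<bar>c\<bar>) (filter (\<lambda>c. c < 0) \<gamma>)))"

text \<open>In the following, blocks are numbered from 0: the block \<open>i\<close> is
  \<open>{partial_sum \<gamma> i + 1..partial_sum \<gamma> (i + 1)}\<close>.\<close>

definition partial_sum :: "int list \<Rightarrow> nat \<Rightarrow> nat" where
  "partial_sum \<gamma> i = (\<Sum>c\<leftarrow>take i \<gamma>. nat \<bar>c\<bar>)"

definition block :: "int list \<Rightarrow> nat \<Rightarrow> nat set" where
  "block \<gamma> i = {partial_sum \<gamma> i + 1..partial_sum \<gamma> (i + 1)}"

definition initial_segment :: "nat set \<Rightarrow> nat set \<Rightarrow> bool" where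
  "initial_segment A B \<longleftrightarrow> A \<subseteq> B \<and> (\<forall>a \<in> A. \<forall>b \<in> B. b < a \<longrightarrow> b \<in> A)"

definition wt :: "int list \<Rightarrow> signed_set \<Rightarrow> int" where
  "wt \<gamma> \<sigma> =
     (if \<exists>i < length \<gamma>.
           (let J = {partial_sum \<gamma> i + 1..<partial_sum \<gamma> (i + 1)} in
             \<not> initial_segment (fst \<sigma> \<inter> J) J) \<or>
           \<not> (\<exists>e. \<forall>j \<in> block \<gamma> i. sign_vector \<sigma> j = e)
      then 0
      else (- 1) ^ (card (fst \<sigma> - partial_sum \<gamma> ` {1..length \<gamma>}) +
             card {i. i < length \<gamma> \<and> (\<forall>j \<in> block \<gamma> i. sign_vector \<sigma> j = - 1) \<and> \<gamma> ! i < 0}))"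

definition fine_set :: "nat \<Rightarrow> 'b set \<Rightarrow> ('b \<Rightarrow> signed_set) \<Rightarrow> ((int \<Rightarrow> int) \<Rightarrow> complex) \<Rightarrow> bool" where
  "fine_set n \<B> D \<chi> \<longleftrightarrow> finite \<B> \<and>
     (\<forall>\<gamma> \<in> signed_compositions n. \<forall>w \<in> signed_perms n.
        signed_cycle_type n w = composition_type \<gamma> \<longrightarrow>
        \<chi> w = of_int (\<Sum>b\<in>\<B>. wt \<gamma> (D b)))"


section \<open>Characters\<close>

text \<open>Characters of a group \<open>G\<close> of permutations are functions that vanish outside \<open>G\<close>.\<close>

definition representation ::
    "('a \<Rightarrow> 'a) set \<Rightarrow> nat \<Rightarrow> (('a \<Rightarrow> 'a) \<Rightarrow> complex mat) \<Rightarrow> bool" where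
  "representation G d \<rho> \<longleftrightarrow>
     (\<forall>u \<in> G. \<rho> u \<in> carrier_mat d d) \<and> \<rho> id = 1\<^sub>m d \<and>
     (\<forall>u \<in> G. \<forall>v \<in> G. \<rho> (u \<circ> v) = \<rho> u * \<rho> v)"

definition invariant_subspace ::
    "('a \<Rightarrow> 'a) set \<Rightarrow> nat \<Rightarrow> (('a \<Rightarrow> 'a) \<Rightarrow> complex mat) \<Rightarrow> complex vec set \<Rightarrow> bool" where
  "invariant_subspace G d \<rho> W \<longleftrightarrow>
     W \<subseteq> carrier_vec d \<and> 0\<^sub>v d \<in> W \<and>
     (\<forall>v \<in> W. \<forall>v' \<in> W. v + v' \<in> W) \<and> (\<forall>c. \<forall>v \<in> W. c \<cdot>\<^sub>v v \<in> W) \<and>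
     (\<forall>u \<in> G. \<forall>v \<in> W. \<rho> u *\<^sub>v v \<in> W)"

definition irreducible_representation ::
    "('a \<Rightarrow> 'a) set \<Rightarrow> nat \<Rightarrow> (('a \<Rightarrow> 'a) \<Rightarrow> complex mat) \<Rightarrow> bool" where
  "irreducible_representation G d \<rho> \<longleftrightarrow> representation G d \<rho> \<and> d > 0 \<and>
     (\<forall>W. invariant_subspace G d \<rho> W \<longrightarrow> W = {0\<^sub>v d} \<or> W = carrier_vec d)"

definition irreducible_character :: "('a \<Rightarrow> 'a) set \<Rightarrow> (('a \<Rightarrow> 'a) \<Rightarrow> complex) \<Rightarrow> bool" where
  "irreducible_character G \<chi> \<longleftrightarrow> (\<exists>d \<rho>. irreducible_representation G d \<rho> \<and>
     \<chi> = (\<lambda>u. if u \<in> G then \<Sum>i<d. \<rho> u $$ (i, i) else 0))"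

text \<open>The induced class function, by the Frobenius formula.\<close>

definition induced ::
    "('a \<Rightarrow> 'a) set \<Rightarrow> ('a \<Rightarrow> 'a) set \<Rightarrow> (('a \<Rightarrow> 'a) \<Rightarrow> complex) \<Rightarrow> ('a \<Rightarrow> 'a) \<Rightarrow> complex" where
  "induced H G \<chi> g =
     (if g \<in> G
      then (\<Sum>u | u \<in> G \<and> inv_into UNIV u \<circ> g \<circ> u \<in> H. \<chi> (inv_into UNIV u \<circ> g \<circ> u)) / of_nat (card H)
      else 0)"

definition ch :: "nat \<Rightarrow> ((int \<Rightarrow> int) \<Rightarrow> complex) \<Rightarrow> var mseries" where
  "ch n \<chi> = mconst (1 / (2 ^ n * fact n)) *
     (\<Sum>w \<in> signed_perms n. case signed_cycle_type n w of (\<alpha>, \<beta>) \<Rightarrow>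
        mconst (\<chi> w) * prod_mset (image_mset p_plus \<alpha>) * prod_mset (image_mset p_minus \<beta>))"

definition irr_char :: "nat \<Rightarrow> nat list \<Rightarrow> nat list \<Rightarrow> (int \<Rightarrow> int) \<Rightarrow> complex" where
  "irr_char n lam mu =
     (THE \<chi>. irreducible_character (signed_perms n) \<chi> \<and> ch n \<chi> = schur X lam * schur Y mu)"


section \<open>The exterior algebra\<close>

text \<open>An element of the exterior algebra of the space with basis \<open>e 1, \<dots>, e m\<close> is given by its
  coordinates with respect to the basis elements \<open>e I = e i\<^sub>1 \<and> \<dots> \<and> e i\<^sub>k\<close>, where
  \<open>I = {i\<^sub>1 < \<dots> < i\<^sub>k}\<close> is a subset of \<open>{1..m}\<close>; the sign in the product counts the
  inversions between the two factors.\<close>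

type_synonym ext = "int set \<Rightarrow> complex"

definition ext_basis :: "int set \<Rightarrow> ext" where
  "ext_basis I = (\<lambda>J. if J = I then 1 else 0)"

definition wedge :: "ext \<Rightarrow> ext \<Rightarrow> ext" where
  "wedge f g = (\<lambda>K. \<Sum>I \<in> Pow K.
     (- 1) ^ card {(i, j). i \<in> I \<and> j \<in> K - I \<and> j < i} * f I * g (K - I))"

text \<open>The image of the basis vector \<open>e i\<close> under a signed permutation.\<close>

definition vec_act :: "(int \<Rightarrow> int) \<Rightarrow> int \<Rightarrow> ext" where
  "vec_act w i = (\<lambda>J. of_int (sgn (w i)) * ext_basis {\<bar>w i\<bar>} J)"

definition ext_act :: "nat \<Rightarrow> (int \<Rightarrow> int) \<Rightarrow> ext \<Rightarrow> ext" where
  "ext_act m w f = (\<lambda>J. \<Sum>I \<in> Pow {1..int m}.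
     f I * foldr wedge (map (vec_act w) (sorted_list_of_set I)) (ext_basis {}) J)"

definition ext_char :: "nat \<Rightarrow> (int \<Rightarrow> int) \<Rightarrow> complex" where
  "ext_char m w =
     (if w \<in> signed_perms m then \<Sum>I \<in> Pow {1..int m}. ext_act m w (ext_basis I) I else 0)"

end

theory Submission
  imports Defs "HOL-Combinatorics.Cycles"
begin

text \<open>
  A signed arc permutation is determined by its sign vector \<open>\<epsilon>\<close> and a residue modulo \<open>n\<close>: the
  unbarred letters increase cyclically, the barred ones decrease cyclically. Hence for every \<open>\<epsilon>\<close> the
  \<open>n\<close> signed descent sets are obtained from one basic signed set (descents exactly at the sign changes and
  at the pairs of adjacent barred letters) by toggling, for \<open>s = 1, \<dots>, n\<close>, the position \<open>s\<close> if
  \<open>\<epsilon>(s) = \<epsilon>(s + 1)\<close>, and doing nothing otherwise. Both generating functions are evaluated from this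
  description. The weights sum up to the number of unbarred parts \<open>1\<close> of \<open>\<gamma>\<close> times the product over
  all parts of \<open>1 \<plusminus> (-1)\<^bsup>r-1\<^esup>\<close> (\<open>r\<close> the length of the part, with the minus sign for barred parts), which is the
  induced character, because the character of the exterior algebra is \<open>det (1 + w)\<close>. The quasisymmetric
  functions sum up to the sum of all variables times \<open>\<Sum>\<^sub>k h\<^sub>k(x) e\<^sub>n\<^sub>-\<^sub>1\<^sub>-\<^sub>k(y)\<close>.

  On the other side, the power sum product of \<open>w\<close> is a signed count of the colourings of
  \<open>{1, \<dots>, n}\<close> by variables that are constant on the cycles of \<open>w\<close>. This gives the characteristic
  \<open>h\<^sub>k(x) e\<^sub>j(y)\<close> of the \<open>j\<close>-th exterior power of \<open>V\<^sub>k\<^sub>+\<^sub>j\<close>, which is irreducible because the sign changes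
  separate the basis vectors and the permutations act transitively on them, and it shows that class functions are
  determined by their characteristics.
\<close>

section \<open>The hyperoctahedral group\<close>

text \<open>Every question about signed permutations is reduced to the plain permutation
  \<open>unsigned w\<close> of the positive letters together with the signs of the values of
  \<open>w\<close>: a cycle of \<open>unsigned w\<close> along which the signs multiply to
  \<open>1\<close> stands for a pair of positive cycles of \<open>w\<close>, one with product
  \<open>- 1\<close> for a negative cycle. The two halves of the theorem are computed independently,
  without a passage from weights to quasisymmetric functions; they share only the toggle description
  of the descents. The obstacle in the second half is that \<open>irr_char\<close> is a definite
  description: a representation with the prescribed characteristic has to be exhibited and shown to
  be irreducible, and its character has to be the only irreducible one with that characteristic.
  Instead of orthogonality of characters, uniqueness uses the injectivity of \<open>ch\<close> on
  class functions, which is triangular with respect to the number of cycles. Induction becomes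
  multiplication by \<open>p_plus 1\<close>, because an element of the stabilizer of
  \<open>n\<close> gains one positive fixed point in the larger group.\<close>

definition unsigned :: "(int \<Rightarrow> int) \<Rightarrow> int \<Rightarrow> int" where
  "unsigned w i = sgn i * \<bar>w i\<bar>"

definition odd_extension :: "nat \<Rightarrow> (int \<Rightarrow> int) \<Rightarrow> int \<Rightarrow> int" where
  "odd_extension n f i = (if \<bar>i\<bar> \<in> {1..int n} then sgn i * f \<bar>i\<bar> else i)"

lemma signed_permsD:
  assumes "w \<in> signed_perms n"
  shows "w permutes ({- int n..int n} - {0})" "w (- i) = - w i" "w 0 = 0" "inj w"
proof -
  show p: "w permutes ({- int n..int n} - {0})" and "w (- i) = - w i"
    using assms by (auto simp: signed_perms_def)
  show "w 0 = 0" using permutes_not_in[OF p] by simp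
  show "inj w" using permutes_inj[OF p] .
qed

lemma signed_perms_eq_0_iff: "w \<in> signed_perms n \<Longrightarrow> w i = 0 \<longleftrightarrow> i = 0"
  using inj_eq[OF signed_permsD(4), of w n i 0] signed_permsD(3) by auto

lemma signed_perms_abs_mem:
  assumes "w \<in> signed_perms n" shows "\<bar>w i\<bar> \<in> {1..int n} \<longleftrightarrow> \<bar>i\<bar> \<in> {1..int n}"
proof -
  have "x \<in> {- int n..int n} - {0} \<longleftrightarrow> \<bar>x\<bar> \<in> {1..int n}" for x by auto
  then show ?thesis using permutes_in_image[OF signed_permsD(1)[OF assms]] by metis
qed

lemma signed_perms_outside:
  assumes "w \<in> signed_perms n" "\<bar>i\<bar> \<notin> {1..int n}" shows "w i = i"
proof -
  have "i \<notin> {- int n..int n} - {0}" using assms(2) by auto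
  then show ?thesis by (rule permutes_not_in[OF signed_permsD(1)[OF assms(1)]])
qed

lemma signed_perms_abs: "w \<in> signed_perms n \<Longrightarrow> \<bar>w \<bar>i\<bar>\<bar> = \<bar>w i\<bar>"
  by (simp add: abs_if signed_permsD(2))

lemma signed_perms_sgn_mult: "w \<in> signed_perms n \<Longrightarrow> w (sgn x * i) = sgn x * w i"
  using signed_permsD(2,3) by (cases x "0::int" rule: linorder_cases) auto

lemma signed_perms_sgn_abs: "w \<in> signed_perms n \<Longrightarrow> w i = sgn i * w \<bar>i\<bar>"
  using signed_perms_sgn_mult[of w n i "\<bar>i\<bar>"] by (simp add: mult_sgn_abs)

lemma signed_perms_id: "id \<in> signed_perms n"
  by (simp add: signed_perms_def permutes_id)

lemma signed_perms_comp: "u \<in> signed_perms n \<Longrightarrow> v \<in> signed_perms n \<Longrightarrow> u \<circ> v \<in> signed_perms n"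
  by (auto simp: signed_perms_def intro: permutes_compose)

lemma signed_perms_inv:
  assumes "u \<in> signed_perms n" shows "inv_into UNIV u \<in> signed_perms n"
proof -
  have p: "u permutes ({- int n..int n} - {0})" using assms signed_permsD(1) by blast
  have "inv_into UNIV u (- i) = - inv_into UNIV u i" for i
    using permutes_inverses[OF p] signed_permsD(2)[OF assms] by (metis permutes_inv_eq[OF p])
  then show ?thesis using permutes_inv[OF p] by (simp add: signed_perms_def)
qed

lemma signed_perms_inv_comp:
  assumes "u \<in> signed_perms n"
  shows "inv_into UNIV u \<circ> u = id" "u \<circ> inv_into UNIV u = id"
  using permutes_inv_o[OF signed_permsD(1)[OF assms]] by auto

lemma finite_signed_perms: "finite (signed_perms n)"
proof (rule finite_subset)
  show "signed_perms n \<subseteq> {w. w permutes ({- int n..int n} - {0})}"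
    by (auto simp: signed_perms_def)
qed (simp add: finite_permutations)

text \<open>The odd extension maps a finite set to itself, so injectivity is enough. Equal values at
  \<open>x\<close> and \<open>y\<close> first give \<open>\<bar>x\<bar> = \<bar>y\<bar>\<close>, and
  then equal signs because \<open>f\<close> does not vanish there.\<close>

lemma odd_extension_signed_perm:
  assumes "\<And>i. i \<in> {1..int n} \<Longrightarrow> \<bar>f i\<bar> \<in> {1..int n}" "inj_on (\<lambda>i. \<bar>f i\<bar>) {1..int n}"
  shows "odd_extension n f \<in> signed_perms n"
proof -
  let ?S = "{- int n..int n} - {0}"
  have S: "x \<in> ?S \<longleftrightarrow> \<bar>x\<bar> \<in> {1..int n}" for x by auto
  have into: "odd_extension n f ` ?S \<subseteq> ?S"
  proof
    fix y assume "y \<in> odd_extension n f ` ?S"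
    then obtain x where x: "\<bar>x\<bar> \<in> {1..int n}" "y = odd_extension n f x" using S by blast
    then have "\<bar>y\<bar> = \<bar>f \<bar>x\<bar>\<bar>" by (auto simp: odd_extension_def abs_mult)
    then show "y \<in> ?S" using assms(1)[OF x(1)] S by metis
  qed
  have inj: "inj_on (odd_extension n f) ?S"
  proof (rule inj_onI)
    fix x y assume xy: "x \<in> ?S" "y \<in> ?S" "odd_extension n f x = odd_extension n f y"
    then have m: "\<bar>x\<bar> \<in> {1..int n}" "\<bar>y\<bar> \<in> {1..int n}" using S by blast+
    then have e: "sgn x * f \<bar>x\<bar> = sgn y * f \<bar>y\<bar>" using xy(3) by (simp add: odd_extension_def)
    then have "\<bar>f \<bar>x\<bar>\<bar> = \<bar>f \<bar>y\<bar>\<bar>" using m by (auto simp: sgn_if split: if_splits)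
    then have a: "\<bar>x\<bar> = \<bar>y\<bar>" using inj_onD[OF assms(2) _ m] by simp
    moreover have "f \<bar>x\<bar> \<noteq> 0" using assms(1)[OF m(1)] by auto
    ultimately have "sgn x = sgn y" using e by simp
    then show "x = y" using a by (metis mult_sgn_abs)
  qed
  have "bij_betw (odd_extension n f) ?S ?S"
    using inj into by (simp add: bij_betw_def endo_inj_surj)
  then have "odd_extension n f permutes ?S"
    by (rule bij_imp_permutes) (use S in \<open>auto simp: odd_extension_def\<close>)
  moreover have "odd_extension n f (- i) = - odd_extension n f i" for i
    by (auto simp: odd_extension_def)
  ultimately show ?thesis by (simp add: signed_perms_def)
qed

lemma odd_extension_eq: "i \<in> {1..int n} \<Longrightarrow> odd_extension n f i = f i"
  by (simp add: odd_extension_def)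

lemma signed_perms_eqI:
  assumes "u \<in> signed_perms n" "v \<in> signed_perms n" "\<And>i. i \<in> {1..int n} \<Longrightarrow> u i = v i"
  shows "u = v"
proof
  fix i show "u i = v i"
  proof (cases "\<bar>i\<bar> \<in> {1..int n}")
    case True
    then show ?thesis
      using assms signed_perms_sgn_abs[OF assms(1), of i] signed_perms_sgn_abs[OF assms(2), of i]
      by simp
  next
    case False
    then show ?thesis using signed_perms_outside assms(1,2) by metis
  qed
qed

lemma abs_image_signed_perm:
  assumes "w \<in> signed_perms n" shows "inj_on (\<lambda>i. \<bar>w i\<bar>) {1..int n}"
    "(\<lambda>i. \<bar>w i\<bar>) ` {1..int n} = {1..int n}"
proof -
  show *: "inj_on (\<lambda>i. \<bar>w i\<bar>) {1..int n}"
  proof (rule inj_onI)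
    fix x y assume xy: "x \<in> {1..int n}" "y \<in> {1..int n}" "\<bar>w x\<bar> = \<bar>w y\<bar>"
    then have "w x = w y \<or> w x = w (- y)" using signed_permsD(2)[OF assms] by (auto simp: abs_eq_iff)
    then have "x = y \<or> x = - y" using signed_permsD(4)[OF assms] by (auto dest: injD)
    then show "x = y" using xy by auto
  qed
  have "(\<lambda>i. \<bar>w i\<bar>) ` {1..int n} \<subseteq> {1..int n}"
    using signed_perms_abs_mem[OF assms] by auto
  then show "(\<lambda>i. \<bar>w i\<bar>) ` {1..int n} = {1..int n}"
    using * by (simp add: endo_inj_surj)
qed

lemma unsigned_eq: "0 < i \<Longrightarrow> unsigned w i = \<bar>w i\<bar>"
  by (simp add: unsigned_def)

lemma abs_unsigned: "w \<in> signed_perms n \<Longrightarrow> \<bar>unsigned w i\<bar> = \<bar>w i\<bar>"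
  using signed_permsD(3) by (auto simp: unsigned_def abs_mult sgn_if)

lemma unsigned_signed_perm:
  assumes "w \<in> signed_perms n" shows "unsigned w \<in> signed_perms n"
proof -
  have "unsigned w = odd_extension n (\<lambda>i. \<bar>w i\<bar>)"
    using signed_perms_outside[OF assms] signed_perms_abs[OF assms]
    by (auto simp: unsigned_def odd_extension_def fun_eq_iff mult_sgn_abs)
  then show ?thesis
    using odd_extension_signed_perm[of n "\<lambda>i. \<bar>w i\<bar>"] abs_image_signed_perm[OF assms]
      signed_perms_abs_mem[OF assms] by auto
qed

text \<open>The sign of \<open>v i\<close> only affects the sign of \<open>u (v i)\<close>, which
  the absolute value forgets. Hence \<open>unsigned\<close> is a group homomorphism onto the
  permutations without bars.\<close>

lemma unsigned_comp:
  assumes "u \<in> signed_perms n" "v \<in> signed_perms n"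
  shows "unsigned (u \<circ> v) = unsigned u \<circ> unsigned v"
proof
  fix i
  have "sgn (unsigned v i) = sgn i"
    using signed_perms_eq_0_iff[OF assms(2), of i]
    by (auto simp: unsigned_def sgn_mult sgn_if)
  moreover have "\<bar>u (unsigned v i)\<bar> = \<bar>u (v i)\<bar>"
    by (metis signed_perms_abs[OF assms(1)] abs_unsigned[OF assms(2)])
  ultimately show "unsigned (u \<circ> v) i = (unsigned u \<circ> unsigned v) i"
    by (simp add: unsigned_def)
qed

lemma unsigned_id: "unsigned id = id"
  by (auto simp: unsigned_def mult_sgn_abs)

lemma unsigned_permutes_image:
  assumes "w \<in> signed_perms n" shows "unsigned w ` {1..int n} = {1..int n}"
  using abs_image_signed_perm(2)[OF assms] by (simp add: unsigned_eq)

lemma unsigned_pos: "w \<in> signed_perms n \<Longrightarrow> 0 < i \<Longrightarrow> 0 < unsigned w i"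
  using signed_perms_eq_0_iff[of w n i] by (simp add: unsigned_eq)

lemma unsigned_mem: "w \<in> signed_perms n \<Longrightarrow> i \<in> {1..int n} \<Longrightarrow> unsigned w i \<in> {1..int n}"
  using unsigned_permutes_image by blast

lemma signed_perms_sgn_unsigned:
  "w \<in> signed_perms n \<Longrightarrow> 0 < i \<Longrightarrow> w i = sgn (w i) * unsigned w i"
  by (simp add: unsigned_eq sgn_mult_abs)

section \<open>The stabilizer of \<open>n\<close>, its cosets and the order of the group\<close>

lemma signed_perms_stabilizer:
  assumes "n \<ge> 1"
  shows "signed_perms (n - 1) = {u \<in> signed_perms n. u (int n) = int n}"
proof -
  let ?S = "{- int n..int n} - {0}" and ?T = "{- int (n - 1)..int (n - 1)} - {0}"
  have sub: "?T \<subseteq> ?S" by auto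
  have "u permutes ?T \<longleftrightarrow> u permutes ?S \<and> u (int n) = int n" if odd: "\<forall>i. u (- i) = - u i" for u
  proof
    assume "u permutes ?T"
    then show "u permutes ?S \<and> u (int n) = int n"
      using permutes_subset[OF _ sub] assms by (auto intro: permutes_not_in simp: of_nat_diff)
  next
    assume u: "u permutes ?S \<and> u (int n) = int n"
    have "\<forall>x\<in>?S - ?T. u x = x"
    proof
      fix x assume "x \<in> ?S - ?T"
      then have "x = int n \<or> x = - int n" using assms by auto
      then show "u x = x" using u odd by auto
    qed
    then show "u permutes ?T" using u permutes_superset[of u ?S ?T] by blast
  qed
  then show ?thesis by (auto simp: signed_perms_def)
qed

lemma signed_perms_transitive:
  assumes "n \<ge> 1" "\<bar>a\<bar> \<in> {1..int n}"
  obtains u where "u \<in> signed_perms n" "u (int n) = a"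
proof -
  \<comment> \<open>The transposition of \<open>n\<close> and \<open>\<bar>a\<bar>\<close>, with the
    sign of \<open>a\<close> put on the image of \<open>n\<close>. If
    \<open>\<bar>a\<bar> = n\<close> the first case takes precedence.\<close>
  let ?f = "\<lambda>i. if i = int n then a else if i = \<bar>a\<bar> then int n else i"
  have "odd_extension n ?f \<in> signed_perms n"
  proof (rule odd_extension_signed_perm)
    show "\<bar>?f i\<bar> \<in> {1..int n}" if "i \<in> {1..int n}" for i using assms that by simp
    show "inj_on (\<lambda>i. \<bar>?f i\<bar>) {1..int n}"
    proof (rule inj_onI)
      fix x y assume "x \<in> {1..int n}" "y \<in> {1..int n}" "\<bar>?f x\<bar> = \<bar>?f y\<bar>"
      then show "x = y" by (simp split: if_splits)
    qed
  qed
  moreover have "odd_extension n ?f (int n) = a" using assms by (simp add: odd_extension_eq)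
  ultimately show ?thesis using that by blast
qed

text \<open>The elements that send \<open>n\<close> to \<open>a\<close> form a left coset of the
  stabilizer of \<open>n\<close>.\<close>

lemma card_signed_perms_coset:
  assumes "n \<ge> 1" "\<bar>a\<bar> \<in> {1..int n}"
  shows "card {u \<in> signed_perms n. u (int n) = a} = card (signed_perms (n - 1))"
proof -
  obtain u0 where u0: "u0 \<in> signed_perms n" "u0 (int n) = a"
    using signed_perms_transitive[OF assms] .
  let ?v = "inv_into UNIV u0"
  have v: "?v \<in> signed_perms n" "?v \<circ> u0 = id" "u0 \<circ> ?v = id"
    using signed_perms_inv[OF u0(1)] signed_perms_inv_comp[OF u0(1)] by auto
  have "bij_betw (\<lambda>h. u0 \<circ> h) {u \<in> signed_perms n. u (int n) = int n} {u \<in> signed_perms n. u (int n) = a}"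
  proof (rule bij_betw_byWitness[where f' = "\<lambda>u. ?v \<circ> u"])
    show "\<forall>h\<in>{u \<in> signed_perms n. u (int n) = int n}. ?v \<circ> (u0 \<circ> h) = h"
      by (metis comp_assoc v(2) fun.map_id comp_id id_comp)
    show "\<forall>h\<in>{u \<in> signed_perms n. u (int n) = a}. u0 \<circ> (?v \<circ> h) = h"
      by (metis comp_assoc v(3) id_comp)
    show "(\<lambda>h. u0 \<circ> h) ` {u \<in> signed_perms n. u (int n) = int n} \<subseteq> {u \<in> signed_perms n. u (int n) = a}"
      using u0 by (auto intro: signed_perms_comp)
    show "(\<lambda>u. ?v \<circ> u) ` {u \<in> signed_perms n. u (int n) = a} \<subseteq> {u \<in> signed_perms n. u (int n) = int n}"
      using u0 v by (auto intro: signed_perms_comp simp: fun_eq_iff)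
  qed
  then show ?thesis
    unfolding signed_perms_stabilizer[OF assms(1)] by (simp add: bij_betw_same_card)
qed

lemma card_signed_perms: "card (signed_perms n) = 2 ^ n * fact n"
proof (induction n)
  case 0
  have "signed_perms 0 = {id}"
    using signed_perms_id signed_perms_eqI[of _ 0] by (auto simp: signed_perms_id)
  then show ?case by simp
next
  case (Suc n)
  let ?S = "{- int (Suc n)..int (Suc n)} - {0}"
  have S: "x \<in> ?S \<longleftrightarrow> \<bar>x\<bar> \<in> {1..int (Suc n)}" for x by auto
  have eq: "signed_perms (Suc n) = (\<Union>a\<in>?S. {u \<in> signed_perms (Suc n). u (int (Suc n)) = a})"
  proof -
    have "u (int (Suc n)) \<in> ?S" if "u \<in> signed_perms (Suc n)" for u
      unfolding S using signed_perms_abs_mem[OF that] by auto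
    then show ?thesis by auto
  qed
  have "card (signed_perms (Suc n)) = (\<Sum>a\<in>?S. card {u \<in> signed_perms (Suc n). u (int (Suc n)) = a})"
    by (subst eq, rule card_UN_disjoint) (auto simp: finite_signed_perms)
  also have "\<dots> = (\<Sum>a\<in>?S. card (signed_perms n))"
  proof (intro sum.cong refl)
    fix a assume "a \<in> ?S"
    then have "\<bar>a\<bar> \<in> {1..int (Suc n)}" using S by blast
    then show "card {u \<in> signed_perms (Suc n). u (int (Suc n)) = a} = card (signed_perms n)"
      using card_signed_perms_coset[of "Suc n" a] by simp
  qed
  also have "\<dots> = 2 * Suc n * card (signed_perms n)"
  proof -
    have "card ?S = 2 * Suc n" by (simp add: card_Diff_singleton)
    then show ?thesis by simp
  qed
  finally show ?case using Suc by (simp add: algebra_simps)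
qed

section \<open>Inversion signs and the exterior algebra\<close>

text \<open>For \<open>a\<close> injective on \<open>I\<close> this is the parity of the number of
  inversions of \<open>a\<close> on \<open>I\<close>. The set need not be mapped to itself, as it
  would be for the sign of a permutation.\<close>

definition inv_sign :: "(int \<Rightarrow> int) \<Rightarrow> int set \<Rightarrow> int" where
  "inv_sign a I = (\<Prod>i\<in>I. \<Prod>j\<in>I. if i < j then sgn (a j - a i) else 1)"

text \<open>The coefficient with which \<open>w\<close> carries the basis element \<open>e I\<close>
  to the one of the image of \<open>I\<close> under \<open>unsigned w\<close>.\<close>

definition ext_sign :: "(int \<Rightarrow> int) \<Rightarrow> int set \<Rightarrow> int" where
  "ext_sign w I = (\<Prod>i\<in>I. sgn (w i)) * inv_sign (unsigned w) I"

lemma inv_sign_empty [simp]: "inv_sign a {} = 1"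
  by (simp add: inv_sign_def)

lemma inv_sign_cong: "(\<And>i. i \<in> I \<Longrightarrow> a i = b i) \<Longrightarrow> inv_sign a I = inv_sign b I"
  unfolding inv_sign_def by (intro prod.cong refl) simp

text \<open>The product \<open>(a i - a x) * (i - x)\<close> is symmetric in the pair, so that its
  sign detects an inversion without a case distinction on the position of \<open>x\<close> in
  \<open>I\<close>.\<close>

lemma inv_sign_insert:
  assumes "finite I" "x \<notin> I"
  shows "inv_sign a (insert x I) = inv_sign a I * (\<Prod>i\<in>I. sgn ((a i - a x) * (i - x)))"
proof -
  have "sgn ((a i - a x) * (i - x))
      = (if i < x then sgn (a x - a i) else 1) * (if x < i then sgn (a i - a x) else 1)"
    if "i \<in> I" for i
    using that assms(2) by (cases i x rule: linorder_cases) (auto simp: sgn_mult minus_diff_eq[of "a i", symmetric] sgn_minus simp del: minus_diff_eq)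
  then have "(\<Prod>i\<in>I. sgn ((a i - a x) * (i - x)))
      = (\<Prod>i\<in>I. if i < x then sgn (a x - a i) else 1) * (\<Prod>i\<in>I. if x < i then sgn (a i - a x) else 1)"
    by (simp add: prod.distrib)
  then show ?thesis
    using assms by (simp add: inv_sign_def prod.distrib)
qed

text \<open>For \<open>i \<noteq> x\<close> the difference \<open>c i - c x\<close> is nonzero by
  injectivity, and its sign can be inserted twice. This splits each pair factor of the composite
  into one for \<open>a\<close> at the images and one for \<open>c\<close>.\<close>

lemma inv_sign_comp:
  assumes "finite I" "inj_on c I"
  shows "inv_sign (a \<circ> c) I = inv_sign a (c ` I) * inv_sign c I"
  using assms
proof (induction I rule: finite_induct)
  case (insert x I)
  have nx: "c x \<notin> c ` I" and inj: "inj_on c I" using insert by auto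
  have "(\<Prod>i\<in>I. sgn (((a \<circ> c) i - (a \<circ> c) x) * (i - x)))
      = (\<Prod>i\<in>I. sgn ((a (c i) - a (c x)) * (c i - c x)) * sgn ((c i - c x) * (i - x)))"
  proof (rule prod.cong[OF refl])
    fix i assume "i \<in> I"
    then have "c i \<noteq> c x" using nx by (metis imageI)
    then have "sgn (c i - c x) * sgn (c i - c x) = 1" by (auto simp: sgn_if)
    then show "sgn (((a \<circ> c) i - (a \<circ> c) x) * (i - x))
      = sgn ((a (c i) - a (c x)) * (c i - c x)) * sgn ((c i - c x) * (i - x))"
      by (simp add: sgn_mult)
  qed
  also have "\<dots> = (\<Prod>i\<in>c ` I. sgn ((a i - a (c x)) * (i - c x))) * (\<Prod>i\<in>I. sgn ((c i - c x) * (i - x)))"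
    by (simp add: prod.distrib prod.reindex[OF inj])
  finally have "(\<Prod>i\<in>I. sgn (((a \<circ> c) i - (a \<circ> c) x) * (i - x))) = \<dots>" .
  then show ?case
    unfolding image_insert inv_sign_insert[OF insert(1,2)]
      inv_sign_insert[OF finite_imageI[OF insert(1)] nx] insert.IH[OF inj]
    by (simp only: ac_simps)
qed simp

lemma inv_sign_Un:
  assumes "finite A" "finite B" "A \<inter> B = {}"
  shows "inv_sign a (A \<union> B)
    = inv_sign a A * inv_sign a B * (\<Prod>x\<in>A. \<Prod>y\<in>B. sgn ((a y - a x) * (y - x)))"
  using assms
proof (induction A rule: finite_induct)
  case (insert x A)
  have "inv_sign a (insert x A \<union> B) = inv_sign a (A \<union> B) * (\<Prod>i\<in>A \<union> B. sgn ((a i - a x) * (i - x)))"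
    using insert by (simp add: inv_sign_insert)
  also have "(\<Prod>i\<in>A \<union> B. sgn ((a i - a x) * (i - x)))
      = (\<Prod>i\<in>A. sgn ((a i - a x) * (i - x))) * (\<Prod>i\<in>B. sgn ((a i - a x) * (i - x)))"
    using insert by (intro prod.union_disjoint) auto
  finally show ?case using insert by (simp add: inv_sign_insert ac_simps)
qed simp

text \<open>Reindexing by \<open>a\<close>, which permutes both sets, turns the product of the signs
  of \<open>a y - a x\<close> over all mixed pairs into that of the signs of \<open>y - x\<close>.
  The mixed factor is therefore a square.\<close>

lemma inv_sign_Un_invariant:
  assumes "finite A" "finite B" "A \<inter> B = {}" "a ` A = A" "a ` B = B"
  shows "inv_sign a (A \<union> B) = inv_sign a A * inv_sign a B"
proof -
  have inj: "inj_on a A" "inj_on a B" using assms by (auto intro: eq_card_imp_inj_on)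
  have "(\<Prod>x\<in>A. \<Prod>y\<in>B. sgn (a y - a x)) = (\<Prod>x\<in>a ` A. \<Prod>y\<in>a ` B. sgn (y - x))"
    by (simp add: prod.reindex[OF inj(1)] prod.reindex[OF inj(2)])
  then have "(\<Prod>x\<in>A. \<Prod>y\<in>B. sgn ((a y - a x) * (y - x)))
      = (\<Prod>x\<in>A. \<Prod>y\<in>B. sgn (y - x) * sgn (y - x))"
    using assms by (simp only: sgn_mult prod.distrib)
  also have "\<dots> = 1"
  proof (intro prod.neutral ballI)
    fix x y assume "x \<in> A" "y \<in> B"
    then have "x \<noteq> y" using assms by auto
    then show "sgn (y - x) * sgn (y - x) = 1" by (auto simp: sgn_if)
  qed
  finally show ?thesis using inv_sign_Un[OF assms(1-3)] by simp
qed

lemma inv_sign_id: "finite I \<Longrightarrow> (\<And>i. i \<in> I \<Longrightarrow> a i = i) \<Longrightarrow> inv_sign a I = 1"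
  unfolding inv_sign_def by (intro prod.neutral ballI) auto

text \<open>For a third element the factors with \<open>p\<close> and with \<open>q\<close> agree,
  since the transposition exchanges the two differences of images. Only the pair \<open>p\<close>,
  \<open>q\<close> itself contributes a sign.\<close>

lemma inv_sign_transpose:
  assumes "finite I" "p \<in> I" "q \<in> I" "p \<noteq> q"
  shows "inv_sign (transpose p q) I = - 1"
proof -
  define J where "J = I - {p, q}"
  have J: "I = insert p (insert q J)" "p \<notin> insert q J" "q \<notin> J" "finite J" "p \<notin> J"
    using assms by (auto simp: J_def)
  let ?t = "transpose p q"
  have fixed: "?t i = i" if "i \<in> J" for i using that J by (intro transpose_apply_other) auto
  have 1: "inv_sign ?t J = 1" using J fixed by (intro inv_sign_id) auto
  have 2: "(\<Prod>i\<in>J. sgn ((?t i - ?t q) * (i - q))) * (\<Prod>i\<in>J. sgn ((?t i - ?t p) * (i - p))) = 1"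
    unfolding prod.distrib[symmetric]
  proof (intro prod.neutral ballI)
    fix i assume i: "i \<in> J"
    then have "i \<noteq> p" "i \<noteq> q" using J by auto
    then show "sgn ((?t i - ?t q) * (i - q)) * sgn ((?t i - ?t p) * (i - p)) = 1"
      using fixed[OF i] by (auto simp: sgn_mult sgn_if mult.commute)
  qed
  have 3: "sgn ((?t q - ?t p) * (q - p)) = - 1"
    using assms by (cases p q rule: linorder_cases) (auto simp: sgn_mult)
  have "inv_sign ?t I = inv_sign ?t J * (\<Prod>i\<in>J. sgn ((?t i - ?t q) * (i - q)))
      * (sgn ((?t q - ?t p) * (q - p)) * (\<Prod>i\<in>J. sgn ((?t i - ?t p) * (i - p))))"
    unfolding J(1) using J(2-5) by (simp only: inv_sign_insert finite_insert prod.insert mult.assoc simp_thms)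
  also have "\<dots> = - 1" unfolding 1 3 using 2 by simp
  finally show ?thesis .
qed

text \<open>A cycle is a transposition composed with the cycle on the tail of the list. The latter
  fixes the new head, so enlarging its index set by the head does not change its sign, and each list
  element after the first costs one factor \<open>- 1\<close>.\<close>

lemma inv_sign_cycle_of_list:
  "distinct cs \<Longrightarrow> inv_sign (cycle_of_list cs) (set cs) = (- 1) ^ (length cs - 1)"
proof (induction cs rule: cycle_of_list.induct)
  case (1 i j cs)
  let ?c = "cycle_of_list (j # cs)" and ?I = "set (j # cs)"
  have c: "?c permutes ?I" by (rule cycle_permutes)
  have ci: "?c i = i" using c 1(2) by (intro permutes_not_in) auto
  have "inv_sign ?c ({i} \<union> ?I) = inv_sign ?c {i} * inv_sign ?c ?I"
    using 1(2) ci permutes_image[OF c] by (intro inv_sign_Un_invariant) auto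
  also have "inv_sign ?c {i} = 1" using ci by (intro inv_sign_id) auto
  finally have 2: "inv_sign ?c (set (i # j # cs)) = (- 1) ^ (length (j # cs) - 1)"
    using 1 by (simp add: insert_commute)
  have im: "?c ` set (i # j # cs) = set (i # j # cs)"
    using permutes_image[OF c] ci by simp
  have "inv_sign (transpose i j \<circ> ?c) (set (i # j # cs))
      = inv_sign (transpose i j) (?c ` set (i # j # cs)) * inv_sign ?c (set (i # j # cs))"
    using inj_on_subset[OF permutes_inj[OF c] subset_UNIV] finite_set by (intro inv_sign_comp)
  also have "inv_sign (transpose i j) (?c ` set (i # j # cs)) = - 1"
    unfolding im using 1(2) by (intro inv_sign_transpose) auto
  finally show ?case using 2 by simp
qed (auto simp: inv_sign_def)

lemma orbit_eq_set_support:
  assumes "permutation p" shows "orbit p x = set (support p x)"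
proof -
  have "orbit p x = {(p ^^ k) x |k. True}" using orbit_altdef_permutation[OF assms] by simp
  moreover have "(p ^^ k) x \<in> set (support p x)" for k
    using support_set[OF assms, of x] by auto
  ultimately show ?thesis by fastforce
qed

lemma inv_sign_orbit:
  assumes "permutation p" shows "inv_sign p (orbit p x) = (- 1) ^ (card (orbit p x) - 1)"
proof -
  note o = orbit_eq_set_support[OF assms, of x]
  have "inv_sign p (orbit p x) = inv_sign (cycle_of_list (support p x)) (set (support p x))"
    unfolding o by (rule inv_sign_cong) (use cycle_restrict[OF assms] in blast)
  also have "\<dots> = (- 1) ^ (length (support p x) - 1)"
    using cycle_of_permutation[OF assms] by (rule inv_sign_cycle_of_list)
  also have "length (support p x) = card (orbit p x)"
    unfolding o using cycle_of_permutation[OF assms] distinct_card by metis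
  finally show ?thesis .
qed

text \<open>This cocycle identity is what makes the monomial matrices of the exterior powers
  multiply correctly.\<close>

lemma ext_sign_comp:
  assumes "u \<in> signed_perms n" "v \<in> signed_perms n" "I \<subseteq> {1..int n}"
  shows "ext_sign (u \<circ> v) I = ext_sign u (unsigned v ` I) * ext_sign v I"
proof -
  have fin: "finite I" using assms(3) finite_subset by blast
  have inj: "inj_on (unsigned v) I"
    using signed_permsD(4)[OF unsigned_signed_perm[OF assms(2)]] inj_on_subset by blast
  have "(\<Prod>i\<in>I. sgn ((u \<circ> v) i)) = (\<Prod>i\<in>I. sgn (u (unsigned v i)) * sgn (v i))"
  proof (rule prod.cong[OF refl])
    fix i assume "i \<in> I"
    then have "i > 0" using assms(3) by auto
    then have "u (v i) = sgn (v i) * u (unsigned v i)"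
      using signed_perms_sgn_unsigned[OF assms(2)] signed_perms_sgn_mult[OF assms(1)] by metis
    then show "sgn ((u \<circ> v) i) = sgn (u (unsigned v i)) * sgn (v i)"
      by (simp add: sgn_mult mult.commute)
  qed
  also have "\<dots> = (\<Prod>i\<in>unsigned v ` I. sgn (u i)) * (\<Prod>i\<in>I. sgn (v i))"
    by (simp add: prod.distrib prod.reindex[OF inj])
  finally show ?thesis
    unfolding ext_sign_def unsigned_comp[OF assms(1,2)] inv_sign_comp[OF fin inj]
    by (simp add: ac_simps)
qed

section \<open>Signed permutations acting on the basis of the exterior algebra\<close>

lemma prod_sgn_diff:
  fixes y :: int
  assumes "finite K" "y \<notin> K"
  shows "(\<Prod>k\<in>K. sgn (k - y)) = (- 1) ^ card {k \<in> K. k < y}"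
  using assms
proof (induction K rule: finite_induct)
  case (insert x K)
  have "{k \<in> insert x K. k < y} = (if x < y then insert x {k \<in> K. k < y} else {k \<in> K. k < y})" by auto
  then show ?case using insert by (auto simp: sgn_if)
qed simp

text \<open>In the sum that defines \<open>wedge\<close> only the subset \<open>{y}\<close>
  survives, and its inversions are the elements of \<open>K\<close> that \<open>y\<close> has to
  pass.\<close>

lemma wedge_basis:
  assumes "finite K" "y \<notin> K"
  shows "wedge (\<lambda>J. b * ext_basis {y} J) (\<lambda>J. c * ext_basis K J)
    = (\<lambda>J. b * c * (- 1) ^ card {k \<in> K. k < y} * ext_basis (insert y K) J)"
proof
  fix J
  show "wedge (\<lambda>J. b * ext_basis {y} J) (\<lambda>J. c * ext_basis K J) J
    = b * c * (- 1) ^ card {k \<in> K. k < y} * ext_basis (insert y K) J"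
  proof (cases "J = insert y K")
    case True
    have "wedge (\<lambda>J. b * ext_basis {y} J) (\<lambda>J. c * ext_basis K J) J
      = (\<Sum>I\<in>{{y}}. (- 1) ^ card {(i, j). i \<in> I \<and> j \<in> J - I \<and> j < i}
           * (b * ext_basis {y} I) * (c * ext_basis K (J - I)))"
      unfolding wedge_def
      by (rule sum.mono_neutral_right) (use True assms in \<open>auto simp: ext_basis_def\<close>)
    moreover have "{(i, j). i \<in> {y} \<and> j \<in> J - {y} \<and> j < i} = (\<lambda>k. (y, k)) ` {k \<in> K. k < y}"
      using True assms by auto
    then have "card {(i, j). i \<in> {y} \<and> j \<in> J - {y} \<and> j < i} = card {k \<in> K. k < y}"
      by (simp add: card_image inj_on_def)
    ultimately show ?thesis using True assms by (simp add: ext_basis_def)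
  next
    case False
    then have "(- 1) ^ card {(i, j). i \<in> I \<and> j \<in> J - I \<and> j < i}
           * (b * ext_basis {y} I) * (c * ext_basis K (J - I)) = 0" if "I \<in> Pow J" for I
      using that by (auto simp: ext_basis_def)
    then have "wedge (\<lambda>J. b * ext_basis {y} J) (\<lambda>J. c * ext_basis K J) J = 0"
      unfolding wedge_def by (intro sum.neutral) blast
    then show ?thesis using False by (simp add: ext_basis_def)
  qed
qed

text \<open>The head \<open>x\<close> is smaller than the rest of the list, so \<open>i - x\<close>
  is positive in the factors of \<open>inv_sign_insert\<close>, and what remains counts the images
  below the image of \<open>x\<close>. That is the sign that \<open>wedge_basis\<close>
  produces.\<close>

lemma foldr_wedge:
  assumes "w \<in> signed_perms n" "sorted_wrt (<) xs" "set xs \<subseteq> {1..int n}"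
  shows "foldr wedge (map (vec_act w) xs) (ext_basis {})
    = (\<lambda>J. of_int (ext_sign w (set xs)) * ext_basis (unsigned w ` set xs) J)"
  using assms(2,3)
proof (induction xs)
  case Nil
  then show ?case by (simp add: ext_sign_def)
next
  case (Cons x xs)
  let ?I = "set xs"
  have x: "x > 0" "x \<notin> ?I" "\<And>i. i \<in> ?I \<Longrightarrow> x < i" using Cons.prems by auto
  have inj: "inj (unsigned w)" using signed_permsD(4)[OF unsigned_signed_perm[OF assms(1)]] .
  have nK: "unsigned w x \<notin> unsigned w ` ?I" using x(2) inj by (auto dest: injD)
  have "(\<Prod>i\<in>?I. sgn ((unsigned w i - unsigned w x) * (i - x))) = (\<Prod>i\<in>?I. sgn (unsigned w i - unsigned w x))"
    using x(3) by (intro prod.cong refl) (auto simp: sgn_mult)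
  also have "\<dots> = (\<Prod>k\<in>unsigned w ` ?I. sgn (k - unsigned w x))"
    by (simp add: prod.reindex[OF inj_on_subset[OF inj]])
  also have "\<dots> = (- 1) ^ card {k \<in> unsigned w ` ?I. k < unsigned w x}"
    using nK by (intro prod_sgn_diff) auto
  finally have sign: "ext_sign w (insert x ?I)
      = sgn (w x) * ext_sign w ?I * (- 1) ^ card {k \<in> unsigned w ` ?I. k < unsigned w x}"
    using x(2) by (simp add: ext_sign_def inv_sign_insert)
  have "foldr wedge (map (vec_act w) (x # xs)) (ext_basis {})
      = wedge (\<lambda>J. of_int (sgn (w x)) * ext_basis {unsigned w x} J)
          (\<lambda>J. of_int (ext_sign w ?I) * ext_basis (unsigned w ` ?I) J)"
    using Cons x(1) by (simp add: vec_act_def[of w x] unsigned_eq)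
  also have "\<dots> = (\<lambda>J. of_int (ext_sign w (insert x ?I)) * ext_basis (insert (unsigned w x) (unsigned w ` ?I)) J)"
    unfolding wedge_basis[OF finite_imageI[OF finite_set] nK] sign by simp
  finally show ?case by simp
qed

text \<open>The action permutes the basis up to signs, so only the subsets that are mapped to
  themselves contribute to the trace.\<close>

lemma ext_char_eq:
  assumes "w \<in> signed_perms m"
  shows "ext_char m w = of_int (\<Sum>I | I \<subseteq> {1..int m} \<and> unsigned w ` I = I. ext_sign w I)"
proof -
  have "ext_act m w (ext_basis I) I = of_int (if unsigned w ` I = I then ext_sign w I else 0)"
    if I: "I \<in> Pow {1..int m}" for I
  proof -
    have fin: "finite I" using I finite_subset by blast
    have "ext_act m w (ext_basis I) I
        = (\<Sum>I'\<in>{I}. ext_basis I I' * foldr wedge (map (vec_act w) (sorted_list_of_set I')) (ext_basis {}) I)"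
      unfolding ext_act_def by (rule sum.mono_neutral_right) (use I in \<open>auto simp: ext_basis_def\<close>)
    also have "\<dots> = of_int (ext_sign w I) * ext_basis (unsigned w ` I) I"
      using foldr_wedge[OF assms, of "sorted_list_of_set I"] I fin by (simp add: ext_basis_def)
    finally show ?thesis by (auto simp: ext_basis_def)
  qed
  then have "ext_char m w = (\<Sum>I\<in>Pow {1..int m}. of_int (if unsigned w ` I = I then ext_sign w I else 0))"
    using assms by (simp add: ext_char_def)
  also have "\<dots> = (\<Sum>I\<in>{I \<in> Pow {1..int m}. unsigned w ` I = I}. of_int (ext_sign w I))"
    unfolding of_int_sum[symmetric] by (subst sum.inter_filter) (auto intro!: arg_cong[of _ _ of_int] sum.cong)
  finally show ?thesis by (simp add: Pow_def Collect_conj_eq)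
qed

section \<open>Signed cycle types\<close>

text \<open>Each of these sets, together with its sign below, replaces a pair of positive cycles or
  one negative cycle, and its cardinality is the length in the signed cycle type.\<close>

definition abs_cycles :: "nat \<Rightarrow> (int \<Rightarrow> int) \<Rightarrow> int set set" where
  "abs_cycles n w = orbit (unsigned w) ` {1..int n}"

definition cycle_sign :: "(int \<Rightarrow> int) \<Rightarrow> int set \<Rightarrow> int" where
  "cycle_sign w b = (\<Prod>i\<in>b. sgn (w i))"

lemma signed_perms_permutation:
  assumes "w \<in> signed_perms n" shows "permutation w"
  unfolding permutation_permutes using signed_permsD(1)[OF assms] finite_Diff finite_atLeastAtMost_int by blast

lemma unsigned_permutation: "w \<in> signed_perms n \<Longrightarrow> permutation (unsigned w)"
  by (rule signed_perms_permutation[OF unsigned_signed_perm])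

lemma orbit_eq_range: "permutation p \<Longrightarrow> orbit p x = range (\<lambda>k. (p ^^ k) x)"
  by (simp add: orbit_altdef_permutation full_SetCompr_eq)

lemma orbit_eq_of_mem: "permutation p \<Longrightarrow> y \<in> orbit p x \<Longrightarrow> orbit p y = orbit p x"
  by (rule orbit_cyclic_eq3[OF cyclic_on_orbit'])

lemma orbit_image: "permutation p \<Longrightarrow> p ` orbit p x = orbit p x"
proof -
  assume p: "permutation p"
  have "inj p" using p by (simp add: permutation_bijective bij_is_inj)
  moreover have "p ` orbit p x \<subseteq> orbit p x" by (auto intro: orbit.step)
  moreover have "finite (orbit p x)" using p by (intro finite_orbit permutation_self_in_orbit)
  ultimately show ?thesis by (meson endo_inj_surj inj_on_subset subset_UNIV)
qed

lemma unsigned_funpow_mem: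
  assumes "w \<in> signed_perms n" "x \<in> {1..int n}"
  shows "(unsigned w ^^ k) x \<in> {1..int n}"
proof (induction k)
  case (Suc k)
  then show ?case using unsigned_mem[OF assms(1)] by simp
qed (use assms in simp)

lemma abs_cycle_subset:
  assumes "w \<in> signed_perms n" "b \<in> abs_cycles n w"
  shows "b \<subseteq> {1..int n}" "finite b" "unsigned w ` b = b"
    "b \<noteq> {}" "\<And>x. x \<in> b \<Longrightarrow> b = orbit (unsigned w) x"
proof -
  note p = unsigned_permutation[OF assms(1)]
  obtain x where x: "x \<in> {1..int n}" "b = orbit (unsigned w) x" using assms(2) by (auto simp: abs_cycles_def)
  show sub: "b \<subseteq> {1..int n}"
    using unsigned_funpow_mem[OF assms(1) x(1)] by (auto simp: x(2) orbit_eq_range[OF p])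
  show "finite b" using sub finite_subset by blast
  show "unsigned w ` b = b" using orbit_image[OF p] x by simp
  show "b \<noteq> {}" using permutation_self_in_orbit[OF p] x by auto
  show "b = orbit (unsigned w) y" if "y \<in> b" for y using that orbit_eq_of_mem[OF p] x by blast
qed

lemma finite_abs_cycles: "finite (abs_cycles n w)"
  by (simp add: abs_cycles_def)

lemma abs_cycles_disjoint:
  assumes "w \<in> signed_perms n" "b \<in> abs_cycles n w" "c \<in> abs_cycles n w" "b \<noteq> c"
  shows "b \<inter> c = {}"
proof (rule ccontr)
  assume "b \<inter> c \<noteq> {}"
  then obtain x where "x \<in> b" "x \<in> c" by blast
  then show False
    using abs_cycle_subset(5)[OF assms(1,2)] abs_cycle_subset(5)[OF assms(1,3)] assms(4) by metis
qed

lemma abs_cycle_mem: "w \<in> signed_perms n \<Longrightarrow> x \<in> {1..int n} \<Longrightarrow> x \<in> orbit (unsigned w) x"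
  by (rule permutation_self_in_orbit[OF unsigned_permutation])

lemma Union_abs_cycles:
  assumes "w \<in> signed_perms n" shows "\<Union>(abs_cycles n w) = {1..int n}"
proof
  show "\<Union>(abs_cycles n w) \<subseteq> {1..int n}" using abs_cycle_subset(1)[OF assms] by blast
  show "{1..int n} \<subseteq> \<Union>(abs_cycles n w)"
    using abs_cycle_mem[OF assms] unfolding abs_cycles_def by blast
qed

lemma cycle_sign_cases:
  assumes "w \<in> signed_perms n" "b \<subseteq> {1..int n}" shows "cycle_sign w b = 1 \<or> cycle_sign w b = - 1"
proof -
  have "finite b" using assms(2) finite_subset by blast
  then show ?thesis using assms(2)
  proof (induction b rule: finite_induct)
    case (insert x b)
    then have "w x \<noteq> 0" using signed_perms_eq_0_iff[OF assms(1), of x] by auto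
    then show ?case using insert by (auto simp: cycle_sign_def sgn_if)
  qed (simp add: cycle_sign_def)
qed

lemma signed_perm_funpow:
  assumes "w \<in> signed_perms n" "x \<in> {1..int n}"
  shows "(w ^^ k) x = (\<Prod>t<k. sgn (w ((unsigned w ^^ t) x))) * (unsigned w ^^ k) x"
proof (induction k)
  case (Suc k)
  let ?y = "(unsigned w ^^ k) x" and ?s = "\<Prod>t<k. sgn (w ((unsigned w ^^ t) x))"
  have y: "?y > 0" using unsigned_funpow_mem[OF assms] by (meson atLeastAtMost_iff zero_less_one_class.zero_less_one order_less_le_trans)
  have "w ((unsigned w ^^ t) x) \<noteq> 0" for t
    using unsigned_funpow_mem[OF assms, of t] signed_perms_eq_0_iff[OF assms(1), of "(unsigned w ^^ t) x"]
    by auto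
  then have "\<forall>t. sgn (w ((unsigned w ^^ t) x)) = 1 \<or> sgn (w ((unsigned w ^^ t) x)) = - 1"
    by (metis sgn_if)
  then have s: "?s = 1 \<or> ?s = - 1"
    by (induction k) auto
  have "(w ^^ Suc k) x = w (?s * ?y)" using Suc by simp
  also have "\<dots> = ?s * w ?y" using s signed_permsD(2)[OF assms(1)] by auto
  also have "w ?y = sgn (w ?y) * unsigned w ?y" by (rule signed_perms_sgn_unsigned[OF assms(1) y])
  finally show ?case by simp
qed simp

lemma orbit_least_power:
  assumes "permutation p"
  shows "inj_on (\<lambda>t. (p ^^ t) x) {..<least_power p x}"
    "(\<lambda>t. (p ^^ t) x) ` {..<least_power p x} = orbit p x" "card (orbit p x) = least_power p x"
proof -
  have d: "distinct (map (\<lambda>t. (p ^^ t) x) [0..<least_power p x])" using cycle_of_permutation[OF assms] .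
  show inj: "inj_on (\<lambda>t. (p ^^ t) x) {..<least_power p x}"
    using d by (simp add: distinct_map atLeast0LessThan)
  show im: "(\<lambda>t. (p ^^ t) x) ` {..<least_power p x} = orbit p x"
    unfolding orbit_eq_set_support[OF assms] by (simp add: atLeast0LessThan)
  show "card (orbit p x) = least_power p x" using card_image[OF inj] im by simp
qed

text \<open>One full turn around the cycle picks up the sign at each of its elements exactly
  once.\<close>

lemma signed_perm_funpow_least_power:
  assumes "w \<in> signed_perms n" "x \<in> {1..int n}"
  defines "b \<equiv> orbit (unsigned w) x"
  shows "(w ^^ card b) x = cycle_sign w b * x"
proof -
  note o = orbit_least_power[OF unsigned_permutation[OF assms(1)], of x]
  have "(\<Prod>t<card b. sgn (w ((unsigned w ^^ t) x))) = cycle_sign w b"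
    unfolding cycle_sign_def b_def o(3) by (simp add: o(2)[symmetric] prod.reindex[OF o(1)])
  moreover have "(unsigned w ^^ card b) x = x"
    unfolding b_def o(3) using least_power_of_permutation(1)[OF unsigned_permutation[OF assms(1)]] .
  ultimately show ?thesis using signed_perm_funpow[OF assms(1,2), of "card b"] by simp
qed

lemma funpow_uminus:
  assumes "w \<in> signed_perms n" shows "(w ^^ k) (- x) = - (w ^^ k) x"
  by (induction k) (simp_all add: signed_permsD(2)[OF assms])

lemma signed_perm_funpow_mult:
  assumes "w \<in> signed_perms n" "x \<in> {1..int n}"
  defines "b \<equiv> orbit (unsigned w) x"
  shows "(w ^^ (t + q * card b)) x = cycle_sign w b ^ q * (w ^^ t) x"
proof (induction q)
  case (Suc q)
  have b: "b \<in> abs_cycles n w" using assms by (auto simp: abs_cycles_def)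
  have s: "cycle_sign w b = 1 \<or> cycle_sign w b = - 1"
    using cycle_sign_cases[OF assms(1) abs_cycle_subset(1)[OF assms(1) b]] .
  have "(w ^^ (t + Suc q * card b)) x = (w ^^ (t + q * card b)) ((w ^^ card b) x)"
    by (simp add: funpow_add[symmetric, THEN fun_cong, unfolded comp_def] algebra_simps)
  also have "(w ^^ card b) x = cycle_sign w b * x"
    using signed_perm_funpow_least_power[OF assms(1,2)] b_def by simp
  also have "(w ^^ (t + q * card b)) (cycle_sign w b * x) = cycle_sign w b * (w ^^ (t + q * card b)) x"
    using s funpow_uminus[OF assms(1)] by auto
  finally show ?case using Suc by simp
qed simp

lemma abs_funpow:
  assumes "w \<in> signed_perms n" "x \<in> {1..int n}"
  shows "\<bar>(w ^^ k) x\<bar> = (unsigned w ^^ k) x"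
proof (induction k)
  case 0
  then show ?case using assms by simp
next
  case (Suc k)
  have "unsigned w ((unsigned w ^^ k) x) = \<bar>w ((unsigned w ^^ k) x)\<bar>"
    using unsigned_funpow_mem[OF assms, of k] by (intro unsigned_eq) auto
  then show ?case using Suc signed_perms_abs[OF assms(1), of "(w ^^ k) x"] by simp
qed

lemma orbit_uminus:
  assumes "w \<in> signed_perms n" shows "orbit w (- x) = uminus ` orbit w x"
  unfolding orbit_eq_range[OF signed_perms_permutation[OF assms]] image_image
  by (simp add: funpow_uminus[OF assms])

lemma orbit_Un_uminus:
  assumes "w \<in> signed_perms n" "x \<in> {1..int n}"
  defines "b \<equiv> orbit (unsigned w) x"
  shows "orbit w x \<union> uminus ` orbit w x = b \<union> uminus ` b"
proof -
  have o: "orbit w x = range (\<lambda>k. (w ^^ k) x)" "b = range (\<lambda>k. \<bar>(w ^^ k) x\<bar>)"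
    unfolding b_def using orbit_eq_range signed_perms_permutation[OF assms(1)]
      unsigned_permutation[OF assms(1)] abs_funpow[OF assms(1,2)] by simp_all
  have "y \<in> orbit w x \<union> uminus ` orbit w x \<longleftrightarrow> \<bar>y\<bar> \<in> b" for y
    unfolding o by (auto simp: image_iff abs_eq_iff)
  moreover have "b \<subseteq> {0<..}"
    using abs_cycle_subset(1)[OF assms(1), of b] assms by (force simp: abs_cycles_def)
  then have "y \<in> b \<union> uminus ` b \<longleftrightarrow> \<bar>y\<bar> \<in> b" for y
    by (auto simp: abs_if image_iff) (metis minus_minus)+
  ultimately show ?thesis by blast
qed

text \<open>If the cycle of \<open>x\<close> is closed under negation, some power of
  \<open>w\<close> sends \<open>x\<close> to \<open>- x\<close>. It sends \<open>x\<close> to itself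
  for \<open>unsigned w\<close>, so it consists of full turns, each of which multiplies by the cycle
  sign; this forces the sign \<open>- 1\<close>. Conversely one turn with sign \<open>- 1\<close>
  reaches \<open>- x\<close>.\<close>

lemma uminus_orbit_eq_iff:
  assumes "w \<in> signed_perms n" "x \<in> {1..int n}"
  defines "b \<equiv> orbit (unsigned w) x"
  shows "uminus ` orbit w x = orbit w x \<longleftrightarrow> cycle_sign w b = - 1"
proof
  note p = signed_perms_permutation[OF assms(1)]
  have b: "b \<in> abs_cycles n w" using assms by (auto simp: abs_cycles_def)
  have s: "cycle_sign w b = 1 \<or> cycle_sign w b = - 1"
    using cycle_sign_cases[OF assms(1) abs_cycle_subset(1)[OF assms(1) b]] .
  {
    assume "cycle_sign w b = - 1"
    then have "(w ^^ card b) x = - x"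
      using signed_perm_funpow_least_power[OF assms(1,2)] by (simp add: b_def)
    then have "- x \<in> orbit w x" unfolding orbit_eq_range[OF p] by (metis rangeI)
    then show "uminus ` orbit w x = orbit w x"
      using orbit_uminus[OF assms(1), of x] orbit_eq_of_mem[OF p] by metis
  }
  assume "uminus ` orbit w x = orbit w x"
  then have "- x \<in> orbit w x" using permutation_self_in_orbit[OF p, of x] by blast
  then obtain k where k: "(w ^^ k) x = - x" unfolding orbit_eq_range[OF p] by auto
  then have "(unsigned w ^^ k) x = x" using abs_funpow[OF assms(1,2), of k] assms(2) by simp
  then have "card b dvd k"
    unfolding b_def orbit_least_power(3)[OF unsigned_permutation[OF assms(1)]] by (rule least_power_minimal)
  then obtain q where "k = 0 + q * card b" by (metis dvd_div_mult_self add_0)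
  then have "- x = cycle_sign w b ^ q * x"
    using k signed_perm_funpow_mult[OF assms(1,2), of 0 q] by (simp add: b_def)
  then show "cycle_sign w b = - 1" using s assms(2) by auto
qed

lemma cycles_eq:
  assumes "w \<in> signed_perms n"
  shows "cycles n w = orbit w ` {1..int n} \<union> (\<lambda>x. uminus ` orbit w x) ` {1..int n}"
proof -
  have "{- int n..int n} - {0} = {1..int n} \<union> uminus ` {1..int n}"
    by auto
  then show ?thesis by (simp only: cycles_def image_Un image_image orbit_uminus[OF assms])
qed

lemma uminus_uminus_image: "uminus ` uminus ` A = (A :: int set)"
  by (simp add: image_image)

lemma cycles_cases:
  assumes "w \<in> signed_perms n" "c \<in> cycles n w"
  obtains x where "x \<in> {1..int n}" "c = orbit w x \<or> c = uminus ` orbit w x"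
proof -
  from assms(2) have "c \<in> orbit w ` {1..int n} \<or> c \<in> (\<lambda>x. uminus ` orbit w x) ` {1..int n}"
    unfolding cycles_eq[OF assms(1)] by (rule UnE) (rule disjI1, assumption, rule disjI2)
  then show ?thesis
  proof
    assume "c \<in> orbit w ` {1..int n}"
    then show ?thesis by (rule imageE) (rule that, assumption, rule disjI1)
  next
    assume "c \<in> (\<lambda>x. uminus ` orbit w x) ` {1..int n}"
    then show ?thesis by (rule imageE) (rule that, assumption, rule disjI2)
  qed
qed

text \<open>The two cycles of a positive pair have the same union with their negatives, so every
  cycle of \<open>unsigned w\<close> yields exactly one element, on the side given by its
  sign.\<close>

lemma pos_neg_cycles_eq:
  assumes "w \<in> signed_perms n"
  shows "pos_cycles n w = (\<lambda>b. b \<union> uminus ` b) ` {b \<in> abs_cycles n w. cycle_sign w b = 1}"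
    "neg_cycles n w = (\<lambda>b. b \<union> uminus ` b) ` {b \<in> abs_cycles n w. cycle_sign w b = - 1}"
proof -
  let ?O = "orbit (unsigned w)" and ?d = "\<lambda>b :: int set. b \<union> uminus ` b"
  have O: "?O x \<in> abs_cycles n w" if "x \<in> {1..int n}" for x
    using that by (simp add: abs_cycles_def)
  have d: "?d (orbit w x) = ?d (?O x)" if "x \<in> {1..int n}" for x
    using orbit_Un_uminus[OF assms that] .
  have in_cycles: "orbit w x \<in> cycles n w" if "x \<in> {1..int n}" for x
    unfolding cycles_eq[OF assms] using that by (intro UnI1 imageI)
  have s: "cycle_sign w (?O x) = 1 \<longleftrightarrow> uminus ` orbit w x \<noteq> orbit w x" if "x \<in> {1..int n}" for x
  proof -
    have "cycle_sign w (?O x) = 1 \<or> cycle_sign w (?O x) = - 1"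
      using cycle_sign_cases[OF assms abs_cycle_subset(1)[OF assms O[OF that]]] .
    then have "cycle_sign w (?O x) = 1 \<longleftrightarrow> cycle_sign w (?O x) \<noteq> - 1" by auto
    then show ?thesis unfolding uminus_orbit_eq_iff[OF assms that] .
  qed
  show "pos_cycles n w = ?d ` {b \<in> abs_cycles n w. cycle_sign w b = 1}"
  proof (intro equalityI subsetI)
    fix y assume "y \<in> pos_cycles n w"
    then obtain c where c: "y = ?d c" "c \<in> cycles n w" "uminus ` c \<noteq> c"
      unfolding pos_cycles_def by blast
    obtain x where x: "x \<in> {1..int n}" "c = orbit w x \<or> c = uminus ` orbit w x"
      using cycles_cases[OF assms c(2)] .
    have "uminus ` orbit w x \<noteq> orbit w x" using x(2) c(3) uminus_uminus_image by metis
    moreover have "y = ?d (orbit w x)" using x(2) c(1) uminus_uminus_image sup_commute by metis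
    ultimately have "y = ?d (?O x)" "cycle_sign w (?O x) = 1" using d s x(1) by metis+
    then show "y \<in> ?d ` {b \<in> abs_cycles n w. cycle_sign w b = 1}" using O[OF x(1)] by blast
  next
    fix y assume "y \<in> ?d ` {b \<in> abs_cycles n w. cycle_sign w b = 1}"
    then obtain x where x: "x \<in> {1..int n}" "y = ?d (?O x)" "cycle_sign w (?O x) = 1"
      unfolding abs_cycles_def by blast
    then have "y = ?d (orbit w x)" "uminus ` orbit w x \<noteq> orbit w x" using d s by metis+
    then show "y \<in> pos_cycles n w" unfolding pos_cycles_def using in_cycles[OF x(1)] by blast
  qed
  show "neg_cycles n w = ?d ` {b \<in> abs_cycles n w. cycle_sign w b = - 1}"
  proof (intro equalityI subsetI)
    fix y assume "y \<in> neg_cycles n w"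
    then have y: "y \<in> cycles n w" "uminus ` y = y" unfolding neg_cycles_def by blast+
    obtain x where x: "x \<in> {1..int n}" "y = orbit w x \<or> y = uminus ` orbit w x"
      using cycles_cases[OF assms y(1)] .
    have u: "uminus ` orbit w x = orbit w x" using x(2) y(2) uminus_uminus_image by metis
    then have "y = ?d (orbit w x)" using x(2) by (metis sup.idem)
    then have "y = ?d (?O x)" "cycle_sign w (?O x) = - 1"
      using d[OF x(1)] u uminus_orbit_eq_iff[OF assms x(1)] by metis+
    then show "y \<in> ?d ` {b \<in> abs_cycles n w. cycle_sign w b = - 1}" using O[OF x(1)] by blast
  next
    fix y assume "y \<in> ?d ` {b \<in> abs_cycles n w. cycle_sign w b = - 1}"
    then obtain x where x: "x \<in> {1..int n}" "y = ?d (?O x)" "cycle_sign w (?O x) = - 1"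
      unfolding abs_cycles_def by blast
    then have u: "uminus ` orbit w x = orbit w x" using uminus_orbit_eq_iff[OF assms x(1)] by metis
    then have "y = orbit w x" using d[OF x(1)] x(2) by (metis sup.idem)
    then show "y \<in> neg_cycles n w"
      unfolding neg_cycles_def using in_cycles[OF x(1)] u by (simp only: mem_Collect_eq simp_thms)
  qed
qed

text \<open>The set \<open>b\<close> is recovered from its symmetrization as the positive part,
  which makes the correspondence injective; the doubled cardinality cancels the division by
  2.\<close>

lemma signed_cycle_type_eq:
  assumes "w \<in> signed_perms n"
  shows "signed_cycle_type n w =
    (image_mset card (mset_set {b \<in> abs_cycles n w. cycle_sign w b = 1}),
     image_mset card (mset_set {b \<in> abs_cycles n w. cycle_sign w b = - 1}))"
proof -
  let ?d = "\<lambda>b :: int set. b \<union> uminus ` b"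
  have pos: "?d b \<inter> {0<..} = b" "card (?d b) = 2 * card b" if "b \<in> abs_cycles n w" for b
  proof -
    note sub = abs_cycle_subset(1,2)[OF assms that]
    have neg: "x < 0" if x: "x \<in> uminus ` b" for x
    proof -
      have "- x \<in> b" using x by (simp add: image_iff equation_minus_iff[of x] flip: ex_simps)
      then have "- x \<in> {1..int n}" using sub(1) by blast
      then show ?thesis by simp
    qed
    have pos: "0 < x" if "x \<in> b" for x using sub(1) that by (auto dest!: subsetD)
    show "?d b \<inter> {0<..} = b"
    proof (intro equalityI subsetI)
      fix x assume "x \<in> ?d b \<inter> {0<..}"
      then show "x \<in> b" using neg[of x] by (metis IntE UnE greaterThan_iff order_less_asym)
    qed (use pos in simp)
    have "x \<notin> uminus ` b" if "x \<in> b" for x using neg[of x] pos[OF that] by linarith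
    then have "b \<inter> uminus ` b = {}" by blast
    then have "card (?d b) = card b + card (uminus ` b)" using sub(2) by (intro card_Un_disjoint) auto
    also have "card (uminus ` b) = card b" by (intro card_image inj_onI) simp
    finally show "card (?d b) = 2 * card b" by simp
  qed
  have "image_mset (\<lambda>c. card c div 2) (mset_set (?d ` B)) = image_mset card (mset_set B)"
    if B: "B \<subseteq> abs_cycles n w" for B
  proof -
    have fin: "finite B" using B finite_abs_cycles finite_subset by blast
    have "inj_on ?d B" by (rule inj_onI) (metis pos(1) B subsetD)
    then have "image_mset (\<lambda>c. card c div 2) (mset_set (?d ` B)) = image_mset (\<lambda>b. card (?d b) div 2) (mset_set B)"
      by (simp add: image_mset_mset_set[symmetric] image_mset.compositionality comp_def)
    also have "\<dots> = image_mset card (mset_set B)"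
      using pos(2) B fin by (intro image_mset_cong) auto
    finally show ?thesis .
  qed
  then show ?thesis by (simp add: signed_cycle_type_def pos_neg_cycles_eq[OF assms])
qed

section \<open>The character of the exterior algebra as a function of the cycle type\<close>

lemma ext_sign_abs_cycle:
  assumes "w \<in> signed_perms n" "b \<in> abs_cycles n w"
  shows "ext_sign w b = (- 1) ^ (card b - 1) * cycle_sign w b"
proof -
  obtain x where "b = orbit (unsigned w) x" using assms(2) unfolding abs_cycles_def by blast
  then have "inv_sign (unsigned w) b = (- 1) ^ (card b - 1)"
    using inv_sign_orbit[OF unsigned_permutation[OF assms(1)]] by simp
  then show ?thesis by (simp add: ext_sign_def cycle_sign_def)
qed

lemma ext_sign_Union:
  assumes "w \<in> signed_perms n" "Q \<subseteq> abs_cycles n w"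
  shows "ext_sign w (\<Union>Q) = (\<Prod>b\<in>Q. ext_sign w b)"
proof -
  have "finite Q" using assms(2) finite_abs_cycles finite_subset by blast
  then show ?thesis using assms(2)
  proof (induction Q rule: finite_induct)
    case (insert b Q)
    then have b: "b \<in> abs_cycles n w" and Q: "Q \<subseteq> abs_cycles n w" by auto
    have disj: "b \<inter> \<Union>Q = {}"
      using abs_cycles_disjoint[OF assms(1) b] Q insert(2) by blast
    have fin: "finite b" "finite (\<Union>Q)"
      using abs_cycle_subset(2)[OF assms(1)] insert(1) b Q by auto
    have inv: "unsigned w ` b = b" "unsigned w ` \<Union>Q = \<Union>Q"
      using abs_cycle_subset(3)[OF assms(1)] b Q by (simp, simp add: image_Union subset_eq)
    have "ext_sign w (b \<union> \<Union>Q) = ext_sign w b * ext_sign w (\<Union>Q)"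
      unfolding ext_sign_def inv_sign_Un_invariant[OF fin disj inv]
      by (subst prod.union_disjoint) (use fin disj in auto)
    then show ?case using insert Q by simp
  qed (simp add: ext_sign_def)
qed

lemma invariant_eq_Union_abs_cycles:
  assumes "w \<in> signed_perms n" "I \<subseteq> {1..int n}" "unsigned w ` I = I"
  shows "I = \<Union>{b \<in> abs_cycles n w. b \<subseteq> I}"
proof
  have "orbit (unsigned w) x \<subseteq> I" if x: "x \<in> I" for x
  proof
    fix y assume "y \<in> orbit (unsigned w) x"
    then show "y \<in> I" by (induction rule: orbit.induct) (use x assms(3) in auto)
  qed
  moreover have "x \<in> orbit (unsigned w) x" "orbit (unsigned w) x \<in> abs_cycles n w" if "x \<in> I" for x
    using that assms(2) abs_cycle_mem[OF assms(1)] unfolding abs_cycles_def by blast+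
  ultimately show "I \<subseteq> \<Union>{b \<in> abs_cycles n w. b \<subseteq> I}" by blast
qed auto

text \<open>Invariant subsets are the unions of cycles, and \<open>ext_sign\<close> is
  multiplicative over disjoint cycles. The sum over all sets of cycles is therefore an expanded
  product with one binomial per cycle.\<close>

lemma sum_ext_sign:
  assumes "w \<in> signed_perms n"
  shows "(\<Sum>I | I \<subseteq> {1..int n} \<and> unsigned w ` I = I. ext_sign w I)
    = (\<Prod>b\<in>abs_cycles n w. 1 + (- 1) ^ (card b - 1) * cycle_sign w b)"
proof -
  have "bij_betw Union (Pow (abs_cycles n w)) {I. I \<subseteq> {1..int n} \<and> unsigned w ` I = I}"
  proof (rule bij_betw_byWitness[where f' = "\<lambda>I. {b \<in> abs_cycles n w. b \<subseteq> I}"])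
    show "\<forall>Q\<in>Pow (abs_cycles n w). {b \<in> abs_cycles n w. b \<subseteq> \<Union>Q} = Q"
    proof (intro ballI Set.set_eqI iffI)
      fix Q b assume Q: "Q \<in> Pow (abs_cycles n w)" and b: "b \<in> {b \<in> abs_cycles n w. b \<subseteq> \<Union>Q}"
      then obtain x where "x \<in> b" using abs_cycle_subset(4)[OF assms] by blast
      then obtain c where "x \<in> c" "c \<in> Q" using b by blast
      then have "b = c" using abs_cycles_disjoint[OF assms, of b c] b Q \<open>x \<in> b\<close> by blast
      then show "b \<in> Q" using \<open>c \<in> Q\<close> by simp
    qed blast
    show "\<forall>I\<in>{I. I \<subseteq> {1..int n} \<and> unsigned w ` I = I}. \<Union>{b \<in> abs_cycles n w. b \<subseteq> I} = I"
      using invariant_eq_Union_abs_cycles[OF assms] by blast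
    show "Union ` Pow (abs_cycles n w) \<subseteq> {I. I \<subseteq> {1..int n} \<and> unsigned w ` I = I}"
    proof
      fix I assume "I \<in> Union ` Pow (abs_cycles n w)"
      then obtain Q where Q: "Q \<subseteq> abs_cycles n w" "I = \<Union>Q" by auto
      have "I \<subseteq> {1..int n}" using Q Union_abs_cycles[OF assms] by blast
      moreover have "unsigned w ` I = (\<Union>b\<in>Q. unsigned w ` b)" using Q by blast
      then have "unsigned w ` I = I" using Q abs_cycle_subset(3)[OF assms] by (simp add: subset_eq)
      ultimately show "I \<in> {I. I \<subseteq> {1..int n} \<and> unsigned w ` I = I}" by simp
    qed
  qed auto
  then have "(\<Sum>I | I \<subseteq> {1..int n} \<and> unsigned w ` I = I. ext_sign w I)
      = (\<Sum>Q\<in>Pow (abs_cycles n w). ext_sign w (\<Union>Q))"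
    by (simp add: sum.reindex_bij_betw[symmetric])
  also have "\<dots> = (\<Sum>Q\<in>Pow (abs_cycles n w). \<Prod>b\<in>Q. (- 1) ^ (card b - 1) * cycle_sign w b)"
  proof (rule sum.cong[OF refl])
    fix Q assume "Q \<in> Pow (abs_cycles n w)"
    then have Q: "Q \<subseteq> abs_cycles n w" by simp
    show "ext_sign w (\<Union>Q) = (\<Prod>b\<in>Q. (- 1) ^ (card b - 1) * cycle_sign w b)"
      unfolding ext_sign_Union[OF assms Q]
      by (rule prod.cong[OF refl], rule ext_sign_abs_cycle[OF assms]) (use Q in blast)
  qed
  also have "\<dots> = (\<Prod>b\<in>abs_cycles n w. (- 1) ^ (card b - 1) * cycle_sign w b + 1)"
    by (simp add: prod_add[OF finite_abs_cycles])
  finally show ?thesis by (simp add: add.commute)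
qed

text \<open>The determinant of \<open>1 + w\<close> at an element of type \<open>t\<close>. On a
  cycle of length \<open>a\<close> and sign \<open>d\<close> the eigenvalues of \<open>w\<close> are
  the solutions of \<open>z ^ a = d\<close>, which gives the factor
  \<open>1 + (- 1) ^ (a - 1) * d\<close>.\<close>

definition type_product :: "nat multiset \<times> nat multiset \<Rightarrow> int" where
  "type_product t = (\<Prod>a\<in>#fst t. 1 + (- 1) ^ (a - 1)) * (\<Prod>a\<in>#snd t. 1 - (- 1) ^ (a - 1))"

lemma prod_abs_cycles_split:
  fixes f :: "int set \<Rightarrow> 'c :: comm_monoid_mult"
  assumes "w \<in> signed_perms n"
  shows "(\<Prod>b\<in>abs_cycles n w. f b)
    = (\<Prod>b\<in>{b \<in> abs_cycles n w. cycle_sign w b = 1}. f b)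
      * (\<Prod>b\<in>{b \<in> abs_cycles n w. cycle_sign w b = - 1}. f b)"
proof -
  have "cycle_sign w b = 1 \<or> cycle_sign w b = - 1" if "b \<in> abs_cycles n w" for b
    using cycle_sign_cases[OF assms abs_cycle_subset(1)[OF assms that]] .
  then have eq: "abs_cycles n w = {b \<in> abs_cycles n w. cycle_sign w b = 1} \<union> {b \<in> abs_cycles n w. cycle_sign w b = - 1}"
    by blast
  show ?thesis
    by (subst eq, rule prod.union_disjoint) (use finite_abs_cycles in \<open>auto intro: finite_subset\<close>)
qed

lemma type_product_eq:
  assumes "w \<in> signed_perms n"
  shows "type_product (signed_cycle_type n w)
    = (\<Prod>b\<in>abs_cycles n w. 1 + (- 1) ^ (card b - 1) * cycle_sign w b)"
proof -
  have "(\<Prod>b\<in>abs_cycles n w. 1 + (- 1) ^ (card b - 1) * cycle_sign w b)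
    = (\<Prod>b\<in>{b \<in> abs_cycles n w. cycle_sign w b = 1}. 1 + (- 1) ^ (card b - 1))
      * (\<Prod>b\<in>{b \<in> abs_cycles n w. cycle_sign w b = - 1}. 1 - (- 1) ^ (card b - 1))"
    unfolding prod_abs_cycles_split[OF assms] by (intro arg_cong2[of _ _ _ _ "(*)"] prod.cong refl) auto
  then show ?thesis
    unfolding signed_cycle_type_eq[OF assms] type_product_def
    by (simp add: prod_unfold_prod_mset image_mset.compositionality comp_def)
qed

lemma ext_char_type:
  "w \<in> signed_perms n \<Longrightarrow> ext_char n w = of_int (type_product (signed_cycle_type n w))"
  by (simp only: ext_char_eq sum_ext_sign type_product_eq)

section \<open>Conjugation, fixed points and the induced character\<close>

lemma signed_cycle_type_conj:
  assumes "u \<in> signed_perms n" "h \<in> signed_perms n"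
  shows "signed_cycle_type n (u \<circ> h \<circ> inv_into UNIV u) = signed_cycle_type n h"
proof -
  let ?v = "inv_into UNIV u" and ?S = "{- int n..int n} - {0}"
  let ?g = "u \<circ> h \<circ> ?v"
  have inj: "inj u" using signed_permsD(4)[OF assms(1)] .
  have v: "?v (u x) = x" for x using inj by simp
  have g: "?g \<in> signed_perms n"
    using assms signed_perms_inv signed_perms_comp by blast
  have pow: "(?g ^^ k) (u x) = u ((h ^^ k) x)" for k x
    by (induction k) (simp_all add: v)
  have orb: "orbit ?g (u x) = u ` orbit h x" for x
    unfolding orbit_eq_range[OF signed_perms_permutation[OF g]]
      orbit_eq_range[OF signed_perms_permutation[OF assms(2)]] image_image pow ..
  have uS: "u ` ?S = ?S" using permutes_image[OF signed_permsD(1)[OF assms(1)]] .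
  have cyc: "cycles n ?g = (`) u ` cycles n h"
  proof -
    have "cycles n ?g = orbit ?g ` (u ` ?S)" by (simp only: cycles_def uS)
    also have "\<dots> = (`) u ` cycles n h" by (simp only: cycles_def image_image orb)
    finally show ?thesis .
  qed
  define N where "N = (\<lambda>c :: int set. uminus ` c)"
  \<comment> \<open>Since \<open>u\<close> is odd it commutes with negation, and therefore respects
    the distinction between positive and negative cycles.\<close>
  have um: "N (u ` c) = u ` N c" for c
    unfolding N_def image_image by (simp add: signed_permsD(2)[OF assms(1)])
  have eqi: "u ` c = u ` d \<longleftrightarrow> c = d" for c d using inj by (rule inj_image_eq_iff)
  have pos: "pos_cycles n ?g = (`) u ` pos_cycles n h"
  proof -
    have "pos_cycles n f = (\<lambda>c. c \<union> N c) ` {c \<in> cycles n f. N c \<noteq> c}" for f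
      unfolding pos_cycles_def N_def by blast
    moreover have "{c \<in> (`) u ` cycles n h. N c \<noteq> c} = (`) u ` {c \<in> cycles n h. N c \<noteq> c}"
      using um eqi by auto
    ultimately show ?thesis by (simp only: cyc image_image um image_Un)
  qed
  have neg: "neg_cycles n ?g = (`) u ` neg_cycles n h"
  proof -
    have "neg_cycles n f = {c \<in> cycles n f. N c = c}" for f
      unfolding neg_cycles_def N_def by blast
    moreover have "{c \<in> (`) u ` cycles n h. N c = c} = (`) u ` {c \<in> cycles n h. N c = c}"
      using um eqi by auto
    ultimately show ?thesis by (simp only: cyc)
  qed
  have "image_mset (\<lambda>c. card c div 2) (mset_set ((`) u ` P)) = image_mset (\<lambda>c. card c div 2) (mset_set P)" for P
  proof -
    have "inj_on ((`) u) P" using eqi by (auto intro: inj_onI)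
    then have "image_mset (\<lambda>c. card c div 2) (mset_set ((`) u ` P)) = image_mset (\<lambda>c. card (u ` c) div 2) (mset_set P)"
      by (simp add: image_mset_mset_set[symmetric] image_mset.compositionality comp_def)
    then show ?thesis using card_image[OF inj_on_subset[OF inj subset_UNIV]] by simp
  qed
  then show ?thesis unfolding signed_cycle_type_def pos neg by simp
qed

lemma signed_cycle_type_stabilizer:
  assumes "n \<ge> 1" "h \<in> signed_perms (n - 1)"
  shows "signed_cycle_type n h
    = (add_mset 1 (fst (signed_cycle_type (n - 1) h)), snd (signed_cycle_type (n - 1) h))"
proof -
  have h: "h \<in> signed_perms n" "h (int n) = int n"
    using assms(2) unfolding signed_perms_stabilizer[OF assms(1)] by auto
  have "{1..int n} = insert (int n) {1..int (n - 1)}" using assms(1) by auto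
  moreover have "orbit (unsigned h) (int n) = {int n}"
    unfolding orbit_eq_singleton_iff using h assms(1) by (simp add: unsigned_def)
  ultimately have A: "abs_cycles n h = insert {int n} (abs_cycles (n - 1) h)"
    by (simp add: abs_cycles_def)
  have nin: "{int n} \<notin> abs_cycles (n - 1) h"
    using abs_cycle_subset(1)[OF assms(2), of "{int n}"] assms(1) by auto
  have s: "cycle_sign h {int n} = 1" using h assms(1) by (simp add: cycle_sign_def)
  have 1: "{b \<in> abs_cycles n h. cycle_sign h b = 1} = insert {int n} {b \<in> abs_cycles (n - 1) h. cycle_sign h b = 1}"
    unfolding A using s by blast
  have 2: "{b \<in> abs_cycles n h. cycle_sign h b = - 1} = {b \<in> abs_cycles (n - 1) h. cycle_sign h b = - 1}"
    unfolding A using s by auto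
  show ?thesis
    unfolding signed_cycle_type_eq[OF h(1)] signed_cycle_type_eq[OF assms(2)] 1 2
    using nin finite_abs_cycles[of "n - 1" h] by simp
qed

lemma mem_uminus_image: "a \<in> uminus ` A \<longleftrightarrow> - a \<in> A" for a :: int
proof
  assume "a \<in> uminus ` A"
  then show "- a \<in> A" by (rule imageE) simp
next
  assume "- a \<in> A"
  then show "a \<in> uminus ` A" by (rule rev_image_eqI) simp
qed

text \<open>Fixed letters come in pairs \<open>a\<close>, \<open>- a\<close>, and a positive letter
  \<open>a\<close> is fixed exactly if \<open>{a}\<close> is a cycle of \<open>unsigned w\<close>
  with sign \<open>1\<close>.\<close>

lemma count_fixed_points:
  assumes "w \<in> signed_perms n"
  shows "card {a \<in> {- int n..int n} - {0}. w a = a} = 2 * count (fst (signed_cycle_type n w)) 1"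
proof -
  let ?F = "{a \<in> {1..int n}. w a = a}"
  have wm: "- a = w (- a) \<longleftrightarrow> w a = a" for a using signed_permsD(2)[OF assms, of a] by auto
  have U: "{a \<in> {- int n..int n} - {0}. w a = a} = ?F \<union> uminus ` ?F"
  proof (rule Set.set_eqI)
    fix a
    have "a \<in> ?F \<union> uminus ` ?F \<longleftrightarrow> a \<in> ?F \<or> - a \<in> ?F" by (simp only: Un_iff mem_uminus_image)
    also have "\<dots> \<longleftrightarrow> (a \<in> {1..int n} \<or> - a \<in> {1..int n}) \<and> w a = a" using wm[of a] by auto
    also have "\<dots> \<longleftrightarrow> a \<in> {a \<in> {- int n..int n} - {0}. w a = a}" by auto
    finally show "a \<in> {a \<in> {- int n..int n} - {0}. w a = a} \<longleftrightarrow> a \<in> ?F \<union> uminus ` ?F" ..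
  qed
  have "finite ?F" by (rule finite_subset[of _ "{1..int n}"]) auto
  moreover have "?F \<inter> uminus ` ?F = {}"
    unfolding disjoint_iff mem_uminus_image by simp
  ultimately have "card {a \<in> {- int n..int n} - {0}. w a = a} = card ?F + card (uminus ` ?F)"
    unfolding U by (intro card_Un_disjoint finite_imageI)
  also have "card (uminus ` ?F) = card ?F" by (intro card_image inj_onI) simp
  also have "card ?F = card {b \<in> {b \<in> abs_cycles n w. cycle_sign w b = 1}. card b = 1}"
  proof (rule bij_betw_same_card[of "\<lambda>a. {a}"])
    show "bij_betw (\<lambda>a. {a}) ?F {b \<in> {b \<in> abs_cycles n w. cycle_sign w b = 1}. card b = 1}"
      unfolding bij_betw_def
    proof (intro conjI equalityI subsetI)
      fix b assume "b \<in> (\<lambda>a. {a}) ` ?F"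
      then obtain a where a: "a \<in> {1..int n}" "w a = a" "b = {a}" by blast
      then have "orbit (unsigned w) a = {a}" unfolding orbit_eq_singleton_iff by (simp add: unsigned_def)
      then have "b \<in> abs_cycles n w" using a unfolding abs_cycles_def by blast
      then show "b \<in> {b \<in> {b \<in> abs_cycles n w. cycle_sign w b = 1}. card b = 1}"
        using a by (simp add: cycle_sign_def)
    next
      fix b assume "b \<in> {b \<in> {b \<in> abs_cycles n w. cycle_sign w b = 1}. card b = 1}"
      then have b: "b \<in> abs_cycles n w" "cycle_sign w b = 1" "card b = 1" by auto
      then obtain a where a: "b = {a}" by (auto simp: card_1_singleton_iff)
      then have m: "a \<in> {1..int n}" using abs_cycle_subset(1)[OF assms b(1)] by simp
      have "unsigned w a = a" using abs_cycle_subset(3)[OF assms b(1)] a by simp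
      moreover have "sgn (w a) = 1" using b(2) a by (simp add: cycle_sign_def)
      ultimately have "w a = a" using signed_perms_sgn_unsigned[OF assms, of a] m by simp
      then show "b \<in> (\<lambda>a. {a}) ` ?F" using a m by blast
    qed (simp add: inj_on_def)
  qed
  also have "\<dots> = count (fst (signed_cycle_type n w)) 1"
    unfolding signed_cycle_type_eq[OF assms] using finite_abs_cycles[of n w]
    by (simp add: count_image_mset_eq_card_vimage)
  finally show ?thesis by simp
qed

text \<open>A conjugate of \<open>g\<close> in the stabilizer has the type of \<open>g\<close>
  without one unbarred 1. This part has the factor 2 in \<open>type_product\<close>, so every
  summand is half the value for \<open>g\<close>. The number of summands is the order of the
  stabilizer times the number of fixed letters of \<open>g\<close>, which is twice the number of
  unbarred 1s; the two factors 2 cancel.\<close>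

lemma induced_ext_char:
  assumes "n \<ge> 1" "g \<in> signed_perms n"
  shows "induced (signed_perms (n - 1)) (signed_perms n) (ext_char (n - 1)) g
    = of_nat (count (fst (signed_cycle_type n g)) 1) * of_int (type_product (signed_cycle_type n g))"
proof -
  let ?H = "signed_perms (n - 1)" and ?G = "signed_perms n" and ?S = "{- int n..int n} - {0}"
  let ?c = "\<lambda>u. inv_into UNIV u \<circ> g \<circ> u"
  let ?U = "{u. u \<in> ?G \<and> ?c u \<in> ?H}" and ?E = "complex_of_int (type_product (signed_cycle_type n g))"
  have S: "x \<in> ?S \<longleftrightarrow> \<bar>x\<bar> \<in> {1..int n}" for x by auto
  have conj: "signed_cycle_type n (?c u) = signed_cycle_type n g" if u: "u \<in> ?G" for u
  proof -
    have "inv_into UNIV (inv_into UNIV u) = u"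
      using permutes_inv_inv[OF signed_permsD(1)[OF u]] .
    then show ?thesis using signed_cycle_type_conj[OF signed_perms_inv[OF u] assms(2)] by simp
  qed
  have val: "ext_char (n - 1) (?c u) = ?E / 2" if u: "u \<in> ?U" for u
  proof -
    have h: "?c u \<in> ?H" using u by simp
    have "type_product (signed_cycle_type n (?c u)) = 2 * type_product (signed_cycle_type (n - 1) (?c u))"
      unfolding signed_cycle_type_stabilizer[OF assms(1) h] by (simp add: type_product_def)
    then have "?E = 2 * ext_char (n - 1) (?c u)"
      using conj[of u] u ext_char_type[OF h] by simp
    then show ?thesis by simp
  qed
  have cG: "?c u \<in> ?G" if "u \<in> ?G" for u
    using that assms(2) signed_perms_inv signed_perms_comp by blast
  have U: "?U = (\<Union>a\<in>{a \<in> ?S. g a = a}. {u \<in> ?G. u (int n) = a})"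
  proof -
    have "?c u \<in> ?H \<longleftrightarrow> g (u (int n)) = u (int n)" if u: "u \<in> ?G" for u
      unfolding signed_perms_stabilizer[OF assms(1)] using cG[OF u]
        permutes_inv_eq[OF signed_permsD(1)[OF u]] by auto
    moreover have "u (int n) \<in> ?S" if u: "u \<in> ?G" for u
      unfolding S using signed_perms_abs_mem[OF u] assms(1) by auto
    ultimately show ?thesis by blast
  qed
  have "card ?U = (\<Sum>a\<in>{a \<in> ?S. g a = a}. card {u \<in> ?G. u (int n) = a})"
    unfolding U
  proof (rule card_UN_disjoint)
    show "finite {a \<in> ?S. g a = a}" by (rule finite_subset[of _ ?S]) auto
  qed (auto simp: finite_signed_perms)
  also have "\<dots> = (\<Sum>a\<in>{a \<in> ?S. g a = a}. card ?H)"
  proof (rule sum.cong[OF refl])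
    fix a assume "a \<in> {a \<in> ?S. g a = a}"
    then have "\<bar>a\<bar> \<in> {1..int n}" using S by blast
    then show "card {u \<in> ?G. u (int n) = a} = card ?H" by (rule card_signed_perms_coset[OF assms(1)])
  qed
  also have "\<dots> = 2 * count (fst (signed_cycle_type n g)) 1 * card ?H"
    using count_fixed_points[OF assms(2)] by simp
  finally have cU: "card ?U = 2 * count (fst (signed_cycle_type n g)) 1 * card ?H" .
  have "induced ?H ?G (ext_char (n - 1)) g = (\<Sum>u\<in>?U. ext_char (n - 1) (?c u)) / of_nat (card ?H)"
    using assms(2) by (simp add: induced_def)
  also have "(\<Sum>u\<in>?U. ext_char (n - 1) (?c u)) = (\<Sum>u\<in>?U. ?E / 2)"
    by (rule sum.cong[OF refl val])
  also have "\<dots> = of_nat (card ?U) * (?E / 2)" by (rule sum_constant)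
  also have "\<dots> / of_nat (card ?H) = of_nat (count (fst (signed_cycle_type n g)) 1) * ?E"
  proof -
    have "card ?H \<noteq> 0" by (simp add: card_signed_perms)
    then show ?thesis unfolding cU by simp
  qed
  finally show ?thesis .
qed

section \<open>Signed arc permutations\<close>

text \<open>The representatives are \<open>1, \<dots>, n\<close>, since these are the letters; the
  residue of \<open>0\<close> is the letter \<open>n\<close>.\<close>

definition residue_rep :: "nat \<Rightarrow> int \<Rightarrow> int" where
  "residue_rep n x = (x - 1) mod int n + 1"

definition pluses :: "(nat \<Rightarrow> bool) \<Rightarrow> nat \<Rightarrow> int" where
  "pluses e i = int (card {j \<in> {1..<i}. e j})"

definition minuses :: "(nat \<Rightarrow> bool) \<Rightarrow> nat \<Rightarrow> int" where
  "minuses e i = int (card {j \<in> {1..<i}. \<not> e j})"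

text \<open>The unbarred letters are \<open>b, b + 1, \<dots>\<close> and the barred ones \<open>b - 1, b - 2, \<dots>\<close> (modulo \<open>n\<close>),
  in the order of their positions; \<open>e\<close> tells which positions are unbarred.\<close>

definition arc_letter :: "nat \<Rightarrow> int \<Rightarrow> (nat \<Rightarrow> bool) \<Rightarrow> nat \<Rightarrow> int" where
  "arc_letter n b e i =
     (if e i then residue_rep n (b + pluses e i) else residue_rep n (b - 1 - minuses e i))"

definition arc_perm :: "nat \<Rightarrow> int \<Rightarrow> (nat \<Rightarrow> bool) \<Rightarrow> int \<Rightarrow> int" where
  "arc_perm n b e =
     odd_extension n (\<lambda>i. (if e (nat i) then 1 else - 1) * arc_letter n b e (nat i))"

lemma residue_rep_mem:
  assumes "n \<ge> 1" shows "residue_rep n x \<in> {1..int n}"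
proof -
  have "0 < int n" using assms by simp
  then have "(x - 1) mod int n < int n" "0 \<le> (x - 1) mod int n" by simp_all
  then show ?thesis unfolding residue_rep_def by simp
qed

lemma residue_rep_eq_iff: "residue_rep n x = residue_rep n y \<longleftrightarrow> [x = y] (mod int n)"
  by (simp add: residue_rep_def mod_eq_dvd_iff cong_iff_dvd_diff)

lemma residue_rep_cong: "[residue_rep n x = x] (mod int n)"
proof -
  have "[(x - 1) mod int n + 1 = (x - 1) + 1] (mod int n)" by (intro cong_add) (auto simp: cong_def)
  then show ?thesis by (simp add: residue_rep_def)
qed

lemma residue_rep_id: "x \<in> {1..int n} \<Longrightarrow> residue_rep n x = x"
  by (simp add: residue_rep_def)

lemma cong_eq_of_bounds:
  assumes "[x = y] (mod int n)" "\<bar>x - y\<bar> < int n" shows "x = y"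
proof (rule ccontr)
  assume "x \<noteq> y"
  then have "\<not> int n dvd \<bar>x - y\<bar>" using assms(2) by (intro zdvd_not_zless) auto
  then show False using assms(1) by (simp add: cong_iff_dvd_diff)
qed

text \<open>The representative drops only in the step from \<open>n\<close> to
  \<open>1\<close>.\<close>

lemma residue_rep_less_Suc:
  assumes "n \<ge> 2" shows "residue_rep n (x + 1) < residue_rep n x \<longleftrightarrow> int n dvd x"
proof -
  let ?r = "residue_rep n x"
  have r: "?r \<in> {1..int n}" using residue_rep_mem assms by simp
  have c: "[?r + 1 = x + 1] (mod int n)" using residue_rep_cong by (rule cong_add) simp
  then have e: "residue_rep n (x + 1) = residue_rep n (?r + 1)"
    unfolding residue_rep_eq_iff by (rule cong_sym)
  have d: "int n dvd x \<longleftrightarrow> int n dvd ?r" using cong_dvd_iff[OF residue_rep_cong[of n x]] by simp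
  show ?thesis
  proof (cases "?r = int n")
    case True
    have "residue_rep n (int n + 1) = residue_rep n 1" unfolding residue_rep_eq_iff by (simp add: cong_def)
    also have "\<dots> = 1" using assms by (intro residue_rep_id) simp
    finally show ?thesis using e d True assms by simp
  next
    case False
    then have "residue_rep n (?r + 1) = ?r + 1" using r by (intro residue_rep_id) simp
    moreover have "\<not> int n dvd ?r" using False r by (intro zdvd_not_zless) auto
    ultimately show ?thesis using e d by simp
  qed
qed

lemma residue_rep_Suc_neq: "n \<ge> 2 \<Longrightarrow> residue_rep n (x + 1) \<noteq> residue_rep n x"
  by (simp add: residue_rep_eq_iff cong_iff_dvd_diff)

lemma pluses_1: "pluses e 1 = 0" and minuses_1: "minuses e 1 = 0"
  by (simp_all add: pluses_def minuses_def)

lemma pluses_Suc: "i \<ge> 1 \<Longrightarrow> pluses e (Suc i) = pluses e i + (if e i then 1 else 0)"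
proof -
  assume "i \<ge> 1"
  then have "{j \<in> {1..<Suc i}. e j} = (if e i then insert i {j \<in> {1..<i}. e j} else {j \<in> {1..<i}. e j})"
    by (auto simp: less_Suc_eq)
  then show ?thesis by (simp add: pluses_def)
qed

lemma minuses_eq_pluses: "minuses e = pluses (\<lambda>j. \<not> e j)"
  by (simp add: fun_eq_iff minuses_def pluses_def)

lemma minuses_Suc: "i \<ge> 1 \<Longrightarrow> minuses e (Suc i) = minuses e i + (if e i then 0 else 1)"
  by (simp add: minuses_eq_pluses pluses_Suc)

lemma pluses_add_minuses: "i \<ge> 1 \<Longrightarrow> pluses e i + minuses e i = int i - 1"
proof (induction i rule: dec_induct)
  case base
  then show ?case using pluses_1 minuses_1 by simp
next
  case (step i)
  then show ?case by (auto simp: pluses_Suc minuses_Suc)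
qed

lemma pluses_nonneg: "pluses e i \<ge> 0" and minuses_nonneg: "minuses e i \<ge> 0"
  by (simp_all add: pluses_def minuses_def)

lemma pluses_mono: "i \<le> j \<Longrightarrow> pluses e i \<le> pluses e j"
  unfolding pluses_def of_nat_le_iff by (rule card_mono) auto

lemma minuses_mono: "i \<le> j \<Longrightarrow> minuses e i \<le> minuses e j"
  unfolding minuses_def of_nat_le_iff by (rule card_mono) auto

lemma arc_letter_mem: "n \<ge> 1 \<Longrightarrow> arc_letter n b e i \<in> {1..int n}"
  by (simp add: arc_letter_def residue_rep_mem del: atLeastAtMost_iff)

text \<open>The invariant of the construction: the letters used so far form an arc, to which an
  unbarred letter is added at the upper end and a barred one at the lower end.\<close>

lemma arc_letter_image:
  assumes "i \<ge> 1"
  shows "arc_letter n b e ` {1..<i} = residue_rep n ` {b - minuses e i..b + pluses e i - 1}"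
  using assms
proof (induction i rule: dec_induct)
  case base
  show ?case using pluses_1[of e] minuses_1[of e] by simp
next
  case (step i)
  let ?I = "{b - minuses e i..b + pluses e i - 1}"
  have "{1..<Suc i} = insert i {1..<i}" using step by auto
  then have *: "arc_letter n b e ` {1..<Suc i} = insert (arc_letter n b e i) (residue_rep n ` ?I)"
    using step by simp
  have nn: "pluses e i \<ge> 0" "minuses e i \<ge> 0" using pluses_nonneg minuses_nonneg by auto
  show ?case
  proof (cases "e i")
    case True
    then have "{b - minuses e (Suc i)..b + pluses e (Suc i) - 1} = insert (b + pluses e i) ?I"
      using step nn by (auto simp: pluses_Suc minuses_Suc)
    then show ?thesis using * True by (simp add: arc_letter_def)
  next
    case False
    then have "{b - minuses e (Suc i)..b + pluses e (Suc i) - 1} = insert (b - 1 - minuses e i) ?I"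
      using step nn by (auto simp: pluses_Suc minuses_Suc)
    then show ?thesis using * False by (simp add: arc_letter_def)
  qed
qed

lemma residue_rep_interval_image:
  assumes "n \<ge> 1" shows "residue_rep n ` {a..a + int n - 1} = {1..int n}"
proof (rule card_subset_eq)
  show "residue_rep n ` {a..a + int n - 1} \<subseteq> {1..int n}" using residue_rep_mem[OF assms] by blast
  have "inj_on (residue_rep n) {a..a + int n - 1}"
  proof (rule inj_onI)
    fix x y assume "x \<in> {a..a + int n - 1}" "y \<in> {a..a + int n - 1}" "residue_rep n x = residue_rep n y"
    then show "x = y" unfolding residue_rep_eq_iff by (intro cong_eq_of_bounds) auto
  qed
  then show "card (residue_rep n ` {a..a + int n - 1}) = card {1..int n}" by (simp add: card_image)
qed simp

lemma arc_letter_bij: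
  assumes "n \<ge> 1"
  shows "arc_letter n b e ` {1..n} = {1..int n}" "inj_on (arc_letter n b e) {1..n}"
proof -
  have "{1..n} = {1..<Suc n}" by auto
  moreover have *: "b + pluses e (Suc n) - 1 = b - minuses e (Suc n) + int n - 1"
    using pluses_add_minuses[of "Suc n" e] by simp
  moreover have "arc_letter n b e ` {1..<Suc n} = {1..int n}"
    unfolding arc_letter_image[OF le_SucI[OF assms]] * by (rule residue_rep_interval_image[OF assms])
  ultimately show im: "arc_letter n b e ` {1..n} = {1..int n}" by simp
  then have "card (arc_letter n b e ` {1..n}) = card {1..n}" by simp
  then show "inj_on (arc_letter n b e) {1..n}" by (intro eq_card_imp_inj_on) auto
qed

lemma arc_perm_apply:
  "i \<in> {1..n} \<Longrightarrow> arc_perm n b e (int i) = (if e i then 1 else - 1) * arc_letter n b e i"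
  unfolding arc_perm_def by (simp add: odd_extension_def)

lemma arc_perm_signed_perm:
  assumes "n \<ge> 1" shows "arc_perm n b e \<in> signed_perms n"
  unfolding arc_perm_def
proof (rule odd_extension_signed_perm)
  let ?f = "\<lambda>i. (if e (nat i) then 1 else - 1) * arc_letter n b e (nat i)"
  have abs: "\<bar>?f i\<bar> = arc_letter n b e (nat i)" for i
    using arc_letter_mem[OF assms, of b e "nat i"] by (auto simp: abs_mult)
  show "\<bar>?f i\<bar> \<in> {1..int n}" for i unfolding abs by (rule arc_letter_mem[OF assms])
  show "inj_on (\<lambda>i. \<bar>?f i\<bar>) {1..int n}"
    unfolding abs
  proof (rule inj_onI)
    fix x y assume xy: "x \<in> {1..int n}" "y \<in> {1..int n}" "arc_letter n b e (nat x) = arc_letter n b e (nat y)"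
    then have "nat x = nat y" by (intro inj_onD[OF arc_letter_bij(2)[OF assms], of b e]) auto
    then show "x = y" using xy by auto
  qed
qed

lemma abs_arc_perm:
  assumes "i \<in> {1..n}" shows "\<bar>arc_perm n b e (int i)\<bar> = arc_letter n b e i"
proof -
  have "1 \<le> arc_letter n b e i" using arc_letter_mem[of n b e i] assms by simp
  then show ?thesis by (simp add: arc_perm_apply[OF assms] abs_mult)
qed

lemma arc_perm_pos_iff:
  assumes "i \<in> {1..n}" shows "0 < arc_perm n b e (int i) \<longleftrightarrow> e i"
proof -
  have "1 \<le> arc_letter n b e i" using arc_letter_mem[of n b e i] assms by simp
  then show ?thesis by (simp add: arc_perm_apply[OF assms])
qed

lemma int_atLeastAtMost_image: "{1..int i - 1} = int ` {1..<i}"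
proof (intro equalityI subsetI)
  fix x assume "x \<in> {1..int i - 1}"
  then have "x = int (nat x)" "nat x \<in> {1..<i}" by auto
  then show "x \<in> int ` {1..<i}" by (rule image_eqI)
qed auto

lemma arc_perm_prefix:
  assumes "i \<in> {1..n}"
  shows "(\<lambda>j. \<bar>arc_perm n b e j\<bar>) ` {1..int i - 1} = residue_rep n ` {b - minuses e i..b + pluses e i - 1}"
proof -
  have "(\<lambda>j. \<bar>arc_perm n b e j\<bar>) ` {1..int i - 1} = (\<lambda>j. \<bar>arc_perm n b e (int j)\<bar>) ` {1..<i}"
    unfolding int_atLeastAtMost_image image_image ..
  also have "\<dots> = arc_letter n b e ` {1..<i}"
    using assms by (intro image_cong refl abs_arc_perm) auto
  finally show ?thesis using arc_letter_image[of i n b e] assms by simp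
qed

lemma cyclic_interval_residue_rep:
  "cyclic_interval n (residue_rep n ` {a..c})"
proof -
  have "(\<lambda>x. x mod int n) ` residue_rep n ` {a..c} = (\<lambda>x. x mod int n) ` {a..c}"
    unfolding image_image using residue_rep_cong by (intro image_cong refl) (simp add: cong_def)
  also have "\<dots> = (\<lambda>x. x mod int n) ` (\<lambda>j. a + int j) ` {..<nat (c - a + 1)}"
  proof (rule arg_cong[of _ _ "image _"])
    show "{a..c} = (\<lambda>j. a + int j) ` {..<nat (c - a + 1)}"
    proof (intro equalityI subsetI)
      fix x assume "x \<in> {a..c}"
      then have "x = a + int (nat (x - a))" "nat (x - a) \<in> {..<nat (c - a + 1)}" by auto
      then show "x \<in> (\<lambda>j. a + int j) ` {..<nat (c - a + 1)}" by (rule image_eqI)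
    qed auto
  qed
  finally have "(\<lambda>x. x mod int n) ` residue_rep n ` {a..c}
      = (\<lambda>j. (a + int j) mod int n) ` {..<nat (c - a + 1)}"
    by (simp only: image_image)
  then show ?thesis unfolding cyclic_interval_def by (intro exI)
qed

text \<open>Before a position \<open>i \<le> n - 1\<close> the arc has at most \<open>n - 2\<close>
  elements. A barred letter extends it at the lower end, so the residue below that letter could lie
  in the arc only by wrapping around, for which the arc is too short. The unbarred case is
  symmetric.\<close>

lemma arc_perm_arc:
  assumes "n \<ge> 2" shows "arc_perm n b e \<in> signed_arc_perms n"
  unfolding signed_arc_perms_def mem_Collect_eq Let_def
proof (intro conjI ballI impI)
  let ?w = "arc_perm n b e"
  show "?w \<in> signed_perms n" using arc_perm_signed_perm assms by simp
  fix i' assume i': "i' \<in> {2..int n - 1}"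
  define i where "i = nat i'"
  have i: "i' = int i" "i \<in> {1..n}" "i \<ge> 2" "i \<le> n - 1" using i' by (auto simp: i_def)
  let ?A = "(\<lambda>j. \<bar>?w j\<bar>) ` {1..i' - 1}" and ?I = "{b - minuses e i..b + pluses e i - 1}"
  have A: "?A = residue_rep n ` ?I" unfolding i(1) by (rule arc_perm_prefix[OF i(2)])
  show "cyclic_interval n ?A" unfolding A by (rule cyclic_interval_residue_rep)
  have pm: "pluses e i + minuses e i = int i - 1" using pluses_add_minuses i by simp
  {
    assume "\<exists>a\<in>?A. [\<bar>?w i'\<bar> - 1 = a] (mod int n)"
    then obtain x where x: "x \<in> ?I" "[\<bar>?w i'\<bar> - 1 = residue_rep n x] (mod int n)" unfolding A by blast
    show "?w i' > 0"
    proof (rule ccontr)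
      assume "\<not> ?w i' > 0"
      then have ne: "\<not> e i" using arc_perm_pos_iff[OF i(2)] i(1) by simp
      have "\<bar>?w i'\<bar> = residue_rep n (b - 1 - minuses e i)"
        unfolding i(1) abs_arc_perm[OF i(2)] using ne by (simp add: arc_letter_def)
      then have "[\<bar>?w i'\<bar> - 1 = b - 1 - minuses e i - 1] (mod int n)"
        using residue_rep_cong cong_diff[OF _ cong_refl] by metis
      then have "[x = b - 1 - minuses e i - 1] (mod int n)"
        using cong_trans[OF x(2) residue_rep_cong] cong_sym cong_trans by blast
      moreover have "\<bar>x - (b - 1 - minuses e i - 1)\<bar> < int n" using x(1) pm i by auto
      ultimately have "x = b - 1 - minuses e i - 1" by (rule cong_eq_of_bounds)
      then show False using x(1) by simp
    qed
  }
  {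
    assume "\<exists>a\<in>?A. [\<bar>?w i'\<bar> + 1 = a] (mod int n)"
    then obtain x where x: "x \<in> ?I" "[\<bar>?w i'\<bar> + 1 = residue_rep n x] (mod int n)" unfolding A by blast
    have "\<not> e i"
    proof
      assume e: "e i"
      have "\<bar>?w i'\<bar> = residue_rep n (b + pluses e i)"
        unfolding i(1) abs_arc_perm[OF i(2)] using e by (simp add: arc_letter_def)
      then have "[\<bar>?w i'\<bar> + 1 = b + pluses e i + 1] (mod int n)"
        using residue_rep_cong cong_add[OF _ cong_refl] by metis
      then have "[x = b + pluses e i + 1] (mod int n)"
        using cong_trans[OF x(2) residue_rep_cong] cong_sym cong_trans by blast
      moreover have "\<bar>x - (b + pluses e i + 1)\<bar> < int n" using x(1) pm i by auto
      ultimately have "x = b + pluses e i + 1" by (rule cong_eq_of_bounds)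
      then show False using x(1) by simp
    qed
    moreover have "?w i' \<noteq> 0" using abs_arc_perm[OF i(2), of b e] arc_letter_mem[of n b e i] assms i(1) by auto
    ultimately show "?w i' < 0" using arc_perm_pos_iff[OF i(2), of b e] i(1) by simp
  }
qed

section \<open>Every signed arc permutation is determined by its signs and a residue\<close>

lemma signed_perms_abs_cong:
  assumes "w \<in> signed_perms n" "j \<in> {1..int n}" "k \<in> {1..int n}" "[\<bar>w j\<bar> = \<bar>w k\<bar>] (mod int n)"
  shows "j = k"
proof -
  have "\<bar>w j\<bar> \<in> {1..int n}" "\<bar>w k\<bar> \<in> {1..int n}"
    using signed_perms_abs_mem[OF assms(1)] assms(2,3) by simp_all
  then have "\<bar>w j\<bar> = \<bar>w k\<bar>" using assms(4) by (intro cong_eq_of_bounds) auto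
  then show ?thesis using abs_image_signed_perm(1)[OF assms(1)] assms(2,3) by (simp add: inj_on_def)
qed

lemma signed_arc_permsD:
  assumes "w \<in> signed_arc_perms n" "i \<in> {2..int n - 1}"
  defines "A \<equiv> (\<lambda>j. \<bar>w j\<bar>) ` {1..i - 1}"
  shows "cyclic_interval n A" "\<exists>a\<in>A. [\<bar>w i\<bar> - 1 = a] (mod int n) \<Longrightarrow> w i > 0"
    "\<exists>a\<in>A. [\<bar>w i\<bar> + 1 = a] (mod int n) \<Longrightarrow> w i < 0"
  using assms(1,2) unfolding signed_arc_perms_def A_def Let_def by blast+

lemma signed_arc_perms_signed_perm: "w \<in> signed_arc_perms n \<Longrightarrow> w \<in> signed_perms n"
  by (simp add: signed_arc_perms_def)

text \<open>The sign rules only speak about letters with a neighbour among the earlier ones. That a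
  neighbour exists follows from the interval condition at the next position. For
  \<open>i = n - 1\<close> there is no such condition, but then only the last letter lies outside
  the first \<open>i\<close> ones, so it cannot be both neighbours of the letter at
  \<open>i\<close>, which are distinct because \<open>n \<ge> 3\<close>.\<close>

lemma signed_arc_neighbour:
  assumes "w \<in> signed_arc_perms n" "i \<in> {2..int n - 1}"
  shows "(\<exists>a\<in>(\<lambda>j. \<bar>w j\<bar>) ` {1..i - 1}. [\<bar>w i\<bar> - 1 = a] (mod int n)) \<or>
    (\<exists>a\<in>(\<lambda>j. \<bar>w j\<bar>) ` {1..i - 1}. [\<bar>w i\<bar> + 1 = a] (mod int n))"
proof -
  note w = signed_arc_perms_signed_perm[OF assms(1)]
  have n: "n \<ge> 3" and i: "i \<in> {1..int n}" using assms(2) by auto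
  have nd: "\<not> [x = x + 1] (mod int n)" "\<not> [x = x - 1] (mod int n)" "\<not> [x - 1 = x + 1] (mod int n)" for x
  proof -
    have "\<not> int n dvd 1" "\<not> int n dvd 2" using n zdvd_imp_le[of "int n" 1] zdvd_imp_le[of "int n" 2] by auto
    then show "\<not> [x = x + 1] (mod int n)" "\<not> [x = x - 1] (mod int n)" "\<not> [x - 1 = x + 1] (mod int n)"
      by (simp_all add: cong_iff_dvd_diff)
  qed
  show ?thesis
  proof (cases "i = int n - 1")
    case True
    have ex: "\<exists>j. (j \<in> {1..i - 1} \<or> j = int n) \<and> [y = \<bar>w j\<bar>] (mod int n)"
      if y: "\<not> [\<bar>w i\<bar> = y] (mod int n)" for y
    proof -
      have "residue_rep n y \<in> (\<lambda>j. \<bar>w j\<bar>) ` {1..int n}"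
        unfolding abs_image_signed_perm(2)[OF w] using residue_rep_mem n by simp
      then obtain j where j: "j \<in> {1..int n}" "residue_rep n y = \<bar>w j\<bar>" by (rule imageE)
      have c: "[y = \<bar>w j\<bar>] (mod int n)" using residue_rep_cong[of n y] j(2) by (simp add: cong_sym)
      then have "j \<noteq> i" using y cong_sym by blast
      then have "j \<in> {1..i - 1} \<or> j = int n" using j(1) True by auto
      then show ?thesis using c by blast
    qed
    obtain j where j: "j \<in> {1..i - 1} \<or> j = int n" "[\<bar>w i\<bar> - 1 = \<bar>w j\<bar>] (mod int n)"
      using ex[OF nd(2)] by blast
    obtain k where k: "k \<in> {1..i - 1} \<or> k = int n" "[\<bar>w i\<bar> + 1 = \<bar>w k\<bar>] (mod int n)"
      using ex[OF nd(1)] by blast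
    have "j \<noteq> k"
    proof
      assume "j = k"
      then have "[\<bar>w i\<bar> - 1 = \<bar>w i\<bar> + 1] (mod int n)" using cong_trans[OF j(2) cong_sym] k(2) by blast
      then show False using nd(3) by blast
    qed
    then show ?thesis using j k by blast
  next
    case False
    then have i1: "i + 1 \<in> {2..int n - 1}" using assms(2) by auto
    \<comment> \<open>The condition at \<open>i + 1\<close> makes the letters up to \<open>i\<close>
      an arc. The letter at \<open>i\<close> sits at some place \<open>t\<close> of it: for
      \<open>t > 0\<close> the place before it holds its predecessor; for \<open>t = 0\<close> the
      place after it holds its successor, and the arc has such a place because the letters at
      \<open>1\<close> and at \<open>i\<close> differ.\<close>
    let ?B = "(\<lambda>j. \<bar>w j\<bar>) ` {1..i}"
    obtain a and k :: nat where ak: "(\<lambda>x. x mod int n) ` ?B = (\<lambda>j. (a + int j) mod int n) ` {..<k}"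
      using signed_arc_permsD(1)[OF assms(1) i1] unfolding cyclic_interval_def by auto
    have mem: "\<exists>j\<in>{1..i}. [a + int t = \<bar>w j\<bar>] (mod int n)" if "t < k" for t
    proof -
      have "(a + int t) mod int n \<in> (\<lambda>x. x mod int n) ` ?B" unfolding ak using that by blast
      then show ?thesis unfolding image_image by (auto simp: cong_def)
    qed
    have mem': "\<exists>t<k. [a + int t = \<bar>w j\<bar>] (mod int n)" if "j \<in> {1..i}" for j
    proof -
      have "\<bar>w j\<bar> mod int n \<in> (\<lambda>j. (a + int j) mod int n) ` {..<k}" unfolding ak[symmetric] using that by blast
      then show ?thesis by (auto simp: cong_def)
    qed
    obtain t where t: "t < k" "[a + int t = \<bar>w i\<bar>] (mod int n)" using mem'[of i] assms(2) by auto
    have lt: "j \<in> {1..i - 1}" if "j \<in> {1..i}" "j \<noteq> i" for j using that by auto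
    show ?thesis
    proof (cases "t = 0")
      case False
      then obtain j where j: "j \<in> {1..i}" "[a + int (t - 1) = \<bar>w j\<bar>] (mod int n)"
        using mem[of "t - 1"] t(1) by (meson less_imp_diff_less)
      have "[a + int t - 1 = \<bar>w i\<bar> - 1] (mod int n)" using t(2) by (rule cong_diff) simp
      then have c: "[\<bar>w i\<bar> - 1 = \<bar>w j\<bar>] (mod int n)"
        using j(2) False by (metis cong_sym cong_trans add_diff_eq of_nat_1 of_nat_diff One_nat_def Suc_leI neq0_conv)
      then have "j \<noteq> i" using nd(2) cong_sym by blast
      then show ?thesis using c lt[OF j(1)] by blast
    next
      case True
      have "k > 1"
      proof (rule ccontr)
        assume "\<not> k > 1"
        moreover obtain r where "r < k" "[a + int r = \<bar>w 1\<bar>] (mod int n)" using mem'[of 1] assms(2) by auto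
        ultimately have "[a + int 0 = \<bar>w 1\<bar>] (mod int n)" by (cases "r = 0") auto
        then have "[\<bar>w 1\<bar> = \<bar>w i\<bar>] (mod int n)" using t(2) True cong_sym cong_trans by blast
        then have "1 = i" using signed_perms_abs_cong[OF w _ i] n by simp
        then show False using assms(2) by simp
      qed
      then obtain j where j: "j \<in> {1..i}" "[a + int 1 = \<bar>w j\<bar>] (mod int n)"
        using mem[of 1] by auto
      have "[a + int 0 + 1 = \<bar>w i\<bar> + 1] (mod int n)" using t(2) True by (intro cong_add) auto
      then have c: "[\<bar>w i\<bar> + 1 = \<bar>w j\<bar>] (mod int n)"
        using j(2) cong_sym cong_trans by (metis add.right_neutral of_nat_0 of_nat_1)
      then have "j \<noteq> i" using nd(1) cong_sym by blast
      then show ?thesis using c lt[OF j(1)] by blast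
    qed
  qed
qed

lemma signed_arc_perm_eq_arc_perm:
  assumes "n \<ge> 2" "w \<in> signed_arc_perms n"
  obtains b e where "b \<in> {1..int n}" "e \<in> {1..n} \<rightarrow>\<^sub>E UNIV" "w = arc_perm n b e"
proof -
  note w = signed_arc_perms_signed_perm[OF assms(2)]
  define e where "e = (\<lambda>i\<in>{1..n}. 0 < w (int i))"
  \<comment> \<open>With no earlier letters an unbarred first letter must be \<open>b\<close> and a
    barred one \<open>b - 1\<close>.\<close>
  define b where "b = (if e 1 then \<bar>w 1\<bar> else residue_rep n (\<bar>w 1\<bar> + 1))"
  have wm: "\<bar>w (int i)\<bar> \<in> {1..int n}" if "i \<in> {1..n}" for i
    using signed_perms_abs_mem[OF w, of "int i"] that by simp
  have e: "e i \<longleftrightarrow> 0 < w (int i)" if "i \<in> {1..n}" for i using that by (simp add: e_def)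
  have b: "b \<in> {1..int n}"
    unfolding b_def using wm[of 1] residue_rep_mem[of n "\<bar>w 1\<bar> + 1"] assms(1) by simp
  have letters: "\<bar>w (int i)\<bar> = arc_letter n b e i" if "i \<in> {1..n}" for i
    using that
  proof (induction i rule: less_induct)
    case (less i)
    have id: "residue_rep n \<bar>w (int i)\<bar> = \<bar>w (int i)\<bar>" by (rule residue_rep_id[OF wm[OF less.prems]])
    have letterI: "\<bar>w (int i)\<bar> = arc_letter n b e i"
      if "e i \<Longrightarrow> [\<bar>w (int i)\<bar> = b + pluses e i] (mod int n)"
        "\<not> e i \<Longrightarrow> [\<bar>w (int i)\<bar> = b - 1 - minuses e i] (mod int n)"
      using that id unfolding arc_letter_def residue_rep_eq_iff[symmetric] by simp
    let ?A = "(\<lambda>j. \<bar>w j\<bar>) ` {1..int i - 1}" and ?I = "{b - minuses e i..b + pluses e i - 1}"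
    have pm: "pluses e i + minuses e i = int i - 1" using pluses_add_minuses less.prems by simp
    have A: "?A = residue_rep n ` ?I"
    proof -
      have "?A = (\<lambda>j. \<bar>w (int j)\<bar>) ` {1..<i}" unfolding int_atLeastAtMost_image image_image ..
      also have "\<dots> = arc_letter n b e ` {1..<i}"
        using less by (intro image_cong refl) auto
      finally show ?thesis using arc_letter_image[of i n b e] less.prems by simp
    qed
    have notin: "\<not> [\<bar>w (int i)\<bar> = x] (mod int n)" if "x \<in> ?I" for x
    proof
      assume "[\<bar>w (int i)\<bar> = x] (mod int n)"
      then have "\<bar>w (int i)\<bar> = residue_rep n x" unfolding residue_rep_eq_iff[symmetric] id .
      then have "\<bar>w (int i)\<bar> \<in> ?A" unfolding A using that by blast
      then obtain j where j: "j \<in> {1..int i - 1}" "\<bar>w (int i)\<bar> = \<bar>w j\<bar>" by (rule imageE)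
      then have "int i = j" using less.prems by (intro signed_perms_abs_cong[OF w]) auto
      then show False using j(1) by simp
    qed
    consider "i = 1" | "i \<ge> 2" "i \<le> n - 1" | "i = n" using less.prems by fastforce
    then show ?case
    proof cases
      case 1
      show ?thesis
      proof (rule letterI)
        assume "e i"
        then show "[\<bar>w (int i)\<bar> = b + pluses e i] (mod int n)" using 1 pluses_1[of e] by (simp add: b_def)
      next
        assume "\<not> e i"
        then have "b = residue_rep n (\<bar>w 1\<bar> + 1)" using 1 by (simp add: b_def)
        then have "[b - 1 = \<bar>w 1\<bar> + 1 - 1] (mod int n)" using residue_rep_cong by (intro cong_diff) auto
        then show "[\<bar>w (int i)\<bar> = b - 1 - minuses e i] (mod int n)"
          using 1 minuses_1[of e] by (simp add: cong_sym)
      qed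
    next
      case 2
      then have i: "int i \<in> {2..int n - 1}" by auto
      from signed_arc_neighbour[OF assms(2) i] show ?thesis
      proof
        assume ex: "\<exists>a\<in>?A. [\<bar>w (int i)\<bar> - 1 = a] (mod int n)"
        have ei: "e i" using signed_arc_permsD(2)[OF assms(2) i ex] e[OF less.prems] by simp
        obtain x where x: "x \<in> ?I" "[\<bar>w (int i)\<bar> - 1 = residue_rep n x] (mod int n)"
          using ex unfolding A by blast
        have "[\<bar>w (int i)\<bar> - 1 = x] (mod int n)" using cong_trans[OF x(2) residue_rep_cong] .
        then have "[\<bar>w (int i)\<bar> - 1 + 1 = x + 1] (mod int n)" by (intro cong_add) auto
        then have c: "[\<bar>w (int i)\<bar> = x + 1] (mod int n)" by simp
        then have "x + 1 \<notin> ?I" using notin by blast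
        then have "x + 1 = b + pluses e i" using x(1) by auto
        then show ?thesis using c ei by (intro letterI) simp_all
      next
        assume ex: "\<exists>a\<in>?A. [\<bar>w (int i)\<bar> + 1 = a] (mod int n)"
        have ei: "\<not> e i" using signed_arc_permsD(3)[OF assms(2) i ex] e[OF less.prems] by simp
        obtain x where x: "x \<in> ?I" "[\<bar>w (int i)\<bar> + 1 = residue_rep n x] (mod int n)"
          using ex unfolding A by blast
        have "[\<bar>w (int i)\<bar> + 1 = x] (mod int n)" using cong_trans[OF x(2) residue_rep_cong] .
        then have "[\<bar>w (int i)\<bar> + 1 - 1 = x - 1] (mod int n)" by (intro cong_diff) auto
        then have c: "[\<bar>w (int i)\<bar> = x - 1] (mod int n)" by simp
        then have "x - 1 \<notin> ?I" using notin by blast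
        then have "x - 1 = b - 1 - minuses e i" using x(1) by auto
        then have "[\<bar>w (int i)\<bar> = b - 1 - minuses e i] (mod int n)" using c by (simp only:)
        then show ?thesis using ei by (intro letterI) simp_all
      qed
    next
      \<comment> \<open>The last letter is subject to no condition. Only one residue is left, and it
        is the upper as well as the lower extension of the arc, since these differ by
        \<open>n\<close>; hence both signs are covered.\<close>
      case 3
      have "\<bar>w (int i)\<bar> \<in> residue_rep n ` {b - minuses e i..b - minuses e i + int n - 1}"
        using residue_rep_interval_image[of n "b - minuses e i"] assms(1) wm[OF less.prems] by simp
      then obtain x where x: "x \<in> {b - minuses e i..b - minuses e i + int n - 1}"
        "\<bar>w (int i)\<bar> = residue_rep n x" by (rule imageE)
      have c: "[\<bar>w (int i)\<bar> = x] (mod int n)" unfolding x(2) by (rule residue_rep_cong)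
      then have "x \<notin> ?I" using notin by blast
      then have "x = b + pluses e i" using x(1) pm 3 by auto
      moreover have "b + pluses e i = b - 1 - minuses e i + int n" using pm 3 by simp
      moreover have "[b - 1 - minuses e i + int n = b - 1 - minuses e i] (mod int n)" by (simp add: cong_def)
      ultimately have "[\<bar>w (int i)\<bar> = b + pluses e i] (mod int n)"
        "[\<bar>w (int i)\<bar> = b - 1 - minuses e i] (mod int n)"
        using c cong_trans by metis+
      then show ?thesis by (rule letterI)
    qed
  qed
  have "w = arc_perm n b e"
  proof (rule signed_perms_eqI[OF w arc_perm_signed_perm])
    show "n \<ge> 1" using assms(1) by simp
    fix i assume "i \<in> {1..int n}"
    then obtain k where k: "i = int k" "k \<in> {1..n}" by (metis atLeastAtMost_iff int_ops(2) nat_le_iff of_nat_le_iff nat_eq_iff zero_le_one order_trans)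
    have "w (int k) = (if e k then 1 else - 1) * \<bar>w (int k)\<bar>" using e[OF k(2)] wm[OF k(2)] by auto
    then show "w i = arc_perm n b e i" using letters[OF k(2)] arc_perm_apply[OF k(2)] k(1) by simp
  qed
  moreover have "e \<in> {1..n} \<rightarrow>\<^sub>E UNIV" by (simp add: e_def)
  ultimately show ?thesis using that b by blast
qed

text \<open>The signs give back \<open>e\<close>, and the first letter then gives back
  \<open>b\<close>.\<close>

lemma arc_perm_bij:
  assumes "n \<ge> 2"
  shows "bij_betw (\<lambda>(e, b). arc_perm n b e) (({1..n} \<rightarrow>\<^sub>E UNIV) \<times> {1..int n}) (signed_arc_perms n)"
  unfolding bij_betw_def
proof
  show "inj_on (\<lambda>(e, b). arc_perm n b e) (({1..n} \<rightarrow>\<^sub>E UNIV) \<times> {1..int n})"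
  proof (rule inj_onI, clarify)
    fix e e' :: "nat \<Rightarrow> bool" and b b'
    assume e: "e \<in> {1..n} \<rightarrow>\<^sub>E UNIV" "e' \<in> {1..n} \<rightarrow>\<^sub>E UNIV" and b: "b \<in> {1..int n}" "b' \<in> {1..int n}"
      and eq: "arc_perm n b e = arc_perm n b' e'"
    have ee: "e = e'"
      using e
    proof (rule PiE_ext)
      fix i assume "i \<in> {1..n}"
      then show "e i = e' i" using arc_perm_pos_iff eq by metis
    qed
    have 1: "1 \<in> {1..n}" using assms by simp
    have "arc_letter n b e 1 = arc_letter n b' e 1" using abs_arc_perm[OF 1] eq ee by metis
    then have "[b = b'] (mod int n)"
      using pluses_1[of e] minuses_1[of e]
      by (cases "e 1") (simp_all add: arc_letter_def residue_rep_eq_iff cong_iff_dvd_diff)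
    then have "b = b'" using b by (intro cong_eq_of_bounds) auto
    then show "e = e' \<and> b = b'" using ee by simp
  qed
  show "(\<lambda>(e, b). arc_perm n b e) ` (({1..n} \<rightarrow>\<^sub>E UNIV) \<times> {1..int n}) = signed_arc_perms n"
  proof (intro equalityI subsetI)
    fix w assume "w \<in> (\<lambda>(e, b). arc_perm n b e) ` (({1..n} \<rightarrow>\<^sub>E UNIV) \<times> {1..int n})"
    then show "w \<in> signed_arc_perms n" using arc_perm_arc[OF assms] by auto
  next
    fix w assume "w \<in> signed_arc_perms n"
    then obtain b e where "b \<in> {1..int n}" "e \<in> {1..n} \<rightarrow>\<^sub>E UNIV" "w = arc_perm n b e"
      using signed_arc_perm_eq_arc_perm[OF assms] by blast
    then show "w \<in> (\<lambda>(e, b). arc_perm n b e) ` (({1..n} \<rightarrow>\<^sub>E UNIV) \<times> {1..int n})"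
      by (intro image_eqI[of _ _ "(e, b)"]) auto
  qed
qed

section \<open>The signed descent sets of the arc permutations\<close>

definition arc_descents :: "nat \<Rightarrow> (nat \<Rightarrow> bool) \<Rightarrow> nat set \<Rightarrow> nat set" where
  "arc_descents n e T = {n} \<union> {s \<in> {1..n - 1}. e s \<noteq> e (s + 1) \<or> (e s \<longleftrightarrow> s \<in> T)}"

text \<open>The value \<open>1\<close> outside \<open>{1..n}\<close> is the one that
  \<open>sDes\<close> takes there, because \<open>w\<close> fixes these positions. Thus the signed
  descent sets are equal as pairs and not only on the relevant positions.\<close>

definition arc_signs :: "nat \<Rightarrow> (nat \<Rightarrow> bool) \<Rightarrow> nat \<Rightarrow> int" where
  "arc_signs n e s = (if s \<in> {1..n} \<and> \<not> e s then - 1 else 1)"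

text \<open>The toggled positions are those where the step to a neighbour of the same sign crosses
  between \<open>n\<close> and \<open>1\<close>. An unbarred step goes up and crosses if it starts
  at \<open>n\<close>; a barred step goes from \<open>b - 1 - minuses e s\<close> down and crosses
  if it ends at \<open>n\<close>. Uncrossed, the former is an ascent and the latter a descent,
  because barred letters are ordered by absolute value.\<close>

lemma sDes_arc_perm:
  assumes "n \<ge> 2"
  shows "sDes n (arc_perm n b e) =
    (arc_descents n e {s. int n dvd (if e s then b + pluses e s else b - 2 - minuses e s)}, arc_signs n e)"
proof -
  let ?w = "arc_perm n b e" and ?T = "{s. int n dvd (if e s then b + pluses e s else b - 2 - minuses e s)}"
  let ?L = "arc_letter n b e"
  have wp: "?w \<in> signed_perms n" using arc_perm_signed_perm assms by simp
  have "(if ?w (int s) < 0 then - 1 else 1) = arc_signs n e s" for s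
  proof (cases "s \<in> {1..n}")
    case True
    have "1 \<le> ?L s" using arc_letter_mem[of n b e s] assms by simp
    then show ?thesis using True arc_perm_apply[OF True, of b e] by (simp add: arc_signs_def)
  next
    case False
    then have "?w (int s) = int s" by (intro signed_perms_outside[OF wp]) auto
    then show ?thesis using False by (auto simp: arc_signs_def)
  qed
  moreover have "(less_r (?w (int s + 1)) (?w (int s)) \<or> (?w (int s) < 0 \<and> ?w (int s + 1) > 0))
      \<longleftrightarrow> e s \<noteq> e (s + 1) \<or> (e s \<longleftrightarrow> s \<in> ?T)" if s: "s \<in> {1..n - 1}" for s
  proof -
    have m: "s \<in> {1..n}" "Suc s \<in> {1..n}" using s by auto
    have pos: "1 \<le> ?L s" "1 \<le> ?L (Suc s)" using arc_letter_mem[of n b e] assms by simp_all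
    have ws: "?w (int s) = (if e s then 1 else - 1) * ?L s"
      "?w (int s + 1) = (if e (Suc s) then 1 else - 1) * ?L (Suc s)"
      using arc_perm_apply[OF m(1)] arc_perm_apply[OF m(2), of b e] by (simp_all add: add.commute)
    consider "e s \<noteq> e (Suc s)" | "e s" "e (Suc s)" | "\<not> e s" "\<not> e (Suc s)" by blast
    then show ?thesis
    proof cases
      case 1
      then show ?thesis using ws pos by (auto simp: less_r_def)
    next
      case 2
      have "?L (Suc s) < ?L s \<longleftrightarrow> int n dvd (b + pluses e s)"
        using residue_rep_less_Suc[OF assms, of "b + pluses e s"] 2 s
        by (simp add: arc_letter_def pluses_Suc add.assoc)
      then show ?thesis using 2 ws pos by (simp add: less_r_def)
    next
      case 3
      have "?L s = residue_rep n (b - 2 - minuses e s + 1)" "?L (Suc s) = residue_rep n (b - 2 - minuses e s)"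
        using 3 s by (simp_all add: arc_letter_def minuses_Suc algebra_simps)
      then have "?L (Suc s) < ?L s \<longleftrightarrow> \<not> int n dvd (b - 2 - minuses e s)"
        using residue_rep_less_Suc[OF assms, of "b - 2 - minuses e s"]
          residue_rep_Suc_neq[OF assms, of "b - 2 - minuses e s"] by auto
      then show ?thesis using 3 ws pos by (simp add: less_r_def)
    qed
  qed
  ultimately show ?thesis
    unfolding sDes_def arc_descents_def by (intro arg_cong2[of _ _ _ _ Pair] arg_cong[of _ _ "(\<union>) {n}"] Collect_cong ext) blast+
qed

text \<open>Rotating the letters moves the step from \<open>n\<close> to \<open>1\<close> through all pairs of adjacent positions
  of equal sign; whenever that step is not between adjacent positions, it does not affect the
  descents.\<close>

lemma sum_arc_descents:
  fixes G :: "nat set \<Rightarrow> 'c :: comm_ring_1"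
  assumes "n \<ge> 2"
  shows "(\<Sum>b = 1..int n. G (arc_descents n e {s. int n dvd (if e s then b + pluses e s else b - 2 - minuses e s)}))
    = (\<Sum>s = 1..n. G (arc_descents n e {s}))"
proof -
  let ?T = "\<lambda>b. {s. int n dvd (if e s then b + pluses e s else b - 2 - minuses e s)}"
  define Q where "Q = {s \<in> {1..n - 1}. e s = e (Suc s)}"
  \<comment> \<open>Modulo \<open>n\<close> this is the rotation \<open>b\<close> that toggles the
    position \<open>s\<close>.\<close>
  define c where "c s = (if e s then - pluses e s else 2 + minuses e s)" for s
  have Q: "Q \<subseteq> {1..n}" "finite Q" by (auto simp: Q_def)
  have TQ: "s \<in> ?T b \<longleftrightarrow> b = residue_rep n (c s)" if "b \<in> {1..int n}" for b s
  proof -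
    have "s \<in> ?T b \<longleftrightarrow> [b = c s] (mod int n)"
      by (simp add: c_def cong_iff_dvd_diff algebra_simps)
    also have "\<dots> \<longleftrightarrow> b = residue_rep n (c s)"
      unfolding residue_rep_eq_iff[symmetric] residue_rep_id[OF that] ..
    finally show ?thesis .
  qed
  have inj: "inj_on (\<lambda>s. residue_rep n (c s)) Q"
  proof -
    have neq: "\<not> [c s = c t] (mod int n)" if st: "s \<in> Q" "t \<in> Q" "s < t" for s t
    proof
      assume cong: "[c s = c t] (mod int n)"
      have m: "s \<ge> 1" "t \<ge> 1" "t \<le> n - 1" "e s = e (Suc s)" "e t = e (Suc t)"
        using st unfolding Q_def by auto
      have P: "pluses e (Suc s) \<le> pluses e t" "minuses e (Suc s) \<le> minuses e t"
        using st(3) pluses_mono minuses_mono by simp_all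
      have P2: "pluses e (Suc (Suc t)) + minuses e (Suc (Suc t)) = int t + 1"
        using pluses_add_minuses[of "Suc (Suc t)" e] by simp
      have Pst: "pluses e (Suc s) = pluses e s + (if e s then 1 else 0)" "minuses e (Suc s) = minuses e s + (if e s then 0 else 1)"
        "pluses e (Suc t) = pluses e t + (if e t then 1 else 0)" "minuses e (Suc t) = minuses e t + (if e t then 0 else 1)"
        "pluses e (Suc (Suc t)) = pluses e (Suc t) + (if e t then 1 else 0)"
        "minuses e (Suc (Suc t)) = minuses e (Suc t) + (if e t then 0 else 1)"
        using m by (simp_all add: pluses_Suc minuses_Suc)
      have nn: "pluses e s \<ge> 0" "minuses e s \<ge> 0" using pluses_nonneg minuses_nonneg by auto
      \<comment> \<open>For different signs \<open>\<bar>c s - c t\<bar>\<close> is a sum of a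
        \<open>pluses\<close> and a \<open>minuses\<close> count, plus the constant 2. The bound
        below \<open>n\<close> survives because \<open>s\<close> and \<open>s + 1\<close> have the
        same sign and both precede \<open>t\<close>, which leaves room for this 2.\<close>
      have S2: "e s \<noteq> e t \<Longrightarrow> (if e s then pluses e s + 2 \<le> pluses e t else minuses e s + 2 \<le> minuses e t)"
      proof -
        assume ne: "e s \<noteq> e t"
        then have "Suc s \<noteq> t" using m(4) by auto
        then have "Suc (Suc s) \<le> t" using st(3) by simp
        then have "pluses e (Suc (Suc s)) \<le> pluses e t" "minuses e (Suc (Suc s)) \<le> minuses e t"
          using pluses_mono minuses_mono by simp_all
        then show ?thesis using m by (cases "e s") (simp_all add: pluses_Suc minuses_Suc)
      qed
      have tn: "int t + 1 \<le> int n" using m by simp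
      have "\<bar>c s - c t\<bar> < int n"
        using P P2 Pst nn S2 tn by (cases "e s"; cases "e t") (simp_all add: c_def)
      with cong have "c s = c t" by (rule cong_eq_of_bounds)
      then show False using P P2 Pst nn S2 tn by (cases "e s"; cases "e t") (simp_all add: c_def)
    qed
    show ?thesis
    proof (rule inj_onI)
      fix s t assume "s \<in> Q" "t \<in> Q" "residue_rep n (c s) = residue_rep n (c t)"
      then show "s = t" unfolding residue_rep_eq_iff using neq[of s t] neq[of t s] cong_sym
        by (metis linorder_neqE_nat)
    qed
  qed
  have dep: "arc_descents n e U = arc_descents n e V" if "U \<inter> Q = V \<inter> Q" for U V
    using that unfolding arc_descents_def Q_def by auto
  let ?B = "(\<lambda>s. residue_rep n (c s)) ` Q"
  have B: "?B \<subseteq> {1..int n}" using residue_rep_mem assms by auto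
  have "(\<Sum>b = 1..int n. G (arc_descents n e (?T b)))
      = (\<Sum>b\<in>?B. G (arc_descents n e (?T b))) + (\<Sum>b\<in>{1..int n} - ?B. G (arc_descents n e (?T b)))"
    using B by (subst add.commute) (intro sum.subset_diff, auto)
  also have "(\<Sum>b\<in>?B. G (arc_descents n e (?T b))) = (\<Sum>s\<in>Q. G (arc_descents n e {s}))"
    unfolding sum.reindex[OF inj] comp_def
  proof (rule sum.cong[OF refl])
    fix s assume s: "s \<in> Q"
    have "?T (residue_rep n (c s)) \<inter> Q = {s} \<inter> Q"
    proof (rule Set.set_eqI)
      fix t
      have "t \<in> ?T (residue_rep n (c s)) \<longleftrightarrow> residue_rep n (c s) = residue_rep n (c t)"
        using assms residue_rep_mem by (intro TQ) simp
      then show "t \<in> ?T (residue_rep n (c s)) \<inter> Q \<longleftrightarrow> t \<in> {s} \<inter> Q"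
        using s inj_onD[OF inj, of s t] by auto
    qed
    then show "G (arc_descents n e (?T (residue_rep n (c s)))) = G (arc_descents n e {s})"
      by (intro arg_cong[of _ _ G] dep)
  qed
  also have "(\<Sum>b\<in>{1..int n} - ?B. G (arc_descents n e (?T b))) = (\<Sum>b\<in>{1..int n} - ?B. G (arc_descents n e {}))"
  proof (rule sum.cong[OF refl])
    fix b assume b: "b \<in> {1..int n} - ?B"
    then have "?T b \<inter> Q = {} \<inter> Q" using TQ[of b] by blast
    then show "G (arc_descents n e (?T b)) = G (arc_descents n e {})" by (intro arg_cong[of _ _ G] dep)
  qed
  \<comment> \<open>The rotations that toggle nothing in \<open>Q\<close> are as many as the
    positions outside \<open>Q\<close>: both are complements of equally large subsets of sets with
    \<open>n\<close> elements.\<close>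
  also have "\<dots> = (\<Sum>s\<in>{1..n} - Q. G (arc_descents n e {}))"
  proof -
    have "card ({1..int n} - ?B) = card ({1..n} - Q)"
      using B Q by (simp add: card_Diff_subset card_image[OF inj])
    then show ?thesis by simp
  qed
  also have "\<dots> = (\<Sum>s\<in>{1..n} - Q. G (arc_descents n e {s}))"
    by (intro sum.cong refl arg_cong[of _ _ G] dep) auto
  also have "(\<Sum>s\<in>Q. G (arc_descents n e {s})) + (\<Sum>s\<in>{1..n} - Q. G (arc_descents n e {s}))
      = (\<Sum>s = 1..n. G (arc_descents n e {s}))"
    using Q by (subst add.commute) (rule sum.subset_diff[symmetric], auto)
  finally show ?thesis .
qed

lemma sum_signed_arc_perms:
  fixes G :: "signed_set \<Rightarrow> 'c :: comm_ring_1"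
  assumes "n \<ge> 2"
  shows "(\<Sum>w\<in>signed_arc_perms n. G (sDes n w))
    = (\<Sum>e\<in>{1..n} \<rightarrow>\<^sub>E UNIV. \<Sum>s = 1..n. G (arc_descents n e {s}, arc_signs n e))"
proof -
  have "(\<Sum>w\<in>signed_arc_perms n. G (sDes n w))
      = (\<Sum>(e, b)\<in>({1..n} \<rightarrow>\<^sub>E UNIV) \<times> {1..int n}. G (sDes n (arc_perm n b e)))"
    unfolding sum.reindex_bij_betw[OF arc_perm_bij[OF assms], symmetric] by (simp add: case_prod_unfold)
  also have "\<dots> = (\<Sum>e\<in>{1..n} \<rightarrow>\<^sub>E UNIV. \<Sum>b = 1..int n. G (sDes n (arc_perm n b e)))"
    by (rule sum.cartesian_product[symmetric])
  also have "\<dots> = (\<Sum>e\<in>{1..n} \<rightarrow>\<^sub>E UNIV. \<Sum>s = 1..n. G (arc_descents n e {s}, arc_signs n e))"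
    unfolding sDes_arc_perm[OF assms]
    by (intro sum.cong refl) (rule sum_arc_descents[OF assms, where G = "\<lambda>S. G (S, arc_signs n _)"])
  finally show ?thesis .
qed

lemma finite_signed_arc_perms: "finite (signed_arc_perms n)"
  by (rule finite_subset[OF _ finite_signed_perms[of n]]) (auto simp: signed_arc_perms_def)

section \<open>The weights of the signed arc permutations\<close>

text \<open>Every sign change is a descent, so the sign stays the same from \<open>j\<close> up to
  the next element of the descent set.\<close>

lemma sign_vector_arc:
  assumes "j \<in> {1..n}"
  shows "sign_vector (arc_descents n e T, arc_signs n e) j = arc_signs n e j"
proof -
  let ?S = "arc_descents n e T"
  let ?P = "\<lambda>s. s \<in> ?S \<and> j \<le> s"
  define t where "t = (LEAST s. ?P s)"
  have n: "?P n" using assms by (simp add: arc_descents_def)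
  have t: "?P t" unfolding t_def using n by (rule LeastI)
  have tn: "t \<le> n" unfolding t_def using n by (rule Least_le)
  have const: "arc_signs n e j = arc_signs n e i" if "j \<le> i" "i \<le> t" for i
    using that
  proof (induction i rule: dec_induct)
    case (step i)
    then have "\<not> ?P i" unfolding t_def by (intro not_less_Least) simp
    then have "i \<notin> ?S" using step by simp
    moreover have "i \<in> {1..n - 1}" using step tn assms by auto
    ultimately have "e i = e (Suc i)" by (simp add: arc_descents_def)
    then show ?case using step tn assms by (simp add: arc_signs_def)
  qed simp
  have "arc_signs n e t = arc_signs n e j" using const[of t] t by simp
  then show ?thesis unfolding sign_vector_def fst_conv snd_conv t_def .
qed

section \<open>Blocks of a signed composition and the weight as a product over blocks\<close>

lemma partial_sum_Suc: "i < length c \<Longrightarrow> partial_sum c (Suc i) = partial_sum c i + nat \<bar>c ! i\<bar>"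
  by (simp add: partial_sum_def take_Suc_conv_app_nth)

lemma partial_sum_mono: "i \<le> j \<Longrightarrow> j \<le> length c \<Longrightarrow> partial_sum c i \<le> partial_sum c j"
  by (induction j rule: dec_induct) (auto simp: partial_sum_Suc)

lemma partial_sum_length:
  assumes "c \<in> signed_compositions n" shows "partial_sum c (length c) = n"
proof -
  have "int (\<Sum>x\<leftarrow>c. nat \<bar>x\<bar>) = (\<Sum>x\<leftarrow>c. \<bar>x\<bar>)" by (induction c) auto
  then show ?thesis using assms by (simp add: partial_sum_def signed_compositions_def)
qed

lemma block_unique:
  assumes "i < length c" "k < length c" "j \<in> block c i" "j \<in> block c k" shows "i = k"
proof (rule ccontr)
  assume "i \<noteq> k"
  then consider "Suc i \<le> k" | "Suc k \<le> i" by linarith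
  then show False
    using assms partial_sum_mono[of "Suc i" k c] partial_sum_mono[of "Suc k" i c]
    by cases (auto simp: block_def)
qed

lemma block_exists:
  assumes "k \<le> length c" "j \<in> {1..partial_sum c k}" obtains i where "i < k" "j \<in> block c i"
  using assms
proof (induction k arbitrary: thesis)
  case 0
  then show ?case by (simp add: partial_sum_def)
next
  case (Suc k)
  show ?case
  proof (cases "j \<le> partial_sum c k")
    case True
    then show ?thesis using Suc.IH[of thesis] Suc.prems less_SucI by force
  next
    case False
    then show ?thesis using Suc.prems by (intro Suc.prems(1)[of k]) (auto simp: block_def)
  qed
qed

lemma block_subset: "i < length c \<Longrightarrow> block c i \<subseteq> {1..partial_sum c (length c)}"
  using partial_sum_mono[of "Suc i" "length c" c] by (auto simp: block_def)

text \<open>The block without its last position. That position is a partial sum, and descents at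
  partial sums do not enter the sign of the weight.\<close>

definition inner :: "int list \<Rightarrow> nat \<Rightarrow> nat set" where
  "inner c i = {partial_sum c i + 1..<partial_sum c (i + 1)}"

lemma inner_block: "inner c i \<subseteq> block c i" "j \<in> inner c i \<Longrightarrow> Suc j \<in> block c i"
  by (auto simp: inner_def block_def)

lemma inner_disjoint: "i < length c \<Longrightarrow> k < length c \<Longrightarrow> i \<noteq> k \<Longrightarrow> inner c i \<inter> inner c k = {}"
  using block_unique inner_block(1) by blast

lemma finite_inner: "finite (inner c i)" and card_inner: "i < length c \<Longrightarrow> card (inner c i) = nat \<bar>c ! i\<bar> - 1"
  by (simp_all add: inner_def partial_sum_Suc)

lemma Union_inner:
  assumes "c \<in> signed_compositions n"
  shows "{1..n} - partial_sum c ` {1..length c} = (\<Union>i<length c. inner c i)"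
proof (intro equalityI subsetI)
  fix j assume j: "j \<in> {1..n} - partial_sum c ` {1..length c}"
  then obtain i where i: "i < length c" "j \<in> block c i"
    using block_exists[of "length c" c j] partial_sum_length[OF assms] by auto
  then have "j \<noteq> partial_sum c (Suc i)" using j by auto
  then have "j \<in> inner c i" using i by (auto simp: block_def inner_def)
  then show "j \<in> (\<Union>i<length c. inner c i)" using i by blast
next
  fix j assume "j \<in> (\<Union>i<length c. inner c i)"
  then obtain i where i: "i < length c" "j \<in> inner c i" by blast
  have "j \<noteq> partial_sum c k" if "k \<in> {1..length c}" for k
  proof (cases "k \<le> i")
    case True
    then show ?thesis using partial_sum_mono[of k i c] i by (auto simp: inner_def)
  next
    case False
    then show ?thesis using partial_sum_mono[of "Suc i" k c] i that by (auto simp: inner_def)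
  qed
  moreover have "j \<in> {1..n}"
    using block_subset[OF i(1)] inner_block(1) i(2) partial_sum_length[OF assms] by blast
  ultimately show "j \<in> {1..n} - partial_sum c ` {1..length c}" by blast
qed

text \<open>The weight of a block of negative sign in which nothing is toggled: all of its
  \<open>nat \<bar>x\<bar> - 1\<close> inner positions are descents, and a barred part contributes
  one more sign.\<close>

definition sign_weight :: "int \<Rightarrow> int" where
  "sign_weight x = (- 1) ^ (nat \<bar>x\<bar> - 1) * sgn x"

text \<open>The factor by which toggling \<open>s\<close> changes the weight of the block
  \<open>i\<close>, where \<open>p\<close> tells that the block is unbarred in the permutation. Then
  toggling creates the single inner descent \<open>s\<close>, which is an initial segment only at
  the first inner position; otherwise it removes \<open>s\<close> from the full set, which leaves an
  initial segment only at the last one. In both cases the number of descents changes by one.\<close>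

definition toggle_weight :: "int list \<Rightarrow> bool \<Rightarrow> nat \<Rightarrow> nat \<Rightarrow> int" where
  "toggle_weight c p s i = (if s \<notin> inner c i then 1
     else if s = (if p then partial_sum c i + 1 else partial_sum c (i + 1) - 1) then - 1 else 0)"

lemma wt_not_constant:
  assumes "c \<in> signed_compositions n" "i < length c" "j \<in> block c i" "k \<in> block c i" "e j \<noteq> e k"
  shows "wt c (arc_descents n e T, arc_signs n e) = 0"
proof -
  have jk: "j \<in> {1..n}" "k \<in> {1..n}"
    using block_subset[OF assms(2)] assms(3,4) partial_sum_length[OF assms(1)] by blast+
  have "sign_vector (arc_descents n e T, arc_signs n e) j \<noteq> sign_vector (arc_descents n e T, arc_signs n e) k"
    unfolding sign_vector_arc[OF jk(1)] sign_vector_arc[OF jk(2)] using jk assms(5) by (simp add: arc_signs_def)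
  then have "\<not> (\<exists>x. \<forall>j\<in>block c i. sign_vector (arc_descents n e T, arc_signs n e) j = x)"
    using assms(3,4) by metis
  then show ?thesis unfolding wt_def using assms(2) by (intro if_P) blast
qed

text \<open>The inner positions of the blocks partition the complement of the partial sums, so the
  sign of the weight factors over the blocks; the weight vanishes exactly if one of the toggle
  factors does.\<close>

lemma wt_constant:
  assumes "c \<in> signed_compositions n" "n \<ge> 1"
    and E: "\<And>i j. i < length c \<Longrightarrow> j \<in> block c i \<Longrightarrow> e j = E i"
  shows "wt c (arc_descents n e {s}, arc_signs n e)
    = (\<Prod>i<length c. (if E i then 1 else sign_weight (c ! i)) * toggle_weight c (E i) s i)"
proof -
  let ?S = "arc_descents n e {s}" and ?m = "length c"
  let ?\<sigma> = "(?S, arc_signs n e)"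
  have len: "partial_sum c ?m = n" using partial_sum_length[OF assms(1)] .
  have blk: "j \<in> {1..n}" if "i < ?m" "j \<in> block c i" for i j using block_subset[of i c] that len by blast
  have sv: "sign_vector ?\<sigma> j = (if E i then 1 else - 1)" if "i < ?m" "j \<in> block c i" for i j
    unfolding sign_vector_arc[OF blk[OF that]] using E[OF that] blk[OF that] by (simp add: arc_signs_def)
  have ne: "block c i \<noteq> {}" if "i < ?m" for i
  proof -
    have "c ! i \<noteq> 0" using assms(1) nth_mem[OF that] unfolding signed_compositions_def by force
    then show ?thesis using that by (simp add: block_def partial_sum_Suc)
  qed
  have SJ: "?S \<inter> inner c i = (if E i then inner c i \<inter> {s} else inner c i - {s})" if i: "i < ?m" for i
  proof -
    have "j \<in> ?S \<longleftrightarrow> (E i \<longleftrightarrow> j = s)" if j: "j \<in> inner c i" for j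
    proof -
      have m: "j \<in> block c i" "Suc j \<in> block c i" using inner_block j by auto
      then have "j \<in> {1..n - 1}" "j \<noteq> n" using blk[OF i] by fastforce+
      then show ?thesis using E[OF i m(1)] E[OF i m(2)] by (auto simp: arc_descents_def)
    qed
    then show ?thesis by auto
  qed
  have init: "initial_segment (?S \<inter> inner c i) (inner c i) \<longleftrightarrow> toggle_weight c (E i) s i \<noteq> 0" if i: "i < ?m" for i
  proof (cases "s \<in> inner c i")
    case True
    have lt: "(\<exists>b\<in>inner c i. b < s) \<longleftrightarrow> s \<noteq> partial_sum c i + 1"
      using True by (auto simp: inner_def intro!: bexI[of _ "partial_sum c i + 1"])
    have gt: "(\<exists>b\<in>inner c i. s < b) \<longleftrightarrow> s \<noteq> partial_sum c (i + 1) - 1"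
      using True by (auto simp: inner_def intro!: bexI[of _ "partial_sum c (i + 1) - 1"])
    show ?thesis
    proof (cases "E i")
      case E: True
      have "initial_segment (inner c i \<inter> {s}) (inner c i) \<longleftrightarrow> \<not> (\<exists>b\<in>inner c i. b < s)"
        using True unfolding initial_segment_def by auto
      then show ?thesis unfolding SJ[OF i] lt using E True by (simp add: toggle_weight_def)
    next
      case E: False
      have "initial_segment (inner c i - {s}) (inner c i) \<longleftrightarrow> \<not> (\<exists>b\<in>inner c i. s < b)"
        using True unfolding initial_segment_def by auto
      then show ?thesis unfolding SJ[OF i] gt using E True by (simp add: toggle_weight_def)
    qed
  next
    case False
    then have "inner c i \<inter> {s} = {}" "inner c i - {s} = inner c i" by auto
    then show ?thesis unfolding SJ[OF i] using False by (simp add: initial_segment_def toggle_weight_def)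
  qed
  have const: "\<exists>x. \<forall>j\<in>block c i. sign_vector ?\<sigma> j = x" if "i < ?m" for i using sv[OF that] by blast
  have bad: "(\<exists>i<?m. (let J = {partial_sum c i + 1..<partial_sum c (i + 1)} in
             \<not> initial_segment (fst ?\<sigma> \<inter> J) J) \<or> \<not> (\<exists>x. \<forall>j\<in>block c i. sign_vector ?\<sigma> j = x))
      \<longleftrightarrow> (\<exists>i<?m. toggle_weight c (E i) s i = 0)"
    unfolding Let_def fst_conv inner_def[symmetric] using init const by blast
  show ?thesis
  proof (cases "\<exists>i<?m. toggle_weight c (E i) s i = 0")
    case True
    then obtain i where "i < ?m" "toggle_weight c (E i) s i = 0" by blast
    then have "(\<Prod>i<?m. (if E i then 1 else sign_weight (c ! i)) * toggle_weight c (E i) s i) = 0"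
      by (intro prod_zero bexI[of _ i]) simp_all
    then show ?thesis unfolding wt_def bad using True by simp
  next
    case False
    then have tw: "toggle_weight c (E i) s i = (if s \<in> inner c i then - 1 else 1)" if "i < ?m" for i
      using that by (auto simp: toggle_weight_def split: if_splits)
    have "?S \<subseteq> {1..n}" using assms(2) by (auto simp: arc_descents_def)
    then have "?S - partial_sum c ` {1..?m} = ?S \<inter> ({1..n} - partial_sum c ` {1..?m})" by blast
    then have "?S - partial_sum c ` {1..?m} = (\<Union>i<?m. ?S \<inter> inner c i)"
      unfolding Union_inner[OF assms(1)] by blast
    then have "card (?S - partial_sum c ` {1..?m}) = (\<Sum>i<?m. card (?S \<inter> inner c i))"
      using inner_disjoint finite_inner by (subst card_UN_disjoint[symmetric]) (auto, blast)
    moreover have neg: "{i. i < ?m \<and> (\<forall>j\<in>block c i. sign_vector ?\<sigma> j = - 1) \<and> c ! i < 0}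
        = {i \<in> {..<?m}. \<not> E i \<and> c ! i < 0}"
    proof (rule Collect_cong)
      fix i
      show "(i < ?m \<and> (\<forall>j\<in>block c i. sign_vector ?\<sigma> j = - 1) \<and> c ! i < 0) \<longleftrightarrow>
        (i \<in> {..<?m} \<and> \<not> E i \<and> c ! i < 0)"
        using sv[of i] ne[of i] by (cases "E i") auto
    qed
    have "(- 1 :: int) ^ card {i \<in> {..<?m}. \<not> E i \<and> c ! i < 0} = (\<Prod>i<?m. if \<not> E i \<and> c ! i < 0 then - 1 else 1)"
      by (simp add: prod.If_cases Collect_conj_eq lessThan_def)
    ultimately have "wt c ?\<sigma> = (\<Prod>i<?m. (- 1) ^ card (?S \<inter> inner c i)) * (\<Prod>i<?m. if \<not> E i \<and> c ! i < 0 then - 1 else 1)"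
      unfolding wt_def bad neg if_not_P[OF False] by (simp add: power_add power_sum)
    also have "\<dots> = (\<Prod>i<?m. (if E i then 1 else sign_weight (c ! i)) * toggle_weight c (E i) s i)"
      unfolding prod.distrib[symmetric]
    proof (rule prod.cong[OF refl])
      fix i assume "i \<in> {..<?m}"
      then have i: "i < ?m" by simp
      have c0: "c ! i \<noteq> 0" using assms(1) nth_mem[OF i] unfolding signed_compositions_def by force
      show "(- 1) ^ card (?S \<inter> inner c i) * (if \<not> E i \<and> c ! i < 0 then - 1 else 1)
        = (if E i then 1 else sign_weight (c ! i)) * toggle_weight c (E i) s i"
      proof (cases "E i")
        case True
        then show ?thesis unfolding SJ[OF i] tw[OF i] by (cases "s \<in> inner c i") simp_all
      next
        case False
        have "(- 1 :: int) ^ card (inner c i - {s}) = (- 1) ^ (nat \<bar>c ! i\<bar> - 1) * (if s \<in> inner c i then - 1 else 1)"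
        proof (cases "s \<in> inner c i")
          case True
          then have "card (inner c i) = Suc (card (inner c i - {s}))"
            using finite_inner by (metis card_Suc_Diff1)
          then have "(- 1 :: int) ^ card (inner c i) = - ((- 1) ^ card (inner c i - {s}))" by (simp only: power_Suc mult_minus1)
          then show ?thesis unfolding card_inner[OF i, symmetric] using True by (simp del: card_Diff_insert card_Diff_singleton)
        qed (simp add: card_inner[OF i])
        then show ?thesis unfolding SJ[OF i] tw[OF i] using False c0
          by (auto simp: sign_weight_def sgn_if)
      qed
    qed
    finally show ?thesis .
  qed
qed

text \<open>Toggling at a partial sum changes nothing and gives \<open>1\<close>, once per part.
  Every part longer than 1 has exactly one inner position of weight \<open>- 1\<close>, the others
  having weight \<open>0\<close>. What remains is the number of parts of length 1, whatever the
  signs of the blocks are.\<close>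

lemma sum_toggle_weight:
  assumes "c \<in> signed_compositions n"
  shows "(\<Sum>s = 1..n. \<Prod>i<length c. toggle_weight c (E i) s i) = int (card {i. i < length c \<and> \<bar>c ! i\<bar> = 1})"
proof -
  let ?m = "length c" and ?R = "partial_sum c ` {1..length c}"
  have len: "partial_sum c ?m = n" using partial_sum_length[OF assms] .
  have c0: "c ! i \<noteq> 0" if "i < ?m" for i using assms nth_mem[OF that] unfolding signed_compositions_def by force
  have strict: "partial_sum c i < partial_sum c k" if "i < k" "k \<le> ?m" for i k
    using partial_sum_mono[of "Suc i" k c] that partial_sum_Suc[of i c] c0[of i] by simp
  have R: "?R \<subseteq> {1..n}"
  proof
    fix x assume "x \<in> ?R"
    then obtain k where k: "k \<in> {1..?m}" "x = partial_sum c k" by blast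
    then show "x \<in> {1..n}" using strict[of 0 k] partial_sum_mono[of k ?m c] len by (simp add: Suc_le_eq)
  qed
  have cR: "card ?R = ?m"
  proof -
    have "inj_on (partial_sum c) {1..?m}"
      by (rule inj_onI) (metis strict atLeastAtMost_iff linorder_neqE_nat less_irrefl)
    then show ?thesis by (simp add: card_image)
  qed
  have UN: "{1..n} - ?R = (\<Union>i<?m. inner c i)" by (rule Union_inner[OF assms])
  have "(\<Sum>s = 1..n. \<Prod>i<?m. toggle_weight c (E i) s i)
      = (\<Sum>s\<in>{1..n} - ?R. \<Prod>i<?m. toggle_weight c (E i) s i) + (\<Sum>s\<in>?R. \<Prod>i<?m. toggle_weight c (E i) s i)"
    by (rule sum.subset_diff[OF R]) simp
  also have "(\<Sum>s\<in>?R. \<Prod>i<?m. toggle_weight c (E i) s i) = (\<Sum>s\<in>?R. 1)"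
  proof (rule sum.cong[OF refl], rule prod.neutral, rule ballI)
    fix s i assume "s \<in> ?R" "i \<in> {..<?m}"
    then have "s \<notin> inner c i" using UN by blast
    then show "toggle_weight c (E i) s i = 1" by (simp add: toggle_weight_def)
  qed
  also have "\<dots> = int ?m" using cR by simp
  also have "(\<Sum>s\<in>{1..n} - ?R. \<Prod>i<?m. toggle_weight c (E i) s i)
      = (\<Sum>i<?m. \<Sum>s\<in>inner c i. \<Prod>k<?m. toggle_weight c (E k) s k)"
    unfolding UN using inner_disjoint[of _ c] finite_inner by (intro sum.UNION_disjoint) auto
  also have "\<dots> = (\<Sum>i<?m. if \<bar>c ! i\<bar> = 1 then 0 else - 1)"
  proof (rule sum.cong[OF refl])
    fix i assume "i \<in> {..<?m}"
    then have i: "i < ?m" by simp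
    define t where "t = (if E i then partial_sum c i + 1 else partial_sum c (i + 1) - 1)"
    have "(\<Sum>s\<in>inner c i. \<Prod>k<?m. toggle_weight c (E k) s k) = (\<Sum>s\<in>inner c i. if s = t then - 1 else 0)"
    proof (rule sum.cong[OF refl])
      fix s assume s: "s \<in> inner c i"
      have "(\<Prod>k<?m. toggle_weight c (E k) s k) = (\<Prod>k\<in>{i}. toggle_weight c (E k) s k)"
      proof (rule prod.mono_neutral_right)
        show "\<forall>k\<in>{..<?m} - {i}. toggle_weight c (E k) s k = 1"
        proof
          fix k assume "k \<in> {..<?m} - {i}"
          then have "s \<notin> inner c k" using inner_disjoint[of i c k] i s by auto
          then show "toggle_weight c (E k) s k = 1" by (simp add: toggle_weight_def)
        qed
      qed (use i in auto)
      then show "(\<Prod>k<?m. toggle_weight c (E k) s k) = (if s = t then - 1 else 0)"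
        using s by (simp add: toggle_weight_def t_def)
    qed
    also have "\<dots> = (if t \<in> inner c i then - 1 else 0)"
      using finite_inner[of c i] by (simp add: sum.delta)
    also have "t \<in> inner c i \<longleftrightarrow> \<bar>c ! i\<bar> \<noteq> 1"
      using c0[OF i] partial_sum_Suc[OF i] by (auto simp: t_def inner_def)
    finally show "(\<Sum>s\<in>inner c i. \<Prod>k<?m. toggle_weight c (E k) s k) = (if \<bar>c ! i\<bar> = 1 then 0 else - 1)"
      by simp
  qed
  also have "(\<Sum>i<?m. if \<bar>c ! i\<bar> = 1 then 0 else - 1) + int ?m = (\<Sum>i<?m. (if \<bar>c ! i\<bar> = 1 then 0 else - 1) + 1)"
    by (simp add: sum.distrib)
  also have "\<dots> = (\<Sum>i<?m. if \<bar>c ! i\<bar> = 1 then 1 else 0)"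
    by (rule sum.cong) auto
  also have "\<dots> = int (card {i. i < ?m \<and> \<bar>c ! i\<bar> = 1})"
    by (simp add: sum.If_cases Collect_conj_eq lessThan_def)
  finally show ?thesis .
qed

text \<open>Only sign vectors that are constant on the blocks contribute. They correspond to one
  free choice of sign per block, and since the sum over the toggles does not depend on this choice,
  the sum over the choices is a product.\<close>

lemma sum_wt_signed_arc_perms:
  assumes "c \<in> signed_compositions n" "n \<ge> 2"
  shows "(\<Sum>w\<in>signed_arc_perms n. wt c (sDes n w))
    = int (card {i. i < length c \<and> \<bar>c ! i\<bar> = 1}) * (\<Prod>i<length c. 1 + sign_weight (c ! i))"
proof -
  let ?m = "length c"
  let ?ones = "int (card {i. i < ?m \<and> \<bar>c ! i\<bar> = 1})"
  have len: "partial_sum c ?m = n" using partial_sum_length[OF assms(1)] .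
  define blk where "blk j = (THE i. i < ?m \<and> j \<in> block c i)" for j
  have blkI: "blk j = i" if "i < ?m" "j \<in> block c i" for i j
    unfolding blk_def using that block_unique[of _ c i j] by (intro the_equality) blast+
  have blk: "blk j < ?m \<and> j \<in> block c (blk j)" if j: "j \<in> {1..n}" for j
  proof -
    obtain i where "i < ?m" "j \<in> block c i"
      by (rule block_exists[of ?m c j]) (use j len in auto)
    then show ?thesis using blkI by simp
  qed
  define ext where "ext E = (\<lambda>j\<in>{1..n}. E (blk j))" for E :: "nat \<Rightarrow> bool"
  have ext: "ext E j = E i" if "i < ?m" "j \<in> block c i" for E i j
    using block_subset[OF that(1)] that blkI len by (auto simp: ext_def)
  let ?F = "{..<?m} \<rightarrow>\<^sub>E (UNIV :: bool set)" and ?D = "{1..n} \<rightarrow>\<^sub>E (UNIV :: bool set)"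
  have last: "partial_sum c (Suc i) \<in> block c i" if "i < ?m" for i
  proof -
    have "c ! i \<noteq> 0" using assms(1) nth_mem[OF that] unfolding signed_compositions_def by force
    then show ?thesis using that by (simp add: block_def partial_sum_Suc)
  qed
  have inj: "inj_on ext ?F"
  proof (rule inj_onI)
    fix E E' assume E: "E \<in> ?F" "E' \<in> ?F" and eq: "ext E = ext E'"
    show "E = E'" using E
    proof (rule PiE_ext)
      fix i assume "i \<in> {..<?m}"
      then have i: "i < ?m" by simp
      show "E i = E' i" using ext[OF i last[OF i]] eq by metis
    qed
  qed
  define W where "W e = (\<Sum>s = 1..n. wt c (arc_descents n e {s}, arc_signs n e))" for e
  have zero: "W e = 0" if e: "e \<in> ?D - ext ` ?F" for e
  proof -
    \<comment> \<open>Otherwise \<open>e\<close> would be the extension of its own values at the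
      ends of the blocks.\<close>
    have "\<exists>i<?m. \<exists>j\<in>block c i. \<exists>k\<in>block c i. e j \<noteq> e k"
    proof (rule ccontr)
      assume "\<not> (\<exists>i<?m. \<exists>j\<in>block c i. \<exists>k\<in>block c i. e j \<noteq> e k)"
      then have const: "e j = e k" if "i < ?m" "j \<in> block c i" "k \<in> block c i" for i j k using that by blast
      define E where "E = (\<lambda>i\<in>{..<?m}. e (partial_sum c (Suc i)))"
      have "e = ext E"
      proof (rule PiE_ext[of e "{1..n}" "\<lambda>_. UNIV" "ext E"])
        show "e \<in> ?D" using e by blast
        show "ext E \<in> ?D" by (simp add: ext_def)
        fix j assume j: "j \<in> {1..n}"
        have "ext E j = E (blk j)" using j by (simp add: ext_def)
        also have "\<dots> = e (partial_sum c (Suc (blk j)))" using blk[OF j] by (simp add: E_def)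
        also have "\<dots> = e j" using const blk[OF j] last by blast
        finally show "e j = ext E j" by simp
      qed
      moreover have "E \<in> ?F" by (simp add: E_def)
      ultimately show False using e by blast
    qed
    then obtain i j k where "i < ?m" "j \<in> block c i" "k \<in> block c i" "e j \<noteq> e k" by blast
    note 0 = wt_not_constant[OF assms(1) this]
    show ?thesis unfolding W_def by (simp add: 0)
  qed
  have "(\<Sum>w\<in>signed_arc_perms n. wt c (sDes n w)) = (\<Sum>e\<in>?D. W e)"
    using sum_signed_arc_perms[OF assms(2), of "wt c"] unfolding W_def .
  also have "\<dots> = (\<Sum>e\<in>ext ` ?F. W e)"
  proof (rule sum.mono_neutral_right)
    show "finite ?D" by (rule finite_PiE) simp_all
    show "ext ` ?F \<subseteq> ?D" unfolding ext_def by (rule image_subsetI) simp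
    show "\<forall>e\<in>?D - ext ` ?F. W e = 0" using zero by (rule ballI)
  qed
  also have "\<dots> = (\<Sum>E\<in>?F. W (ext E))" by (simp add: sum.reindex[OF inj])
  also have "\<dots> = (\<Sum>E\<in>?F. ?ones * (\<Prod>i<?m. if E i then 1 else sign_weight (c ! i)))"
  proof (rule sum.cong[OF refl])
    fix E
    have "W (ext E) = (\<Sum>s = 1..n. (\<Prod>i<?m. if E i then 1 else sign_weight (c ! i)) * (\<Prod>i<?m. toggle_weight c (E i) s i))"
      unfolding W_def
    proof (rule sum.cong[OF refl])
      fix s
      have "n \<ge> 1" using assms(2) by simp
      from wt_constant[OF assms(1) this, where e = "ext E" and E = E and s = s, OF ext]
      show "wt c (arc_descents n (ext E) {s}, arc_signs n (ext E))
        = (\<Prod>i<?m. if E i then 1 else sign_weight (c ! i)) * (\<Prod>i<?m. toggle_weight c (E i) s i)"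
        by (simp only: prod.distrib)
    qed
    also have "\<dots> = (\<Prod>i<?m. if E i then 1 else sign_weight (c ! i)) * ?ones"
      unfolding sum_distrib_left[symmetric] sum_toggle_weight[OF assms(1)] ..
    finally show "W (ext E) = ?ones * (\<Prod>i<?m. if E i then 1 else sign_weight (c ! i))" by simp
  qed
  also have "\<dots> = ?ones * (\<Sum>E\<in>?F. \<Prod>i<?m. if E i then 1 else sign_weight (c ! i))"
    by (rule sum_distrib_left[symmetric])
  also have "(\<Sum>E\<in>?F. \<Prod>i<?m. if E i then 1 else sign_weight (c ! i))
      = (\<Prod>i<?m. \<Sum>p\<in>UNIV. if p then 1 else sign_weight (c ! i))"
    by (rule prod_sum_PiE[symmetric]) auto
  also have "\<dots> = (\<Prod>i<?m. 1 + sign_weight (c ! i))" by (simp add: UNIV_bool add.commute)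
  finally show ?thesis .
qed

section \<open>Comparison of the weights with the induced character\<close>

lemma type_product_composition:
  "0 \<notin> set c \<Longrightarrow> type_product (composition_type c) = (\<Prod>i<length c. 1 + sign_weight (c ! i))"
proof (induction c)
  case (Cons x c)
  have "(\<Prod>i<length (x # c). 1 + sign_weight ((x # c) ! i)) = (1 + sign_weight x) * type_product (composition_type c)"
    using Cons by (simp add: prod.lessThan_Suc_shift del: prod.lessThan_Suc)
  also have "\<dots> = type_product (composition_type (x # c))"
    using Cons.prems by (cases x "0 :: int" rule: linorder_cases)
      (auto simp: type_product_def composition_type_def sign_weight_def mult_ac)
  finally show ?case by simp
qed (simp add: type_product_def composition_type_def)

lemma fine_set_signed_arc_perms:
  assumes "n \<ge> 2"
  shows "fine_set n (signed_arc_perms n) (sDes n)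
    (induced (signed_perms (n - 1)) (signed_perms n) (ext_char (n - 1)))"
  unfolding fine_set_def
proof (intro conjI ballI impI)
  show "finite (signed_arc_perms n)" by (rule finite_signed_arc_perms)
  fix c w assume c: "c \<in> signed_compositions n" and w: "w \<in> signed_perms n"
    and type: "signed_cycle_type n w = composition_type c"
  have c0: "0 \<notin> set c" using c by (simp add: signed_compositions_def)
  let ?P = "\<Prod>i<length c. 1 + sign_weight (c ! i)"
  \<comment> \<open>The weights count the barred and unbarred parts of length 1, the character only
    the unbarred ones. The counts differ only if a barred 1 occurs, and then its factor
    \<open>1 + sign_weight (- 1)\<close> makes both sides vanish.\<close>
  have "int (count (fst (composition_type c)) 1) * ?P = int (card {i. i < length c \<and> \<bar>c ! i\<bar> = 1}) * ?P"
  proof (cases "- 1 \<in> set c")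
    case True
    then obtain i where "i < length c" "c ! i = - 1" by (auto simp: in_set_conv_nth)
    then have "?P = 0" by (intro prod_zero bexI[of _ i]) (simp_all add: sign_weight_def)
    then show ?thesis by simp
  next
    case False
    have "count (fst (composition_type c)) 1 = length (filter (\<lambda>x. x = 1) c)" for c :: "int list"
      by (induction c) (auto simp: composition_type_def nat_eq_iff)
    also have "length (filter (\<lambda>x. x = 1) c) = card {i. i < length c \<and> c ! i = 1}"
      by (rule length_filter_conv_card)
    also have "{i. i < length c \<and> c ! i = 1} = {i. i < length c \<and> \<bar>c ! i\<bar> = 1}"
    proof (rule Collect_cong)
      fix i show "(i < length c \<and> c ! i = 1) = (i < length c \<and> \<bar>c ! i\<bar> = 1)"
        using False nth_mem[of i c] by (cases "c ! i = - 1") (auto simp: abs_if split: if_splits)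
    qed
    finally show ?thesis by simp
  qed
  then have "int (count (fst (composition_type c)) 1) * type_product (composition_type c)
      = (\<Sum>b\<in>signed_arc_perms n. wt c (sDes n b))"
    unfolding sum_wt_signed_arc_perms[OF c assms] type_product_composition[OF c0] .
  moreover have "induced (signed_perms (n - 1)) (signed_perms n) (ext_char (n - 1)) w
      = of_int (int (count (fst (composition_type c)) 1) * type_product (composition_type c))"
    using induced_ext_char[OF _ w] assms type by simp
  ultimately show "induced (signed_perms (n - 1)) (signed_perms n) (ext_char (n - 1)) w
      = of_int (\<Sum>b\<in>signed_arc_perms n. wt c (sDes n b))"
    by (simp only:)
qed

section \<open>The quasisymmetric generating function\<close>

lemma mcoeff_0: "mcoeff 0 M = 0" and mcoeff_add: "mcoeff (f + g) M = mcoeff f M + mcoeff g M"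
  by (simp_all add: zero_mseries.rep_eq plus_mseries.rep_eq)

lemma mcoeff_diff: "mcoeff (f - g) M = mcoeff f M - mcoeff g M"
  by (simp add: minus_mseries.rep_eq)

lemma mcoeff_mult: "mcoeff (f * g) M = (\<Sum>A | A \<subseteq># M. mcoeff f A * mcoeff g (M - A))"
  by (simp add: times_mseries.rep_eq)

lemma mcoeff_sum: "mcoeff (sum f A) M = (\<Sum>x\<in>A. mcoeff (f x) M)"
  by (induction A rule: infinite_finite_induct) (simp_all add: mcoeff_0 mcoeff_add)

lemma finite_submultisets: "finite {A. A \<subseteq># M}"
proof (induction M)
  case (add x M)
  have "{A. A \<subseteq># add_mset x M} \<subseteq> {A. A \<subseteq># M} \<union> add_mset x ` {A. A \<subseteq># M}"
  proof
    fix A assume "A \<in> {A. A \<subseteq># add_mset x M}"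
    then have A: "A \<subseteq># add_mset x M" by simp
    show "A \<in> {A. A \<subseteq># M} \<union> add_mset x ` {A. A \<subseteq># M}"
    proof (cases "x \<in># A")
      case True
      then obtain B where "A = add_mset x B" by (blast dest: multi_member_split)
      then show ?thesis using A by simp
    next
      case False
      have "A \<subseteq># M"
      proof (rule mset_subset_eqI)
        fix a show "count A a \<le> count M a"
          using mset_subset_eq_count[OF A, of a] False by (cases "a = x") (simp_all add: not_in_iff)
      qed
      then show ?thesis by simp
    qed
  qed
  then show ?case using add finite_subset by blast
qed simp

lemma sorted_map_upt_iff:
  "sorted (map f [a..<a + k]) \<longleftrightarrow> (\<forall>j. a \<le> j \<and> Suc j < a + k \<longrightarrow> f j \<le> f (Suc j))"
proof -
  have "sorted (map f [a..<a + k]) \<longleftrightarrow> (\<forall>i. Suc i < k \<longrightarrow> f (a + i) \<le> f (Suc (a + i)))"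
    by (simp add: sorted_iff_nth_Suc)
  also have "\<dots> \<longleftrightarrow> (\<forall>j. a \<le> j \<and> Suc j < a + k \<longrightarrow> f j \<le> f (Suc j))"
    by (metis add_Suc_right add_less_cancel_left le_Suc_ex le_add1)
  finally show ?thesis .
qed

lemma sorted_fun_unique:
  fixes f g :: "nat \<Rightarrow> 'b :: linorder"
  assumes "\<And>j. a \<le> j \<Longrightarrow> Suc j < a + k \<Longrightarrow> f j \<le> f (Suc j)" "\<And>j. a \<le> j \<Longrightarrow> Suc j < a + k \<Longrightarrow> g j \<le> g (Suc j)"
    and "image_mset f (mset_set {a..<a + k}) = image_mset g (mset_set {a..<a + k})" "j \<in> {a..<a + k}"
  shows "f j = g j"
proof -
  have "sorted (map f [a..<a + k])" "sorted (map g [a..<a + k])"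
    unfolding sorted_map_upt_iff using assms(1,2) by blast+
  moreover have "mset (map f [a..<a + k]) = mset (map g [a..<a + k])" using assms(3) by simp
  ultimately have "map f [a..<a + k] = map g [a..<a + k]" by (metis properties_for_sort)
  then show ?thesis using assms(4) by simp
qed

lemma sorted_fun_exists:
  fixes M :: "'b :: linorder multiset"
  assumes "size M = k"
  obtains f where "\<And>j. a \<le> j \<Longrightarrow> Suc j < a + k \<Longrightarrow> f j \<le> f (Suc j)"
    "image_mset f (mset_set {a..<a + k}) = M"
proof -
  define xs where "xs = sorted_list_of_multiset M"
  have len: "length xs = k" using assms by (metis xs_def mset_sorted_list_of_multiset size_mset)
  define f where "f j = xs ! (j - a)" for j
  have map: "map f [a..<a + k] = xs" using len by (intro nth_equalityI) (simp_all add: f_def)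
  have "sorted (map f [a..<a + k])" unfolding map xs_def by simp
  then have "\<forall>j. a \<le> j \<and> Suc j < a + k \<longrightarrow> f j \<le> f (Suc j)" by (simp only: sorted_map_upt_iff)
  moreover have "mset (map f [a..<a + k]) = M" unfolding map xs_def by simp
  then have "image_mset f (mset_set {a..<a + k}) = M" by simp
  ultimately show ?thesis using that by blast
qed

text \<open>The variable \<open>y\<close> comes before the \<open>x\<close> of the same index
  because a change of sign from \<open>+\<close> to \<open>-\<close> is a weak descent and forces
  the index to grow, while a change from \<open>-\<close> to \<open>+\<close> does not.\<close>

fun var_rank :: "var \<Rightarrow> nat" where
  "var_rank (Y i) = 2 * i" | "var_rank (X i) = 2 * i + 1"

fun is_X :: "var \<Rightarrow> bool" where
  "is_X (X i) = True" | "is_X (Y i) = False"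

fun var_index :: "var \<Rightarrow> nat" where
  "var_index (X i) = i" | "var_index (Y i) = i"

lemma var_rank_inj: "var_rank x = var_rank y \<longleftrightarrow> x = y"
  by (cases x; cases y) (auto; presburger)+

lemma inj_var_rank: "inj var_rank"
  by (simp add: inj_def var_rank_inj)

lemma wDes_arc:
  assumes "n \<ge> 1" "j \<in> {1..<n}"
  shows "j \<in> wDes (arc_descents n e T, arc_signs n e)
    \<longleftrightarrow> (e j \<and> \<not> e (Suc j)) \<or> (e j = e (Suc j) \<and> (e j \<longleftrightarrow> j \<in> T))"
proof -
  let ?S = "arc_descents n e T" and ?\<epsilon> = "arc_signs n e"
  have "Suc j \<in> {1..n}" using assms by auto
  \<comment> \<open>The element of the descent set that follows \<open>j\<close> is the one looked
    up by the sign vector at \<open>Suc j\<close>.\<close>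
  from sign_vector_arc[OF this] have "?\<epsilon> (LEAST t. t \<in> ?S \<and> j < t) = ?\<epsilon> (Suc j)"
    by (simp add: sign_vector_def Suc_le_eq)
  moreover have "n \<in> ?S" "j < n" using assms by (simp_all add: arc_descents_def)
  then have "\<exists>t\<in>?S. j < t" by blast
  ultimately have "j \<in> wDes (?S, ?\<epsilon>) \<longleftrightarrow> j \<in> ?S \<and> (?\<epsilon> j = ?\<epsilon> (Suc j) \<or> (?\<epsilon> j = 1 \<and> ?\<epsilon> (Suc j) = - 1))"
    by (simp add: wDes_def Let_def)
  moreover have "j \<in> {1..n - 1}" "j \<noteq> n" "j \<in> {1..n}" "Suc j \<in> {1..n}" using assms by auto
  ultimately show ?thesis by (auto simp: arc_descents_def arc_signs_def)
qed

lemma wDes_subset: "wDes (arc_descents n e T, arc_signs n e) \<subseteq> {1..<n}"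
  by (auto simp: wDes_def arc_descents_def)

text \<open>Among the monomials of degree \<open>m\<close> these are the ones that occur in the sum
  of the products \<open>h\<^sub>k(x) e\<^sub>m\<^sub>-\<^sub>k(y)\<close>, each with coefficient
  1.\<close>

definition y_squarefree :: "var multiset \<Rightarrow> bool" where
  "y_squarefree M \<longleftrightarrow> (\<forall>i. count M (Y i) \<le> 1)"

text \<open>In the order \<open>y\<^sub>0 < x\<^sub>0 < y\<^sub>1 < x\<^sub>1 < \<dots>\<close> the words counted by the quasisymmetric functions are the weakly
  increasing ones with prescribed equalities.\<close>

lemma F_condition:
  fixes e :: "nat \<Rightarrow> bool" and i :: "nat \<Rightarrow> nat"
  assumes "j \<in> {1..<n}"
  defines "v \<equiv> \<lambda>j. if e j then X (i j) else Y (i j)"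
  shows "(i j \<le> i (Suc j) \<and> (j \<in> wDes (arc_descents n e {s}, arc_signs n e) \<longrightarrow> i j < i (Suc j)))
    \<longleftrightarrow> var_rank (v j) \<le> var_rank (v (Suc j)) \<and> (v j = v (Suc j) \<longrightarrow> (is_X (v j) \<longleftrightarrow> j \<noteq> s))"
proof -
  have "n \<ge> 1" using assms(1) by auto
  then show ?thesis
    unfolding wDes_arc[OF \<open>n \<ge> 1\<close> assms(1)] v_def
    by (cases "e j"; cases "e (Suc j)") auto
qed

text \<open>A word counted for \<open>M\<close> is weakly increasing in rank, hence it is
  \<open>v\<close>, and its variables determine the signs \<open>e0\<close> and the indices
  \<open>i0\<close>. All that is left to count are the toggles \<open>s\<close> that are compatible
  with the equal neighbours in \<open>v\<close>.\<close>

lemma sum_F_coeff: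
  assumes "n \<ge> 2" "size M = n"
    and v: "\<And>j. j \<in> {1..<n} \<Longrightarrow> var_rank (v j) \<le> var_rank (v (Suc j))" "image_mset v (mset_set {1..n}) = M"
  shows "mcoeff (\<Sum>w\<in>signed_arc_perms n. F_fun n (sDes n w)) M
    = of_nat (card {s \<in> {1..n}. \<forall>j\<in>{1..<n}. v j = v (Suc j) \<longrightarrow> (is_X (v j) \<longleftrightarrow> j \<noteq> s)})"
proof -
  define e0 where "e0 = (\<lambda>j\<in>{1..n}. is_X (v j))"
  define i0 where "i0 = (\<lambda>j\<in>{1..n}. var_index (v j))"
  let ?c = "\<lambda>s. \<forall>j\<in>{1..<n}. v j = v (Suc j) \<longrightarrow> (is_X (v j) \<longleftrightarrow> j \<noteq> s)"
  let ?V = "\<lambda>e i j. if e j then X (i j) else Y (i j)"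
  define I where "I e s = {i \<in> {1..n} \<rightarrow>\<^sub>E (UNIV :: nat set). (\<forall>j\<in>{1..<n}. i j \<le> i (j + 1)) \<and>
      (\<forall>j\<in>wDes (arc_descents n e {s}, arc_signs n e). i j < i (j + 1)) \<and>
      image_mset (\<lambda>j. if sign_vector (arc_descents n e {s}, arc_signs n e) j = 1 then X (i j) else Y (i j)) (mset_set {1..n}) = M}" for e s
  have range: "{1..<1 + n} = {1..n}" by auto
  have I: "i \<in> I e s \<longleftrightarrow> i \<in> {1..n} \<rightarrow>\<^sub>E UNIV
      \<and> (\<forall>j\<in>{1..<n}. var_rank (?V e i j) \<le> var_rank (?V e i (Suc j))
            \<and> (?V e i j = ?V e i (Suc j) \<longrightarrow> (is_X (?V e i j) \<longleftrightarrow> j \<noteq> s)))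
      \<and> image_mset (?V e i) (mset_set {1..n}) = M" for e i s
  proof -
    have "(\<forall>j\<in>{1..<n}. i j \<le> i (j + 1)) \<and> (\<forall>j\<in>wDes (arc_descents n e {s}, arc_signs n e). i j < i (j + 1))
      \<longleftrightarrow> (\<forall>j\<in>{1..<n}. i j \<le> i (Suc j) \<and> (j \<in> wDes (arc_descents n e {s}, arc_signs n e) \<longrightarrow> i j < i (Suc j)))"
      using wDes_subset[of n e "{s}"] by auto
    also have "\<dots> \<longleftrightarrow> (\<forall>j\<in>{1..<n}. var_rank (?V e i j) \<le> var_rank (?V e i (Suc j))
            \<and> (?V e i j = ?V e i (Suc j) \<longrightarrow> (is_X (?V e i j) \<longleftrightarrow> j \<noteq> s)))"
      by (rule ball_cong[OF refl F_condition])
    finally have 1: "(\<forall>j\<in>{1..<n}. i j \<le> i (j + 1)) \<and> (\<forall>j\<in>wDes (arc_descents n e {s}, arc_signs n e). i j < i (j + 1))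
      \<longleftrightarrow> (\<forall>j\<in>{1..<n}. var_rank (?V e i j) \<le> var_rank (?V e i (Suc j))
            \<and> (?V e i j = ?V e i (Suc j) \<longrightarrow> (is_X (?V e i j) \<longleftrightarrow> j \<noteq> s)))" .
    have 2: "image_mset (\<lambda>j. if sign_vector (arc_descents n e {s}, arc_signs n e) j = 1 then X (i j) else Y (i j)) (mset_set {1..n})
      = image_mset (?V e i) (mset_set {1..n})"
    proof (rule image_mset_cong)
      fix j assume "j \<in># mset_set {1..n}"
      then have j: "j \<in> {1..n}" by simp
      show "(if sign_vector (arc_descents n e {s}, arc_signs n e) j = 1 then X (i j) else Y (i j)) = ?V e i j"
        unfolding sign_vector_arc[OF j] using j by (simp add: arc_signs_def)
    qed
    show ?thesis unfolding I_def mem_Collect_eq 2 using 1 by blast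
  qed
  have V0: "?V e0 i0 j = v j" if "j \<in> {1..n}" for j
    using that by (cases "v j") (simp_all add: e0_def i0_def)
  have uniq: "e = e0 \<and> i = i0 \<and> ?c s" if e: "e \<in> {1..n} \<rightarrow>\<^sub>E UNIV" and i: "i \<in> I e s" for e i s
  proof -
    define V where "V = ?V e i"
    note i' = i[unfolded I, folded V_def]
    have i1: "i \<in> {1..n} \<rightarrow>\<^sub>E UNIV" and i4: "image_mset V (mset_set {1..n}) = M"
      using i' unfolding V_def by blast+
    have i2: "var_rank (V j) \<le> var_rank (V (Suc j))" if "j \<in> {1..<n}" for j
      using i' that unfolding V_def by blast
    have i3: "V j = V (Suc j) \<Longrightarrow> is_X (V j) \<longleftrightarrow> j \<noteq> s" if "j \<in> {1..<n}" for j
      using i' that unfolding V_def by blast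
    have eq: "V j = v j" if j: "j \<in> {1..n}" for j
    proof -
      have "var_rank (V j) = var_rank (v j)"
      proof (rule sorted_fun_unique[of 1 n "\<lambda>j. var_rank (V j)" "\<lambda>j. var_rank (v j)"])
        show "var_rank (V j) \<le> var_rank (V (Suc j))" if "1 \<le> j" "Suc j < 1 + n" for j
          using that by (intro i2) simp
        show "var_rank (v j) \<le> var_rank (v (Suc j))" if "1 \<le> j" "Suc j < 1 + n" for j
          using that by (intro v(1)) simp
        have "image_mset var_rank (image_mset V (mset_set {1..n})) = image_mset var_rank (image_mset v (mset_set {1..n}))"
          unfolding i4 v(2) ..
        then show "image_mset (\<lambda>j. var_rank (V j)) (mset_set {1..<1 + n}) = image_mset (\<lambda>j. var_rank (v j)) (mset_set {1..<1 + n})"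
          unfolding range image_mset.compositionality comp_def .
        show "j \<in> {1..<1 + n}" using j by simp
      qed
      then show ?thesis by (simp only: var_rank_inj)
    qed
    have "e j = e0 j \<and> i j = i0 j" if j: "j \<in> {1..n}" for j
    proof -
      have "?V e i j = ?V e0 i0 j" using eq[OF j] unfolding V_def V0[OF j] .
      then show ?thesis by (simp split: if_splits)
    qed
    then have ei: "e j = e0 j" "i j = i0 j" if "j \<in> {1..n}" for j using that by blast+
    have "e = e0" by (rule PiE_ext[OF e, of e0]) (simp add: e0_def, rule ei(1))
    moreover have "i = i0" by (rule PiE_ext[OF i1, of i0]) (simp add: i0_def, rule ei(2))
    moreover have "?c s"
    proof (intro ballI impI)
      fix j assume j: "j \<in> {1..<n}" and vv: "v j = v (Suc j)"
      then have m: "j \<in> {1..n}" "Suc j \<in> {1..n}" by auto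
      show "is_X (v j) \<longleftrightarrow> j \<noteq> s" using i3[OF j] vv unfolding eq[OF m(1)] eq[OF m(2)] by blast
    qed
    ultimately show ?thesis by blast
  qed
  have mem: "i0 \<in> I e0 s" if c: "?c s" for s
    unfolding I
  proof (intro conjI ballI)
    show "i0 \<in> {1..n} \<rightarrow>\<^sub>E UNIV" by (simp add: i0_def)
    have "image_mset (?V e0 i0) (mset_set {1..n}) = image_mset v (mset_set {1..n})"
      using V0 by (intro image_mset_cong) simp
    then show "image_mset (?V e0 i0) (mset_set {1..n}) = M" using v(2) by simp
    fix j assume j: "j \<in> {1..<n}"
    then have m: "j \<in> {1..n}" "Suc j \<in> {1..n}" by auto
    show "var_rank (?V e0 i0 j) \<le> var_rank (?V e0 i0 (Suc j))"
      unfolding V0[OF m(1)] V0[OF m(2)] using v(1)[OF j] .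
    show "?V e0 i0 j = ?V e0 i0 (Suc j) \<longrightarrow> (is_X (?V e0 i0 j) \<longleftrightarrow> j \<noteq> s)"
      unfolding V0[OF m(1)] V0[OF m(2)] using c j by blast
  qed
  have card_I: "card (I e s) = (if e = e0 \<and> ?c s then 1 else 0)" if e: "e \<in> {1..n} \<rightarrow>\<^sub>E UNIV" for e s
  proof (cases "e = e0 \<and> ?c s")
    case True
    then have "I e s = {i0}" using uniq[OF e] mem by blast
    then show ?thesis using True by simp
  next
    case False
    then have "I e s = {}" using uniq[OF e] by blast
    then show ?thesis using False by (simp only: card.empty if_False)
  qed
  have e0: "e0 \<in> {1..n} \<rightarrow>\<^sub>E UNIV" by (simp add: e0_def)
  have "mcoeff (\<Sum>w\<in>signed_arc_perms n. F_fun n (sDes n w)) M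
      = (\<Sum>e\<in>{1..n} \<rightarrow>\<^sub>E UNIV. \<Sum>s = 1..n. mcoeff (F_fun n (arc_descents n e {s}, arc_signs n e)) M)"
    unfolding sum_signed_arc_perms[OF assms(1), of "F_fun n"] mcoeff_sum ..
  also have "\<dots> = (\<Sum>e\<in>{1..n} \<rightarrow>\<^sub>E UNIV. \<Sum>s = 1..n. of_nat (card (I e s)))"
    unfolding F_fun.rep_eq I_def ..
  also have "\<dots> = (\<Sum>e\<in>{1..n} \<rightarrow>\<^sub>E UNIV. if e = e0 then (\<Sum>s = 1..n. if ?c s then 1 else 0) else 0)"
  proof (rule sum.cong[OF refl])
    fix e assume "e \<in> {1..n} \<rightarrow>\<^sub>E (UNIV :: bool set)"
    note c = card_I[OF this]
    show "(\<Sum>s = 1..n. of_nat (card (I e s))) = (if e = e0 then (\<Sum>s = 1..n. if ?c s then 1 else 0) else (0 :: complex))"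
      unfolding c by (cases "e = e0") (auto intro: sum.cong)
  qed
  also have "\<dots> = (\<Sum>s = 1..n. if ?c s then 1 else 0)"
    using e0 by (simp add: finite_PiE sum.delta')
  also have "\<dots> = of_nat (card {s \<in> {1..n}. ?c s})"
    by (simp add: sum.If_cases Int_def)
  finally show ?thesis .
qed

text \<open>Two equal adjacent \<open>x\<close> forbid the toggle at the first of them, two equal
  adjacent \<open>y\<close> demand it there. Hence there is at most one repetition of a
  \<open>y\<close>, and it disappears when the letter at \<open>s\<close> is removed. An admissible
  \<open>s\<close> is determined by its letter \<open>v s\<close>.\<close>

lemma card_admissible_positions:
  assumes v: "\<And>j. j \<in> {1..<n} \<Longrightarrow> var_rank (v j) \<le> var_rank (v (Suc j))" "image_mset v (mset_set {1..n}) = M"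
  shows "card {s \<in> {1..n}. \<forall>j\<in>{1..<n}. v j = v (Suc j) \<longrightarrow> (is_X (v j) \<longleftrightarrow> j \<noteq> s)}
    = card {x \<in> set_mset M. y_squarefree (M - {#x#})}"
proof -
  define A where "A = {s \<in> {1..n}. \<forall>j\<in>{1..<n}. v j = v (Suc j) \<longrightarrow> (is_X (v j) \<longleftrightarrow> j \<noteq> s)}"
  define B where "B = {x \<in> set_mset M. y_squarefree (M - {#x#})}"
  have A1: "s \<in> {1..n}" if "s \<in> A" for s using that unfolding A_def by blast
  have A2: "is_X (v j) \<longleftrightarrow> j \<noteq> s" if "s \<in> A" "j \<in> {1..<n}" "v j = v (Suc j)" for s j
    using that unfolding A_def by blast
  have count: "count M x = card {j \<in> {1..n}. v j = x}" for x
    unfolding v(2)[symmetric] by (simp add: count_image_mset_eq_card_vimage)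
  have mono: "var_rank (v i) \<le> var_rank (v j)" if "i \<ge> 1" "i \<le> j" "j \<le> n" for i j
    using that(2,3) that(1)
  proof (induction j rule: dec_induct)
    case (step j)
    then show ?case using v(1)[of j] by simp
  qed simp
  have adj: "v i = v (Suc i)" if "i \<ge> 1" "i < j" "j \<le> n" "v i = v j" for i j
  proof -
    have "var_rank (v i) \<le> var_rank (v (Suc i))" "var_rank (v (Suc i)) \<le> var_rank (v j)"
      using mono[of i "Suc i"] mono[of "Suc i" j] that by simp_all
    then show ?thesis using that(4) by (simp add: var_rank_inj[symmetric])
  qed
  have "inj_on v A"
  proof (rule inj_onI)
    have False if s: "s \<in> A" "t \<in> A" "v s = v t" "s < t" for s t
    proof -
      have "s \<in> {1..<n}" "v s = v (Suc s)" using adj[of s t] A1[OF s(1)] A1[OF s(2)] s(3,4) by simp_all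
      then show False using A2[OF s(1), of s] A2[OF s(2), of s] s(4) by simp
    qed
    then have *: "\<not> s < t" if "s \<in> A" "t \<in> A" "v s = v t" for s t using that by blast
    show "s = t" if "s \<in> A" "t \<in> A" "v s = v t" for s t
      using *[of s t] *[of t s] that by simp
  qed
  moreover have "v ` A = B"
  proof (intro equalityI subsetI)
    fix x assume "x \<in> v ` A"
    then obtain s where s: "s \<in> A" "x = v s" by blast
    have "x \<in># M" unfolding v(2)[symmetric] s(2) using A1[OF s(1)] by simp
    moreover have "count (M - {#x#}) (Y i) \<le> 1" for i
    proof (rule ccontr)
      let ?P = "{j \<in> {1..n}. v j = Y i}"
      assume "\<not> count (M - {#x#}) (Y i) \<le> 1"
      then have "1 < count (M - {#x#}) (Y i)" by simp
      then have "1 < card (?P - {s})"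
        using s(2) A1[OF s(1)] count[of "Y i"] by (cases "x = Y i") (simp_all add: card_Diff_singleton_if)
      then have "\<not> (\<forall>a\<in>?P - {s}. \<forall>b\<in>?P - {s}. a = b)"
        using card_le_Suc0_iff_eq[of "?P - {s}"] by simp
      then obtain a b where ab: "a \<in> ?P - {s}" "b \<in> ?P - {s}" "a \<noteq> b" by blast
      obtain p q where p: "p \<in> ?P - {s}" and q: "q \<in> ?P - {s}" "p < q"
      proof (cases "a < b")
        case True
        then show ?thesis using that[OF ab(1,2)] by blast
      next
        case False
        then show ?thesis using that[OF ab(2,1)] ab(3) by simp
      qed
      then have "v p = v (Suc p)" "p \<in> {1..<n}" using p adj[of p q] by simp_all
      then show False using A2[OF s(1), of p] p by simp
    qed
    ultimately show "x \<in> B" by (simp add: y_squarefree_def B_def)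
  next
    fix x assume "x \<in> B"
    then have x: "x \<in># M" "y_squarefree (M - {#x#})" unfolding B_def by blast+
    let ?P = "{j \<in> {1..n}. v j = x}"
    have P: "finite ?P" "?P \<noteq> {}" using x(1) unfolding v(2)[symmetric] by auto
    \<comment> \<open>The only admissible position for the letter \<open>x\<close>: the last
      occurrence if it is an \<open>x\<close>-variable, the first of at most two occurrences if it
      is a \<open>y\<close>-variable.\<close>
    define s where "s = (if is_X x then Max ?P else Min ?P)"
    have s: "s \<in> ?P" unfolding s_def using Max_in[OF P] Min_in[OF P] by simp
    have "is_X (v j) \<longleftrightarrow> j \<noteq> s" if j: "j \<in> {1..<n}" "v j = v (Suc j)" for j
    proof (cases "v j")
      case (X a)
      have "j \<noteq> s"
      proof
        assume "j = s"
        then have "Suc j \<in> ?P" "is_X x" using s j X by auto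
        then have "Suc j \<le> s" unfolding s_def using Max_ge[OF P(1)] by simp
        then show False using \<open>j = s\<close> by simp
      qed
      then show ?thesis using X by simp
    next
      case (Y a)
      let ?R = "{j \<in> {1..n}. v j = Y a}"
      have R: "{j, Suc j} \<subseteq> ?R" "finite ?R" using j Y by auto
      then have 2: "2 \<le> count M (Y a)" unfolding count using card_mono[OF R(2,1)] by simp
      moreover have "count (M - {#x#}) (Y a) \<le> 1" using x(2) by (simp add: y_squarefree_def)
      ultimately have xa: "x = Y a \<and> count M (Y a) \<le> 2" by (cases "x = Y a") simp_all
      then have "card ?R \<le> card {j, Suc j}" unfolding count by simp
      then have "?R = {j, Suc j}" using card_seteq[OF R(2,1)] by simp
      then have "s = Min {j, Suc j}" unfolding s_def using xa by simp
      then show ?thesis using Y by simp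
    qed
    then have "s \<in> A" using s unfolding A_def by blast
    moreover have "x = v s" using s by simp
    ultimately show "x \<in> v ` A" by (rule rev_image_eqI)
  qed
  ultimately show ?thesis unfolding A_def[symmetric] B_def[symmetric] using card_image[of v A] by simp
qed

section \<open>Schur functions of one row and of one column\<close>

lemma young_diagram_row: "young_diagram [k] = (\<lambda>j. (0, j)) ` {0..<0 + k}"
  by (auto simp: young_diagram_def)

lemma young_diagram_column: "young_diagram (replicate k 1) = (\<lambda>i. (i, 0)) ` {0..<0 + k}"
  by (auto simp: young_diagram_def)

lemma image_mset_young:
  assumes "inj_on g {0..<0 + k}"
  shows "image_mset (\<lambda>c. z (T c)) (mset_set (g ` {0..<0 + k})) = image_mset z (image_mset (\<lambda>j. T (g j)) (mset_set {0..<0 + k}))"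
  unfolding image_mset_mset_set[OF assms, symmetric] image_mset.compositionality comp_def ..

text \<open>One-row tableaux are the case of the relation \<open>\<le>\<close>, one-column tableaux the case of \<open><\<close>.\<close>

lemma card_monotone_fillings:
  fixes z :: "nat \<Rightarrow> var" and g :: "nat \<Rightarrow> nat \<times> nat"
  assumes g: "inj g" and z: "\<And>i. var_index (z i) = i"
    and r: "\<And>a b. r a b \<Longrightarrow> a \<le> b" "\<And>a b. a \<le> b \<Longrightarrow> a \<noteq> b \<Longrightarrow> r a b"
    and M: "size M = k" "\<And>x. x \<in># M \<Longrightarrow> x \<in> range z" "\<And>a. \<not> r a a \<Longrightarrow> count M (z a) \<le> 1"
  shows "card {T \<in> g ` {0..<0 + k} \<rightarrow>\<^sub>E UNIV. (\<forall>j. Suc j < k \<longrightarrow> r (T (g j)) (T (g (Suc j))))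
      \<and> image_mset (\<lambda>c. z (T c)) (mset_set (g ` {0..<0 + k})) = M} = 1"
proof -
  let ?D = "g ` {0..<0 + k}"
  let ?A = "{T \<in> ?D \<rightarrow>\<^sub>E UNIV. (\<forall>j. Suc j < k \<longrightarrow> r (T (g j)) (T (g (Suc j))))
      \<and> image_mset (\<lambda>c. z (T c)) (mset_set ?D) = M}"
  note img = image_mset_young[OF inj_on_subset[OF g subset_UNIV]]
  have zM: "image_mset z (image_mset var_index M) = M"
  proof -
    have "image_mset (\<lambda>x. z (var_index x)) M = image_mset (\<lambda>x. x) M"
    proof (rule image_mset_cong)
      fix x assume "x \<in># M"
      then obtain i where "x = z i" using M(2) by blast
      then show "z (var_index x) = x" using z by simp
    qed
    then show ?thesis by (simp add: image_mset.compositionality comp_def)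
  qed
  have "size (image_mset var_index M) = k" using M(1) by simp
  then obtain f where f: "\<And>j. 0 \<le> j \<Longrightarrow> Suc j < 0 + k \<Longrightarrow> f j \<le> f (Suc j)"
    "image_mset f (mset_set {0..<0 + k}) = image_mset var_index M"
    by (rule sorted_fun_exists[of _ k 0]) blast
  define T0 where "T0 = (\<lambda>c\<in>?D. f (inv_into UNIV g c))"
  have T0: "T0 (g j) = f j" if "j < k" for j using that g by (simp add: T0_def)
  have "T0 \<in> ?A"
  proof (intro CollectI conjI allI impI)
    show "T0 \<in> ?D \<rightarrow>\<^sub>E UNIV" by (simp add: T0_def)
    have "image_mset (\<lambda>j. T0 (g j)) (mset_set {0..<0 + k}) = image_mset f (mset_set {0..<0 + k})"
      using T0 by (intro image_mset_cong) simp
    then show "image_mset (\<lambda>c. z (T0 c)) (mset_set ?D) = M" unfolding img using f(2) zM by simp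
    fix j assume j: "Suc j < k"
    show "r (T0 (g j)) (T0 (g (Suc j)))"
    proof (cases "f j = f (Suc j)")
      case True
      have "r (f j) (f j)"
      proof (rule ccontr)
        assume "\<not> r (f j) (f j)"
        then have c: "count M (z (f j)) \<le> 1" by (rule M(3))
        have "M = image_mset (\<lambda>i. z (f i)) (mset_set {0..<0 + k})"
          using zM f(2) by (simp add: image_mset.compositionality comp_def flip: f(2))
        then have "count M (z (f j)) = card {i \<in> {0..<0 + k}. z (f i) = z (f j)}"
          by (simp add: count_image_mset_eq_card_vimage)
        moreover have "{j, Suc j} \<subseteq> {i \<in> {0..<0 + k}. z (f i) = z (f j)}" using j True by auto
        then have "card {j, Suc j} \<le> card {i \<in> {0..<0 + k}. z (f i) = z (f j)}" by (intro card_mono) auto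
        ultimately show False using c by simp
      qed
      then show ?thesis using T0[of j] T0[of "Suc j"] j True by simp
    next
      case False
      then show ?thesis using T0[of j] T0[of "Suc j"] j f(1)[of j] r(2) by simp
    qed
  qed
  moreover have "T = T0" if T: "T \<in> ?A" for T
  proof (rule PiE_ext)
    show "T \<in> ?D \<rightarrow>\<^sub>E UNIV" using T by blast
    show "T0 \<in> ?D \<rightarrow>\<^sub>E UNIV" by (simp add: T0_def)
    fix c assume "c \<in> ?D"
    then obtain j where j: "j \<in> {0..<0 + k}" "c = g j" by blast
    have "T (g j) = f j"
    proof (rule sorted_fun_unique[of 0 k "\<lambda>j. T (g j)" f])
      show "T (g i) \<le> T (g (Suc i))" if "Suc i < 0 + k" for i using T that r(1) by simp
      show "f i \<le> f (Suc i)" if "Suc i < 0 + k" for i using f(1) that by simp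
      have "image_mset z (image_mset (\<lambda>j. T (g j)) (mset_set {0..<0 + k})) = M" using T unfolding img by simp
      then have "image_mset var_index (image_mset z (image_mset (\<lambda>j. T (g j)) (mset_set {0..<0 + k}))) = image_mset var_index M" by simp
      then show "image_mset (\<lambda>j. T (g j)) (mset_set {0..<0 + k}) = image_mset f (mset_set {0..<0 + k})"
        unfolding f(2) by (simp add: image_mset.compositionality comp_def z)
    qed (use j in auto)
    then show "T c = T0 c" using T0 j by simp
  qed
  ultimately have "?A = {T0}" by blast
  then show ?thesis by simp
qed

lemma monotone_filling_content:
  fixes g :: "nat \<Rightarrow> nat \<times> nat"
  assumes "inj g" "image_mset (\<lambda>c. z (T c)) (mset_set (g ` {0..<0 + k})) = M"
  shows "size M = k" "x \<in># M \<Longrightarrow> x \<in> range z"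
proof -
  have M: "M = image_mset z (image_mset (\<lambda>j. T (g j)) (mset_set {0..<0 + k}))"
    using assms(2) unfolding image_mset_young[OF inj_on_subset[OF assms(1) subset_UNIV]] by (rule sym)
  show "size M = k" unfolding M by simp
  show "x \<in> range z" if "x \<in># M" using that unfolding M by auto
qed

lemma schur_row_coeff:
  "mcoeff (schur X [k]) M = (if size M = k \<and> (\<forall>x\<in>#M. is_X x) then 1 else 0)"
proof -
  define g where "g j = (0 :: nat, j)" for j :: nat
  have g: "inj g" by (simp add: g_def inj_def)
  have D: "young_diagram [k] = g ` {0..<0 + k}" unfolding young_diagram_row g_def ..
  have rX: "x \<in> range X \<longleftrightarrow> is_X x" for x by (cases x) auto
  have "ssyt [k] = {T \<in> g ` {0..<0 + k} \<rightarrow>\<^sub>E UNIV. \<forall>j. Suc j < k \<longrightarrow> T (g j) \<le> T (g (Suc j))}"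
    unfolding ssyt_def D[symmetric] by (auto simp: young_diagram_def g_def)
  then have c: "mcoeff (schur X [k]) M = of_nat (card {T \<in> g ` {0..<0 + k} \<rightarrow>\<^sub>E UNIV.
      (\<forall>j. Suc j < k \<longrightarrow> T (g j) \<le> T (g (Suc j))) \<and> image_mset (\<lambda>c. X (T c)) (mset_set (g ` {0..<0 + k})) = M})"
    unfolding schur.rep_eq D by (simp only: mem_Collect_eq conj_assoc)
  show ?thesis
  proof (cases "size M = k \<and> (\<forall>x\<in>#M. is_X x)")
    case True
    then show ?thesis unfolding c
      by (subst card_monotone_fillings[OF g, of X "(\<le>)" M k]) (auto simp: rX)
  next
    case False
    then have "{T \<in> g ` {0..<0 + k} \<rightarrow>\<^sub>E UNIV.
      (\<forall>j. Suc j < k \<longrightarrow> T (g j) \<le> T (g (Suc j))) \<and> image_mset (\<lambda>c. X (T c)) (mset_set (g ` {0..<0 + k})) = M} = {}"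
      using monotone_filling_content[OF g, of X _ k M] rX by blast
    then show ?thesis unfolding c if_not_P[OF False] by (simp only: card.empty of_nat_0)
  qed
qed

lemma schur_column_coeff:
  "mcoeff (schur Y (replicate k 1)) M
    = (if size M = k \<and> (\<forall>x\<in>#M. \<not> is_X x) \<and> y_squarefree M then 1 else 0)"
proof -
  define g where "g i = (i, 0 :: nat)" for i :: nat
  have g: "inj g" by (simp add: g_def inj_def)
  have D: "young_diagram (replicate k 1) = g ` {0..<0 + k}" unfolding young_diagram_column g_def ..
  have rY: "x \<in> range Y \<longleftrightarrow> \<not> is_X x" for x by (cases x) auto
  have "ssyt (replicate k 1) = {T \<in> g ` {0..<0 + k} \<rightarrow>\<^sub>E UNIV. \<forall>j. Suc j < k \<longrightarrow> T (g j) < T (g (Suc j))}"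
    unfolding ssyt_def D[symmetric] by (auto simp: young_diagram_def g_def)
  then have c: "mcoeff (schur Y (replicate k 1)) M = of_nat (card {T \<in> g ` {0..<0 + k} \<rightarrow>\<^sub>E UNIV.
      (\<forall>j. Suc j < k \<longrightarrow> T (g j) < T (g (Suc j))) \<and> image_mset (\<lambda>c. Y (T c)) (mset_set (g ` {0..<0 + k})) = M})"
    unfolding schur.rep_eq D by (simp only: mem_Collect_eq conj_assoc)
  show ?thesis
  proof (cases "size M = k \<and> (\<forall>x\<in>#M. \<not> is_X x) \<and> y_squarefree M")
    case True
    then show ?thesis unfolding c
      by (subst card_monotone_fillings[OF g, of Y "(<)" M k]) (auto simp: rY y_squarefree_def)
  next
    case False
    have "y_squarefree M" if T: "\<forall>j. Suc j < k \<longrightarrow> T (g j) < T (g (Suc j))"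
      "image_mset (\<lambda>c. Y (T c)) (mset_set (g ` {0..<0 + k})) = M" for T
      unfolding y_squarefree_def
    proof
      fix a
      have mono: "T (g i) < T (g j)" if "i < j" "j < k" for i j
        using that
      proof (induction j)
        case (Suc j)
        then show ?case using T(1) less_trans by (cases "i = j") (auto simp: less_Suc_eq)
      qed simp
      have "M = image_mset (\<lambda>j. Y (T (g j))) (mset_set {0..<0 + k})"
        using T(2) unfolding image_mset_young[OF inj_on_subset[OF g subset_UNIV]]
        by (simp add: image_mset.compositionality comp_def)
      then have "count M (Y a) = card {i \<in> {0..<0 + k}. Y (T (g i)) = Y a}"
        by (simp add: count_image_mset_eq_card_vimage)
      also have "\<dots> \<le> 1"
      proof -
        have "i = j" if "i < k" "j < k" "T (g i) = a" "T (g j) = a" for i j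
          using mono[of i j] mono[of j i] that by (cases i j rule: linorder_cases) auto
        then show ?thesis by (simp add: card_le_Suc0_iff_eq)
      qed
      finally show "count M (Y a) \<le> 1" .
    qed
    then have "{T \<in> g ` {0..<0 + k} \<rightarrow>\<^sub>E UNIV.
      (\<forall>j. Suc j < k \<longrightarrow> T (g j) < T (g (Suc j))) \<and> image_mset (\<lambda>c. Y (T c)) (mset_set (g ` {0..<0 + k})) = M} = {}"
      using False monotone_filling_content[OF g, of Y _ k M] rY by blast
    then show ?thesis unfolding c if_not_P[OF False] by (simp only: card.empty of_nat_0)
  qed
qed

text \<open>The only factorization of \<open>M\<close> into a monomial in the \<open>x\<close> and
  one in the \<open>y\<close> is the one into its two parts.\<close>

lemma schur_row_column_coeff:
  "mcoeff (schur X [k] * schur Y (replicate j 1)) M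
    = (if size (filter_mset is_X M) = k \<and> size (filter_mset (\<lambda>x. \<not> is_X x) M) = j \<and> y_squarefree M then 1 else 0)"
proof -
  let ?A = "filter_mset is_X M" and ?B = "filter_mset (\<lambda>x. \<not> is_X x) M"
  have MA: "M - ?A = ?B" by (metis add_diff_cancel_left' multiset_partition)
  have "mcoeff (schur X [k] * schur Y (replicate j 1)) M
      = (\<Sum>A\<in>{?A}. mcoeff (schur X [k]) A * mcoeff (schur Y (replicate j 1)) (M - A))"
    unfolding mcoeff_mult
  proof (rule sum.mono_neutral_right)
    show "finite {A. A \<subseteq># M}" by (rule finite_submultisets)
    show "\<forall>A\<in>{A. A \<subseteq># M} - {?A}. mcoeff (schur X [k]) A * mcoeff (schur Y (replicate j 1)) (M - A) = 0"
    proof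
      fix A assume A: "A \<in> {A. A \<subseteq># M} - {?A}"
      then have sub: "A \<subseteq># M" by simp
      have "\<not> ((\<forall>x\<in>#A. is_X x) \<and> (\<forall>x\<in>#M - A. \<not> is_X x))"
      proof
        assume *: "(\<forall>x\<in>#A. is_X x) \<and> (\<forall>x\<in>#M - A. \<not> is_X x)"
        have "filter_mset is_X M = filter_mset is_X (A + (M - A))" using sub by simp
        also have "\<dots> = filter_mset is_X A + filter_mset is_X (M - A)" by simp
        also have "filter_mset is_X A = A" using * by (simp add: filter_mset_eq_conv)
        also have "filter_mset is_X (M - A) = filter_mset (\<lambda>_. False) (M - A)"
          using * by (intro filter_mset_cong0) blast
        finally show False using A by simp
      qed
      then show "mcoeff (schur X [k]) A * mcoeff (schur Y (replicate j 1)) (M - A) = 0"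
        unfolding schur_row_coeff schur_column_coeff by auto
    qed
  qed simp
  moreover have "y_squarefree ?B \<longleftrightarrow> y_squarefree M" by (simp add: y_squarefree_def)
  ultimately show ?thesis by (simp add: schur_row_coeff schur_column_coeff[unfolded One_nat_def] MA)
qed

lemma sum_schur_coeff:
  "mcoeff (\<Sum>k = 0..m. schur X [k] * schur Y (replicate (m - k) 1)) M
    = (if size M = m \<and> y_squarefree M then 1 else 0)"
proof -
  let ?a = "size (filter_mset is_X M)" and ?b = "size (filter_mset (\<lambda>x. \<not> is_X x) M)"
  have ab: "size M = ?a + ?b" by (metis multiset_partition size_union)
  have "mcoeff (\<Sum>k = 0..m. schur X [k] * schur Y (replicate (m - k) 1)) M
      = (\<Sum>k = 0..m. if ?a = k then (if ?b = m - k \<and> y_squarefree M then 1 else 0) else 0)"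
    unfolding mcoeff_sum schur_row_column_coeff by (intro sum.cong refl) auto
  also have "\<dots> = (if ?a \<in> {0..m} then (if ?b = m - ?a \<and> y_squarefree M then 1 else 0) else 0)"
    by (simp add: sum.delta)
  also have "\<dots> = (if size M = m \<and> y_squarefree M then 1 else 0)"
    unfolding ab by auto
  finally show ?thesis .
qed

section \<open>The generating function of the signed arc permutations\<close>

lemma p_plus_1_coeff: "mcoeff (p_plus 1) A = (if size A = 1 then 1 else 0)"
proof (cases "size A = 1")
  case True
  then obtain x where "A = {#x#}" by (metis One_nat_def size_1_singleton_mset)
  then show ?thesis by (cases x) (auto simp: p_plus_def mcoeff_add power_sum.rep_eq)
next
  case False
  then show ?thesis by (auto simp: p_plus_def mcoeff_add power_sum.rep_eq)
qed

text \<open>On the right, the coefficient of \<open>M\<close> counts the distinct variables in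
  \<open>M\<close> whose removal leaves a monomial without repeated \<open>y\<close>; on the left,
  it counts the admissible toggles of the word obtained by sorting \<open>M\<close> by rank.\<close>

lemma sum_F_signed_arc_perms:
  assumes "n \<ge> 2"
  shows "(\<Sum>w\<in>signed_arc_perms n. F_fun n (sDes n w))
    = p_plus 1 * (\<Sum>k = 0..n - 1. schur X [k] * schur Y (replicate (n - 1 - k) 1))"
proof (rule mseries_eqI)
  fix M :: "var multiset"
  let ?H = "\<Sum>k = 0..n - 1. schur X [k] * schur Y (replicate (n - 1 - k) 1)"
  have "mcoeff (p_plus 1 * ?H) M
      = (\<Sum>A\<in>(\<lambda>x. {#x#}) ` set_mset M. mcoeff (p_plus 1) A * mcoeff ?H (M - A))"
    unfolding mcoeff_mult
  proof (rule sum.mono_neutral_right)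
    show "finite {A. A \<subseteq># M}" by (rule finite_submultisets)
    show "(\<lambda>x. {#x#}) ` set_mset M \<subseteq> {A. A \<subseteq># M}" by auto
    show "\<forall>A\<in>{A. A \<subseteq># M} - (\<lambda>x. {#x#}) ` set_mset M. mcoeff (p_plus 1) A * mcoeff ?H (M - A) = 0"
    proof
      fix A assume A: "A \<in> {A. A \<subseteq># M} - (\<lambda>x. {#x#}) ` set_mset M"
      have "size A \<noteq> 1"
      proof
        assume "size A = 1"
        then obtain x where "A = {#x#}" by (metis One_nat_def size_1_singleton_mset)
        then show False using A by auto
      qed
      then show "mcoeff (p_plus 1) A * mcoeff ?H (M - A) = 0" by (simp only: p_plus_1_coeff if_False mult_zero_left)
    qed
  qed
  also have "\<dots> = (\<Sum>x\<in>set_mset M. mcoeff ?H (M - {#x#}))"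
    by (subst sum.reindex) (simp_all add: inj_on_def p_plus_1_coeff[simplified])
  also have "\<dots> = (\<Sum>x\<in>set_mset M. if size M = n \<and> y_squarefree (M - {#x#}) then 1 else 0)"
  proof (rule sum.cong[OF refl])
    fix x assume "x \<in># M"
    then have "size (M - {#x#}) = size M - 1" "size M \<noteq> 0" by (auto simp: size_Diff_singleton)
    then show "mcoeff ?H (M - {#x#}) = (if size M = n \<and> y_squarefree (M - {#x#}) then 1 else 0)"
      unfolding sum_schur_coeff using assms by auto
  qed
  also have "\<dots> = (if size M = n then of_nat (card {x \<in> set_mset M. y_squarefree (M - {#x#})}) else 0)"
    by (simp add: sum.If_cases Int_def)
  finally have R: "mcoeff (p_plus 1 * ?H) M = (if size M = n then of_nat (card {x \<in> set_mset M. y_squarefree (M - {#x#})}) else 0)" .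
  show "mcoeff (\<Sum>w\<in>signed_arc_perms n. F_fun n (sDes n w)) M = mcoeff (p_plus 1 * ?H) M"
  proof (cases "size M = n")
    case True
    then have "size (image_mset var_rank M) = n" by simp
    then obtain f where f: "\<And>j. 1 \<le> j \<Longrightarrow> Suc j < 1 + n \<Longrightarrow> f j \<le> f (Suc j)"
      "image_mset f (mset_set {1..<1 + n}) = image_mset var_rank M"
      by (rule sorted_fun_exists[of _ n 1]) blast
    define v where "v j = inv_into UNIV var_rank (f j)" for j
    have range: "{1..<1 + n} = {1..n}" by auto
    have fv: "f j = var_rank (v j)" if "j \<in> {1..n}" for j
    proof -
      have "f j \<in># image_mset var_rank M" unfolding f(2)[symmetric] range using that by simp
      then show ?thesis unfolding v_def by (metis f_inv_into_f imageE rangeI set_image_mset)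
    qed
    have vM: "image_mset v (mset_set {1..n}) = M"
    proof -
      have "image_mset v (mset_set {1..n}) = image_mset (inv_into UNIV var_rank) (image_mset f (mset_set {1..n}))"
        by (simp add: image_mset.compositionality comp_def v_def[abs_def])
      also have "\<dots> = image_mset (inv_into UNIV var_rank) (image_mset var_rank M)" using f(2) unfolding range by simp
      also have "\<dots> = M" using inj_var_rank by (simp add: image_mset.compositionality)
      finally show ?thesis .
    qed
    have mono: "var_rank (v j) \<le> var_rank (v (Suc j))" if "j \<in> {1..<n}" for j
      using f(1)[of j] fv[of j] fv[of "Suc j"] that by simp
    show ?thesis
      using sum_F_coeff[OF assms True mono vM] card_admissible_positions[OF mono vM]
      by (simp only: R if_P[OF True])
  next
    case False
    have ne: "image_mset h (mset_set {1..n}) \<noteq> M" for h :: "nat \<Rightarrow> var"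
    proof
      assume eq: "image_mset h (mset_set {1..n}) = M"
      have "size M = n" unfolding eq[symmetric] by simp
      then show False using False by simp
    qed
    have "mcoeff (F_fun n \<sigma>) M = 0" for \<sigma>
    proof -
      have "{i \<in> {1..n} \<rightarrow>\<^sub>E (UNIV :: nat set). (\<forall>j\<in>{1..<n}. i j \<le> i (j + 1)) \<and> (\<forall>j\<in>wDes \<sigma>. i j < i (j + 1)) \<and>
          image_mset (\<lambda>j. if sign_vector \<sigma> j = 1 then X (i j) else Y (i j)) (mset_set {1..n}) = M} = {}"
        using ne by blast
      then show ?thesis unfolding F_fun.rep_eq by (simp only: card.empty of_nat_0)
    qed
    then show ?thesis unfolding R if_not_P[OF False] mcoeff_sum by simp
  qed
qed

section \<open>The Frobenius characteristic\<close>

definition type_series :: "nat multiset \<times> nat multiset \<Rightarrow> var mseries" where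
  "type_series t = prod_mset (image_mset p_plus (fst t)) * prod_mset (image_mset p_minus (snd t))"

lemma mcoeff_mconst_mult: "mcoeff (mconst a * f) M = a * mcoeff f M"
proof -
  have "mcoeff (mconst a * f) M = (\<Sum>A\<in>{{#}}. mcoeff (mconst a) A * mcoeff f (M - A))"
    unfolding mcoeff_mult by (rule sum.mono_neutral_right) (auto simp: finite_submultisets mconst.rep_eq)
  then show ?thesis by (simp add: mconst.rep_eq)
qed

lemma ch_eq: "ch n f = mconst (1 / of_nat (card (signed_perms n)))
    * (\<Sum>w\<in>signed_perms n. mconst (f w) * type_series (signed_cycle_type n w))"
  unfolding ch_def type_series_def card_signed_perms
  by (simp add: case_prod_unfold mult.assoc)

lemma mcoeff_ch:
  "mcoeff (ch n f) M = (\<Sum>w\<in>signed_perms n. f w * mcoeff (type_series (signed_cycle_type n w)) M)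
    / of_nat (card (signed_perms n))"
  unfolding ch_eq mcoeff_mconst_mult mcoeff_sum by simp

text \<open>Frobenius reciprocity in unnormalized form: for each \<open>u\<close> the substitution
  of \<open>w\<close> by its conjugate turns the inner sum into the sum over the stabilizer.\<close>

lemma sum_induced:
  fixes q :: "(int \<Rightarrow> int) \<Rightarrow> complex"
  assumes "n \<ge> 1" and q: "\<And>u h. u \<in> signed_perms n \<Longrightarrow> h \<in> signed_perms n \<Longrightarrow> q (u \<circ> h \<circ> inv_into UNIV u) = q h"
  shows "(\<Sum>w\<in>signed_perms n. induced (signed_perms (n - 1)) (signed_perms n) f w * q w)
    = of_nat (card (signed_perms n)) / of_nat (card (signed_perms (n - 1))) * (\<Sum>h\<in>signed_perms (n - 1). f h * q h)"
proof -
  let ?G = "signed_perms n" and ?H = "signed_perms (n - 1)"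
  let ?c = "\<lambda>u w. inv_into UNIV u \<circ> w \<circ> u"
  have HG: "h \<in> ?G" if "h \<in> ?H" for h using that unfolding signed_perms_stabilizer[OF assms(1)] by blast
  have "(\<Sum>w\<in>?G. induced ?H ?G f w * q w)
      = (\<Sum>w\<in>?G. (\<Sum>u\<in>?G. if ?c u w \<in> ?H then f (?c u w) * q w / of_nat (card ?H) else 0))"
  proof (rule sum.cong[OF refl])
    fix w assume w: "w \<in> ?G"
    have "induced ?H ?G f w * q w = (\<Sum>u | u \<in> ?G \<and> ?c u w \<in> ?H. f (?c u w) * q w / of_nat (card ?H))"
      using w by (simp add: induced_def sum_distrib_right sum_divide_distrib)
    also have "\<dots> = (\<Sum>u\<in>?G. if ?c u w \<in> ?H then f (?c u w) * q w / of_nat (card ?H) else 0)"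
      by (rule sum.inter_filter) (rule finite_signed_perms)
    finally show "induced ?H ?G f w * q w = \<dots>" .
  qed
  also have "\<dots> = (\<Sum>u\<in>?G. \<Sum>w\<in>?G. if ?c u w \<in> ?H then f (?c u w) * q w / of_nat (card ?H) else 0)"
    by (rule sum.swap)
  also have "\<dots> = (\<Sum>u\<in>?G. \<Sum>h\<in>?H. f h * q h / of_nat (card ?H))"
  proof (rule sum.cong[OF refl])
    fix u assume u: "u \<in> ?G"
    note i = signed_perms_inv_comp[OF u] and v = signed_perms_inv[OF u]
    have "(\<Sum>w\<in>?G. if ?c u w \<in> ?H then f (?c u w) * q w / of_nat (card ?H) else 0)
        = (\<Sum>w\<in>{w \<in> ?G. ?c u w \<in> ?H}. f (?c u w) * q w / of_nat (card ?H))"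
      by (rule sum.inter_filter[symmetric]) (rule finite_signed_perms)
    also have "\<dots> = (\<Sum>h\<in>?H. f h * q h / of_nat (card ?H))"
    proof (rule sum.reindex_bij_witness[of _ "\<lambda>h. u \<circ> h \<circ> inv_into UNIV u" "?c u"])
      fix w assume w: "w \<in> {w \<in> ?G. ?c u w \<in> ?H}"
      show *: "u \<circ> ?c u w \<circ> inv_into UNIV u = w"
        using i by (metis comp_assoc comp_id id_comp)
      show "?c u w \<in> ?H" using w by blast
      have "q w = q (?c u w)"
        using q[OF u HG, of "?c u w"] w unfolding * by simp
      then show "f (?c u w) * q (?c u w) / of_nat (card ?H) = f (?c u w) * q w / of_nat (card ?H)" by simp
    next
      fix h assume h: "h \<in> ?H"
      show *: "?c u (u \<circ> h \<circ> inv_into UNIV u) = h"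
        using i by (metis comp_assoc comp_id id_comp)
      have "u \<circ> h \<circ> inv_into UNIV u \<in> ?G" using u HG[OF h] v by (intro signed_perms_comp)
      then show "u \<circ> h \<circ> inv_into UNIV u \<in> {w \<in> ?G. ?c u w \<in> ?H}" using h * by simp
    qed
    finally show "(\<Sum>w\<in>?G. if ?c u w \<in> ?H then f (?c u w) * q w / of_nat (card ?H) else 0) = \<dots>" .
  qed
  finally show ?thesis by (simp add: sum_divide_distrib[symmetric])
qed

text \<open>The factor \<open>p_plus 1\<close> is the positive fixed point \<open>n\<close> that an
  element of the stabilizer has in the larger group.\<close>

lemma ch_induced:
  assumes "n \<ge> 1"
  shows "ch n (induced (signed_perms (n - 1)) (signed_perms n) f) = p_plus 1 * ch (n - 1) f"
proof -
  let ?G = "signed_perms n" and ?H = "signed_perms (n - 1)"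
  have "ch n (induced ?H ?G f) = mconst (1 / of_nat (card ?H)) * (\<Sum>h\<in>?H. mconst (f h) * type_series (signed_cycle_type n h))"
  proof (rule mseries_eqI)
    fix M
    have "card ?G \<noteq> 0" by (simp add: card_signed_perms)
    then show "mcoeff (ch n (induced ?H ?G f)) M
      = mcoeff (mconst (1 / of_nat (card ?H)) * (\<Sum>h\<in>?H. mconst (f h) * type_series (signed_cycle_type n h))) M"
      unfolding mcoeff_ch mcoeff_mconst_mult mcoeff_sum
      by (subst sum_induced[OF assms]) (simp_all add: signed_cycle_type_conj)
  qed
  also have "(\<Sum>h\<in>?H. mconst (f h) * type_series (signed_cycle_type n h))
      = p_plus 1 * (\<Sum>h\<in>?H. mconst (f h) * type_series (signed_cycle_type (n - 1) h))"
    unfolding sum_distrib_left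
  proof (rule sum.cong[OF refl])
    fix h assume "h \<in> ?H"
    from signed_cycle_type_stabilizer[OF assms this]
    show "mconst (f h) * type_series (signed_cycle_type n h) = p_plus 1 * (mconst (f h) * type_series (signed_cycle_type (n - 1) h))"
      by (simp add: type_series_def mult_ac)
  qed
  finally show ?thesis unfolding ch_eq[of "n - 1"] by (simp add: mult_ac)
qed

section \<open>Power sum products as signed counts of colourings\<close>

definition colourings :: "int set \<Rightarrow> var multiset \<Rightarrow> (int \<Rightarrow> var) set" where
  "colourings U M = {c \<in> U \<rightarrow>\<^sub>E UNIV. image_mset c (mset_set U) = M}"

text \<open>Positions coloured by an \<open>x\<close> carry no sign. A cycle coloured entirely by
  one \<open>y\<close> thus contributes its cycle sign, which is the coefficient of the
  \<open>y\<close>-power in \<open>p_plus\<close> or \<open>p_minus\<close>.\<close>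

definition colour_sign :: "int set \<Rightarrow> (int \<Rightarrow> var) \<Rightarrow> (int \<Rightarrow> int) \<Rightarrow> int" where
  "colour_sign U c w = (\<Prod>i\<in>U. if is_X (c i) then 1 else sgn (w i))"

lemma finite_colourings: "finite U \<Longrightarrow> finite (colourings U M)"
proof (rule finite_subset)
  assume "finite U"
  then show "colourings U M \<subseteq> U \<rightarrow>\<^sub>E set_mset M" by (auto simp: colourings_def)
  show "finite (U \<rightarrow>\<^sub>E set_mset M)" using \<open>finite U\<close> by (intro finite_PiE) auto
qed

lemma image_mset_const_on:
  assumes "\<And>i. i \<in> b \<Longrightarrow> c i = v" shows "image_mset c (mset_set b) = replicate_mset (card b) v"
proof -
  have "image_mset c (mset_set b) = image_mset (\<lambda>_. v) (mset_set b)"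
    using assms by (intro image_mset_cong) (metis elem_mset_set finite_set_mset_mset_set mset_set.infinite empty_iff set_mset_empty)
  then show ?thesis by (simp add: image_mset_const_eq)
qed

text \<open>A colouring that is constant on the cycle \<open>b\<close> amounts to a choice of one variable for \<open>b\<close>.\<close>

lemma mcoeff_cycle_series_mult:
  fixes w :: "int \<Rightarrow> int"
  assumes "finite b" "b \<noteq> {}" "finite U" "b \<inter> U = {}"
    and g: "\<And>A. mcoeff g A = (\<Sum>v | replicate_mset (card b) v = A. of_int (if is_X v then 1 else cycle_sign w b))"
    and f: "\<And>A. mcoeff f A = (\<Sum>c | c \<in> colourings U A \<and> R c. of_int (colour_sign U c w))"
    and R: "\<And>c c'. (\<And>i. i \<in> U \<Longrightarrow> c i = c' i) \<Longrightarrow> R c \<longleftrightarrow> R c'"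
  shows "mcoeff (g * f) M = (\<Sum>c | c \<in> colourings (b \<union> U) M \<and> (\<exists>v. \<forall>i\<in>b. c i = v) \<and> R c.
    of_int (colour_sign (b \<union> U) c w))"
proof -
  let ?r = "\<lambda>v. replicate_mset (card b) v"
  have b0: "card b \<noteq> 0" using assms(1,2) by simp
  \<comment> \<open>The common colour of \<open>b\<close> is read off at \<open>x0\<close>; this
    inverts the gluing of a colour on \<open>b\<close> with a colouring of \<open>U\<close>.\<close>
  obtain x0 where x0: "x0 \<in> b" using assms(2) by blast
  have inj: "inj ?r" by (rule injI) (use b0 in \<open>simp add: replicate_mset_eq_iff\<close>)
  define V where "V = {v. ?r v \<subseteq># M}"
  have finV: "finite V"
  proof (rule finite_subset)
    show "V \<subseteq> set_mset M"
    proof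
      fix v assume "v \<in> V"
      then have "?r v \<subseteq># M" by (simp add: V_def)
      moreover have "v \<in># ?r v" using b0 by simp
      ultimately show "v \<in># M" by (rule mset_subset_eqD)
    qed
  qed simp
  define \<omega> where "\<omega> v = (of_int (if is_X v then 1 else cycle_sign w b) :: complex)" for v
  have g1: "mcoeff g (?r v) = \<omega> v" for v
  proof -
    have "?r v' = ?r v \<longleftrightarrow> v' = v" for v' using b0 by (simp add: replicate_mset_eq_iff)
    then have "{v'. ?r v' = ?r v} = {v}" by (simp only: singleton_conv)
    then show ?thesis unfolding g \<omega>_def by simp
  qed
  have "mcoeff (g * f) M = (\<Sum>A\<in>?r ` V. mcoeff g A * mcoeff f (M - A))"
    unfolding mcoeff_mult
  proof (rule sum.mono_neutral_right)
    show "finite {A. A \<subseteq># M}" by (rule finite_submultisets)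
    show "?r ` V \<subseteq> {A. A \<subseteq># M}" by (auto simp: V_def)
    show "\<forall>A\<in>{A. A \<subseteq># M} - ?r ` V. mcoeff g A * mcoeff f (M - A) = 0"
    proof
      fix A assume "A \<in> {A. A \<subseteq># M} - ?r ` V"
      then have "{v. ?r v = A} = {}" unfolding V_def by blast
      then have "mcoeff g A = 0" unfolding g by (simp only: sum.empty)
      then show "mcoeff g A * mcoeff f (M - A) = 0" by simp
    qed
  qed
  also have "\<dots> = (\<Sum>v\<in>V. \<omega> v * mcoeff f (M - ?r v))"
    by (subst sum.reindex[OF inj_on_subset[OF inj subset_UNIV]]) (simp add: g1)
  also have "\<dots> = (\<Sum>v\<in>V. \<Sum>c | c \<in> colourings U (M - ?r v) \<and> R c. \<omega> v * of_int (colour_sign U c w))"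
    unfolding f sum_distrib_left ..
  also have "\<dots> = (\<Sum>(v, c)\<in>(SIGMA v:V. {c. c \<in> colourings U (M - ?r v) \<and> R c}). \<omega> v * of_int (colour_sign U c w))"
    using finV finite_colourings[OF assms(3)] by (intro sum.Sigma) auto
  also have "\<dots> = (\<Sum>c | c \<in> colourings (b \<union> U) M \<and> (\<exists>v. \<forall>i\<in>b. c i = v) \<and> R c. of_int (colour_sign (b \<union> U) c w))"
  proof (rule sum.reindex_bij_witness[of _ "\<lambda>c. (c x0, restrict c U)" "\<lambda>(v, c). \<lambda>i\<in>b \<union> U. if i \<in> b then v else c i"])
    fix p assume "p \<in> (SIGMA v:V. {c. c \<in> colourings U (M - ?r v) \<and> R c})"
    then obtain v c where p: "p = (v, c)" "v \<in> V" "c \<in> colourings U (M - ?r v)" "R c" by blast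
    define c' where "c' = (\<lambda>i\<in>b \<union> U. if i \<in> b then v else c i)"
    have c'b: "c' i = v" if "i \<in> b" for i using that by (simp add: c'_def)
    have c'U: "c' i = c i" if "i \<in> U" for i using that assms(4) by (auto simp: c'_def)
    have ext: "c \<in> U \<rightarrow>\<^sub>E UNIV" using p(3) by (simp add: colourings_def)
    have rU: "restrict c' U = c"
      by (rule PiE_ext[OF _ ext]) (simp_all add: c'U)
    have "image_mset c' (mset_set U) = image_mset c (mset_set U)"
      using c'U assms(3) by (intro image_mset_cong) simp
    then have "image_mset c' (mset_set (b \<union> U)) = ?r v + (M - ?r v)"
      using p(3) image_mset_const_on[of b c' v] c'b assms(1,3,4)
      by (simp add: mset_set_Union colourings_def)
    also have "\<dots> = M" using p(2) by (simp add: V_def)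
    finally have c'M: "c' \<in> colourings (b \<union> U) M" by (simp add: colourings_def c'_def)
    have sign: "colour_sign (b \<union> U) c' w = (if is_X v then 1 else cycle_sign w b) * colour_sign U c w"
    proof -
      have "colour_sign (b \<union> U) c' w = colour_sign b c' w * colour_sign U c' w"
        unfolding colour_sign_def using assms(1,3,4) by (intro prod.union_disjoint)
      also have "colour_sign b c' w = (if is_X v then 1 else cycle_sign w b)"
        using c'b by (simp add: colour_sign_def cycle_sign_def)
      also have "colour_sign U c' w = colour_sign U c w" using c'U by (simp add: colour_sign_def)
      finally show ?thesis .
    qed
    have case_p: "(case p of (v, c) \<Rightarrow> \<lambda>i\<in>b \<union> U. if i \<in> b then v else c i) = c'" by (simp add: p(1) c'_def)
    show "((case p of (v, c) \<Rightarrow> \<lambda>i\<in>b \<union> U. if i \<in> b then v else c i) x0,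
        restrict (case p of (v, c) \<Rightarrow> \<lambda>i\<in>b \<union> U. if i \<in> b then v else c i) U) = p"
      unfolding case_p rU c'b[OF x0] by (rule p(1)[symmetric])
    show "(case p of (v, c) \<Rightarrow> \<lambda>i\<in>b \<union> U. if i \<in> b then v else c i)
        \<in> {c. c \<in> colourings (b \<union> U) M \<and> (\<exists>v. \<forall>i\<in>b. c i = v) \<and> R c}"
      unfolding case_p mem_Collect_eq using c'M c'b p(4) R[of c' c] c'U by blast
    show "of_int (colour_sign (b \<union> U) (case p of (v, c) \<Rightarrow> \<lambda>i\<in>b \<union> U. if i \<in> b then v else c i) w)
        = (case p of (v, c) \<Rightarrow> \<omega> v * of_int (colour_sign U c w))"
      unfolding case_p sign by (simp add: p(1) \<omega>_def)
  next
    fix c assume c: "c \<in> {c. c \<in> colourings (b \<union> U) M \<and> (\<exists>v. \<forall>i\<in>b. c i = v) \<and> R c}"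
    then have cb: "c i = c x0" if "i \<in> b" for i using x0 that by auto
    define v0 where "v0 = c x0"
    have ext: "c \<in> b \<union> U \<rightarrow>\<^sub>E UNIV" and cM: "image_mset c (mset_set (b \<union> U)) = M"
      using c by (simp_all add: colourings_def)
    have split: "M = ?r v0 + image_mset c (mset_set U)"
      using cM image_mset_const_on[of b c v0] cb assms(1,3,4) by (simp add: mset_set_Union v0_def)
    have rU: "image_mset (restrict c U) (mset_set U) = image_mset c (mset_set U)"
      using assms(3) by (intro image_mset_cong) simp
    show "(case (c x0, restrict c U) of (v, c) \<Rightarrow> \<lambda>i\<in>b \<union> U. if i \<in> b then v else c i) = c"
      unfolding prod.case
    proof (rule PiE_ext[OF _ ext])
      fix i assume "i \<in> b \<union> U"
      then show "(\<lambda>i\<in>b \<union> U. if i \<in> b then c x0 else restrict c U i) i = c i"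
        using cb[of i] by (cases "i \<in> b") simp_all
    qed simp
    have "c x0 \<in> V" unfolding V_def mem_Collect_eq v0_def[symmetric] split by (rule mset_subset_eq_add_left)
    moreover have "image_mset c (mset_set U) = M - ?r (c x0)"
      unfolding v0_def[symmetric] split by simp
    then have "restrict c U \<in> colourings U (M - ?r (c x0))"
      unfolding colourings_def mem_Collect_eq rU by simp
    moreover have "R (restrict c U)" using c R[of c "restrict c U"] by simp
    ultimately show "(c x0, restrict c U) \<in> (SIGMA v:V. {c. c \<in> colourings U (M - ?r v) \<and> R c})" by blast
  qed
  finally show ?thesis .
qed

lemma cycle_series_coeff:
  assumes "r \<noteq> 0" "d = 1 \<or> d = - 1"
  shows "mcoeff (if d = 1 then p_plus r else p_minus r) A
    = (\<Sum>v | replicate_mset r v = A. of_int (if is_X v then 1 else d))"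
proof -
  have eqi: "replicate_mset r u = replicate_mset r v \<longleftrightarrow> u = v" for u v :: var
    using assms(1) by (simp add: replicate_mset_eq_iff)
  show ?thesis
  proof (cases "\<exists>v. replicate_mset r v = A")
    case True
    then obtain v where v: "A = replicate_mset r v" by blast
    have "{u. replicate_mset r u = A} = {v}" unfolding v eqi by simp
    moreover have "mcoeff (power_sum z r) A = (if v \<in> range z then 1 else 0)" for z
      unfolding v power_sum.rep_eq eqi by (simp add: image_iff)
    moreover have "v \<in> range X \<longleftrightarrow> is_X v" "v \<in> range Y \<longleftrightarrow> \<not> is_X v" by (cases v; auto)+
    ultimately show ?thesis using assms(2) by (auto simp: p_plus_def p_minus_def mcoeff_add mcoeff_diff)
  next
    case False
    then have "{u. replicate_mset r u = A} = {}" by blast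
    moreover have "mcoeff (power_sum z r) A = 0" for z
      unfolding power_sum.rep_eq using False by (intro if_not_P) metis
    ultimately show ?thesis by (simp add: p_plus_def p_minus_def mcoeff_add mcoeff_diff)
  qed
qed

text \<open>Induction over the cycles. Constancy on the cycles already treated serves as the
  predicate \<open>R\<close> for the next one; it only depends on the colours outside the new
  cycle.\<close>

lemma prod_cycle_series_coeff:
  assumes w: "w \<in> signed_perms n" and "Q \<subseteq> abs_cycles n w"
  shows "mcoeff (\<Prod>b\<in>Q. if cycle_sign w b = 1 then p_plus (card b) else p_minus (card b)) M
    = (\<Sum>c | c \<in> colourings (\<Union>Q) M \<and> (\<forall>b\<in>Q. \<exists>v. \<forall>i\<in>b. c i = v). of_int (colour_sign (\<Union>Q) c w))"
proof -
  have "finite Q" using assms(2) finite_abs_cycles finite_subset by blast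
  then show ?thesis using assms(2)
  proof (induction Q arbitrary: M rule: finite_induct)
    case empty
    have "{c. c \<in> colourings (\<Union>{}) M \<and> (\<forall>b\<in>{}. \<exists>v. \<forall>i\<in>b. c i = v)} = (if M = {#} then {\<lambda>_. undefined} else {})"
      by (auto simp: colourings_def)
    then show ?case by (simp add: one_mseries.rep_eq colour_sign_def)
  next
    case (insert b Q)
    have b: "b \<in> abs_cycles n w" and Q: "Q \<subseteq> abs_cycles n w" using insert.prems by auto
    have fb: "finite b" "b \<noteq> {}" using abs_cycle_subset[OF w b] by auto
    have fQ: "finite (\<Union>Q)" using abs_cycle_subset(2)[OF w] insert(1) Q by blast
    have disj: "b \<inter> \<Union>Q = {}" using abs_cycles_disjoint[OF w b] Q insert(2) by blast
    have r: "card b \<noteq> 0" using fb by simp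
    define f where "f = (\<Prod>b\<in>Q. if cycle_sign w b = 1 then p_plus (card b) else p_minus (card b))"
    define g where "g = (if cycle_sign w b = 1 then p_plus (card b) else p_minus (card b))"
    have f: "mcoeff f A = (\<Sum>c | c \<in> colourings (\<Union>Q) A \<and> (\<forall>b\<in>Q. \<exists>v. \<forall>i\<in>b. c i = v). of_int (colour_sign (\<Union>Q) c w))" for A
      unfolding f_def by (rule insert.IH[OF Q])
    have g: "mcoeff g A = (\<Sum>v | replicate_mset (card b) v = A. of_int (if is_X v then 1 else cycle_sign w b))" for A
      unfolding g_def using cycle_series_coeff[OF r cycle_sign_cases[OF w abs_cycle_subset(1)[OF w b]]] .
    have R: "(\<forall>b\<in>Q. \<exists>v. \<forall>i\<in>b. c i = v) \<longleftrightarrow> (\<forall>b\<in>Q. \<exists>v. \<forall>i\<in>b. c' i = v)"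
      if "\<And>i. i \<in> \<Union>Q \<Longrightarrow> c i = c' i" for c c' :: "int \<Rightarrow> var"
    proof (rule ball_cong[OF refl])
      fix b assume "b \<in> Q"
      then have "c i = c' i" if "i \<in> b" for i using \<open>\<And>i. i \<in> \<Union>Q \<Longrightarrow> c i = c' i\<close> that by blast
      then show "(\<exists>v. \<forall>i\<in>b. c i = v) \<longleftrightarrow> (\<exists>v. \<forall>i\<in>b. c' i = v)" by simp
    qed
    have "(\<Prod>b\<in>insert b Q. if cycle_sign w b = 1 then p_plus (card b) else p_minus (card b)) = g * f"
      unfolding f_def g_def by (rule prod.insert[OF insert(1,2)])
    moreover note mcoeff_cycle_series_mult[OF fb fQ disj, of g w f "\<lambda>c. \<forall>b\<in>Q. \<exists>v. \<forall>i\<in>b. c i = v" M, OF g f R]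
    ultimately show ?case by (simp only: Union_insert ball_simps)
  qed
qed

lemma type_series_prod:
  assumes "w \<in> signed_perms n"
  shows "type_series (signed_cycle_type n w)
    = (\<Prod>b\<in>abs_cycles n w. if cycle_sign w b = 1 then p_plus (card b) else p_minus (card b))"
proof -
  have "(\<Prod>b\<in>abs_cycles n w. if cycle_sign w b = 1 then p_plus (card b) else p_minus (card b))
    = (\<Prod>b\<in>{b \<in> abs_cycles n w. cycle_sign w b = 1}. p_plus (card b))
      * (\<Prod>b\<in>{b \<in> abs_cycles n w. cycle_sign w b = - 1}. p_minus (card b))"
    unfolding prod_abs_cycles_split[OF assms] by (intro arg_cong2[of _ _ _ _ "(*)"] prod.cong refl) auto
  then show ?thesis
    unfolding signed_cycle_type_eq[OF assms] type_series_def
    by (simp add: prod_unfold_prod_mset image_mset.compositionality comp_def)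
qed

definition colour_stabilizer :: "nat \<Rightarrow> (int \<Rightarrow> var) \<Rightarrow> (int \<Rightarrow> int) set" where
  "colour_stabilizer n c = {w \<in> signed_perms n. \<forall>i\<in>{1..int n}. c (unsigned w i) = c i}"

lemma colour_stabilizer_iff:
  assumes w: "w \<in> signed_perms n"
  shows "w \<in> colour_stabilizer n c \<longleftrightarrow> (\<forall>b\<in>abs_cycles n w. \<exists>v. \<forall>i\<in>b. c i = v)"
proof
  assume s: "w \<in> colour_stabilizer n c"
  show "\<forall>b\<in>abs_cycles n w. \<exists>v. \<forall>i\<in>b. c i = v"
  proof
    fix b assume "b \<in> abs_cycles n w"
    then obtain x where x: "x \<in> {1..int n}" "b = orbit (unsigned w) x" unfolding abs_cycles_def by blast
    have "c i = c x \<and> i \<in> {1..int n}" if "i \<in> b" for i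
      using that unfolding x(2)
      by (induction rule: orbit.induct)
        (use s x(1) unsigned_mem[OF w] in \<open>simp_all add: colour_stabilizer_def del: atLeastAtMost_iff\<close>)
    then show "\<exists>v. \<forall>i\<in>b. c i = v" by blast
  qed
next
  assume const: "\<forall>b\<in>abs_cycles n w. \<exists>v. \<forall>i\<in>b. c i = v"
  have "c (unsigned w i) = c i" if i: "i \<in> {1..int n}" for i
  proof -
    have "orbit (unsigned w) i \<in> abs_cycles n w" using i unfolding abs_cycles_def by blast
    then obtain v where "\<forall>j\<in>orbit (unsigned w) i. c j = v" using const by blast
    then show ?thesis using abs_cycle_mem[OF w i] orbit.base[of "unsigned w" i] by simp
  qed
  then show "w \<in> colour_stabilizer n c" using w by (simp add: colour_stabilizer_def)
qed

text \<open>Exchanging the sums over group elements and over colourings turns each coefficient into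
  a sum of pairings of \<open>f\<close> with the sign character \<open>colour_sign\<close> of the
  stabilizers of colourings.\<close>

lemma mcoeff_ch_colourings:
  "mcoeff (ch n f) M = (\<Sum>c\<in>colourings {1..int n} M. \<Sum>w\<in>colour_stabilizer n c.
      f w * of_int (colour_sign {1..int n} c w)) / of_nat (card (signed_perms n))"
proof -
  let ?G = "signed_perms n" and ?C = "colourings {1..int n} M"
  let ?s = "\<lambda>c w. complex_of_int (colour_sign {1..int n} c w)"
  have finC: "finite ?C" by (rule finite_colourings) simp
  have "(\<Sum>w\<in>?G. f w * mcoeff (type_series (signed_cycle_type n w)) M)
      = (\<Sum>w\<in>?G. \<Sum>c\<in>?C. if w \<in> colour_stabilizer n c then f w * ?s c w else 0)"
  proof (rule sum.cong[OF refl])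
    fix w assume w: "w \<in> ?G"
    have "mcoeff (type_series (signed_cycle_type n w)) M
        = (\<Sum>c\<in>{c \<in> ?C. w \<in> colour_stabilizer n c}. ?s c w)"
      unfolding type_series_prod[OF w] prod_cycle_series_coeff[OF w order_refl]
        Union_abs_cycles[OF w] colour_stabilizer_iff[OF w] ..
    then have "f w * mcoeff (type_series (signed_cycle_type n w)) M
        = (\<Sum>c\<in>{c \<in> ?C. w \<in> colour_stabilizer n c}. f w * ?s c w)"
      by (simp only: sum_distrib_left)
    also have "\<dots> = (\<Sum>c\<in>?C. if w \<in> colour_stabilizer n c then f w * ?s c w else 0)"
      by (rule sum.inter_filter[OF finC])
    finally show "f w * mcoeff (type_series (signed_cycle_type n w)) M = \<dots>" .
  qed
  also have "\<dots> = (\<Sum>c\<in>?C. \<Sum>w\<in>?G. if w \<in> colour_stabilizer n c then f w * ?s c w else 0)"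
    by (rule sum.swap)
  also have "\<dots> = (\<Sum>c\<in>?C. \<Sum>w\<in>colour_stabilizer n c. f w * ?s c w)"
  proof (rule sum.cong[OF refl])
    fix c
    have "{w \<in> ?G. w \<in> colour_stabilizer n c} = colour_stabilizer n c" by (auto simp: colour_stabilizer_def)
    then show "(\<Sum>w\<in>?G. if w \<in> colour_stabilizer n c then f w * ?s c w else 0)
        = (\<Sum>w\<in>colour_stabilizer n c. f w * ?s c w)"
      using sum.inter_filter[OF finite_signed_perms, of "\<lambda>w. f w * ?s c w" n "\<lambda>w. w \<in> colour_stabilizer n c"]
      by simp
  qed
  finally show ?thesis unfolding mcoeff_ch by (simp only:)
qed

section \<open>The exterior powers\<close>

definition ext_power_char :: "nat \<Rightarrow> nat \<Rightarrow> (int \<Rightarrow> int) \<Rightarrow> complex" where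
  "ext_power_char m j w = (if w \<in> signed_perms m
     then of_int (\<Sum>I | I \<subseteq> {1..int m} \<and> card I = j \<and> unsigned w ` I = I. ext_sign w I) else 0)"

lemma sum_involution_cancel:
  fixes t :: "'a \<Rightarrow> int"
  assumes "\<And>w. w \<in> S \<Longrightarrow> \<phi> w \<in> S" "\<And>w. w \<in> S \<Longrightarrow> \<phi> (\<phi> w) = w" "\<And>w. w \<in> S \<Longrightarrow> t (\<phi> w) = - t w"
  shows "sum t S = 0"
proof -
  have "sum t S = (\<Sum>w\<in>S. t (\<phi> w))"
    by (rule sum.reindex_bij_witness[of _ \<phi> \<phi>]) (use assms in auto)
  also have "\<dots> = - sum t S" using assms(3) by (simp add: sum_negf)
  finally show ?thesis by simp
qed

definition sign_flip :: "nat \<Rightarrow> int \<Rightarrow> int \<Rightarrow> int" where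
  "sign_flip m k = odd_extension m (\<lambda>i. if i = k then - i else i)"

lemma sign_flip:
  "sign_flip m k \<in> signed_perms m" "unsigned (sign_flip m k) = id" "sign_flip m k \<circ> sign_flip m k = id"
  "i \<in> {1..int m} \<Longrightarrow> sign_flip m k i = (if i = k then - i else i)"
proof -
  show 1: "sign_flip m k \<in> signed_perms m"
    unfolding sign_flip_def
  proof (rule odd_extension_signed_perm)
    let ?f = "\<lambda>i. if i = k then - i else i"
    show "\<bar>?f i\<bar> \<in> {1..int m}" if "i \<in> {1..int m}" for i using that by simp
    show "inj_on (\<lambda>i. \<bar>?f i\<bar>) {1..int m}" by (rule inj_onI) (simp split: if_splits)
  qed
  show 4: "sign_flip m k i = (if i = k then - i else i)" if "i \<in> {1..int m}" for i
    unfolding sign_flip_def odd_extension_eq[OF that] ..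
  show "unsigned (sign_flip m k) = id"
  proof (rule signed_perms_eqI[OF unsigned_signed_perm[OF 1] signed_perms_id])
    fix i assume i: "i \<in> {1..int m}"
    then show "unsigned (sign_flip m k) i = id i" using 4[OF i] by (simp add: unsigned_def)
  qed
  show "sign_flip m k \<circ> sign_flip m k = id"
  proof (rule signed_perms_eqI[OF signed_perms_comp[OF 1 1] signed_perms_id])
    fix i assume i: "i \<in> {1..int m}"
    then show "(sign_flip m k \<circ> sign_flip m k) i = id i"
      using 4[OF i] signed_permsD(2)[OF 1, of i] by (cases "i = k") auto
  qed
qed

lemma odd_extension_permutes:
  assumes "p permutes {1..int m}"
  shows "odd_extension m p \<in> signed_perms m" "unsigned (odd_extension m p) = odd_extension m p"
    "i \<in> {1..int m} \<Longrightarrow> odd_extension m p i = p i"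
proof -
  have pm: "p i \<in> {1..int m}" if "i \<in> {1..int m}" for i using permutes_in_image[OF assms] that by blast
  show 1: "odd_extension m p \<in> signed_perms m"
  proof (rule odd_extension_signed_perm)
    show "\<bar>p i\<bar> \<in> {1..int m}" if "i \<in> {1..int m}" for i using pm[OF that] by simp
    show "inj_on (\<lambda>i. \<bar>p i\<bar>) {1..int m}"
    proof (rule inj_onI)
      fix x y assume "x \<in> {1..int m}" "y \<in> {1..int m}" "\<bar>p x\<bar> = \<bar>p y\<bar>"
      then have "p x = p y" using pm[of x] pm[of y] by simp
      then show "x = y" using permutes_inj[OF assms] by (simp add: inj_eq)
    qed
  qed
  show 3: "odd_extension m p i = p i" if "i \<in> {1..int m}" for i
    unfolding odd_extension_eq[OF that] ..
  show "unsigned (odd_extension m p) = odd_extension m p"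
  proof (rule signed_perms_eqI[OF unsigned_signed_perm[OF 1] 1])
    fix i assume i: "i \<in> {1..int m}"
    then show "unsigned (odd_extension m p) i = odd_extension m p i"
      using 3[OF i] pm[OF i] by (simp add: unsigned_def)
  qed
qed

lemma ext_sign_flip:
  assumes "w \<in> signed_perms m" "I \<subseteq> {1..int m}"
  shows "ext_sign (w \<circ> sign_flip m k) I = (if k \<in> I then - 1 else 1) * ext_sign w I"
proof -
  have fin: "finite I" using assms(2) finite_subset by blast
  have "ext_sign (sign_flip m k) I = (\<Prod>i\<in>I. sgn (sign_flip m k i))"
    unfolding ext_sign_def sign_flip(2) using inv_sign_id[OF fin, of id] by simp
  also have "\<dots> = (\<Prod>i\<in>I. if i = k then - 1 else 1)"
  proof (rule prod.cong[OF refl])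
    fix i assume "i \<in> I"
    then have i: "i \<in> {1..int m}" using assms(2) by blast
    show "sgn (sign_flip m k i) = (if i = k then - 1 else 1)" unfolding sign_flip(4)[OF i] using i by simp
  qed
  also have "\<dots> = (if k \<in> I then - 1 else 1)" using fin by (simp add: prod.delta)
  finally show ?thesis
    using ext_sign_comp[OF assms(1) sign_flip(1) assms(2), of k] by (simp add: sign_flip(2))
qed

lemma colour_sign_eq_prod:
  assumes "finite U"
  shows "colour_sign U c w = (\<Prod>i\<in>{i \<in> U. \<not> is_X (c i)}. sgn (w i))"
proof -
  have "colour_sign U c w = (\<Prod>i\<in>U. if \<not> is_X (c i) then sgn (w i) else 1)"
    unfolding colour_sign_def by (intro prod.cong) auto
  also have "\<dots> = (\<Prod>i\<in>{i \<in> U. \<not> is_X (c i)}. sgn (w i))"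
    by (rule prod.inter_filter[OF assms, symmetric])
  finally show ?thesis .
qed

lemma colour_sign_flip:
  assumes "w \<in> signed_perms m" "k \<in> {1..int m}"
  shows "colour_sign {1..int m} c (w \<circ> sign_flip m k)
    = (if is_X (c k) then 1 else - 1) * colour_sign {1..int m} c w"
proof -
  have "colour_sign {1..int m} c (w \<circ> sign_flip m k)
      = (\<Prod>i\<in>{1..int m}. (if i = k then (if is_X (c k) then 1 else - 1) else 1) * (if is_X (c i) then 1 else sgn (w i)))"
    unfolding colour_sign_def
  proof (rule prod.cong[OF refl])
    fix i assume i: "i \<in> {1..int m}"
    show "(if is_X (c i) then 1 else sgn ((w \<circ> sign_flip m k) i))
      = (if i = k then (if is_X (c k) then 1 else - 1) else 1) * (if is_X (c i) then 1 else sgn (w i))"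
      using sign_flip(4)[OF i, of k] signed_permsD(2)[OF assms(1), of i] by (cases "i = k") (auto simp: sgn_minus)
  qed
  also have "\<dots> = (if is_X (c k) then 1 else - 1) * colour_sign {1..int m} c w"
    unfolding prod.distrib colour_sign_def using assms(2) by (simp add: prod.delta)
  finally show ?thesis .
qed

text \<open>If some \<open>k\<close> lies in exactly one of \<open>I\<close> and \<open>Yc\<close>,
  the sign change at \<open>k\<close> reverses exactly one of the two signs, and the terms cancel.
  If two elements of \<open>I = Yc\<close> have the same colour, their transposition reverses
  \<open>ext_sign\<close> only. Otherwise the stabilizer fixes \<open>I\<close> pointwise up to
  signs, both factors are the same product of signs, and every term is \<open>1\<close>.\<close>

lemma sum_stabilizer_ext_sign:
  fixes c :: "int \<Rightarrow> var"
  assumes I: "I \<subseteq> {1..int m}"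
  defines "Yc \<equiv> {i \<in> {1..int m}. \<not> is_X (c i)}"
  shows "(\<Sum>w\<in>{w \<in> colour_stabilizer m c. unsigned w ` I = I}. ext_sign w I * colour_sign {1..int m} c w)
    = (if I = Yc \<and> inj_on c I then int (card (colour_stabilizer m c)) else 0)"
proof -
  let ?S = "{w \<in> colour_stabilizer m c. unsigned w ` I = I}"
  let ?t = "\<lambda>w. ext_sign w I * colour_sign {1..int m} c w"
  have SG: "w \<in> signed_perms m" if "w \<in> ?S" for w using that by (simp add: colour_stabilizer_def)
  have Sc: "c (unsigned w i) = c i" if "w \<in> ?S" "i \<in> {1..int m}" for w i
    using that by (simp add: colour_stabilizer_def)
  have SI: "unsigned w ` I = I" if "w \<in> ?S" for w using that by simp
  have fin: "finite I" using I finite_subset by blast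
  consider "I \<noteq> Yc" | "I = Yc" "\<not> inj_on c I" | "I = Yc" "inj_on c I" by blast
  then show ?thesis
  proof cases
    case 1
    have "Yc \<subseteq> {1..int m}" by (auto simp: Yc_def)
    then obtain k where k: "k \<in> {1..int m}" "k \<in> I \<longleftrightarrow> k \<notin> Yc" using 1 I by blast
    have kY: "k \<in> Yc \<longleftrightarrow> \<not> is_X (c k)" using k(1) by (simp add: Yc_def)
    have "sum ?t ?S = 0"
    proof (rule sum_involution_cancel[of _ "\<lambda>w. w \<circ> sign_flip m k"])
      fix w assume w: "w \<in> ?S"
      note G = SG[OF w]
      have u: "unsigned (w \<circ> sign_flip m k) = unsigned w"
        using unsigned_comp[OF G sign_flip(1)] by (simp add: sign_flip(2))
      show "w \<circ> sign_flip m k \<in> ?S"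
        using w signed_perms_comp[OF G sign_flip(1)] u by (simp add: colour_stabilizer_def)
      show "w \<circ> sign_flip m k \<circ> sign_flip m k = w" by (simp add: comp_assoc sign_flip(3))
      show "?t (w \<circ> sign_flip m k) = - ?t w"
        unfolding ext_sign_flip[OF G I] colour_sign_flip[OF G k(1)] using k(2) kY by auto
    qed
    then show ?thesis using 1 by simp
  next
    case 2
    then obtain p q where pq: "p \<in> I" "q \<in> I" "p \<noteq> q" "c p = c q" unfolding inj_on_def by blast
    have pqm: "p \<in> {1..int m}" "q \<in> {1..int m}" using pq I by blast+
    define T where "T = odd_extension m (transpose p q)"
    have tp: "transpose p q permutes {1..int m}" using pqm by (rule permutes_swap_id)
    note T = odd_extension_permutes[OF tp, folded T_def]
    have TI: "unsigned T ` I = I"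
    proof -
      have "unsigned T ` I = transpose p q ` I"
        unfolding T(2) using T(3) I by (intro image_cong) auto
      also have "\<dots> = I" using pq by (simp add: transpose_image_eq)
      finally show ?thesis .
    qed
    have cT: "c (T i) = c i" if "i \<in> {1..int m}" for i
      unfolding T(3)[OF that] using pq(4) by (cases "i = p"; cases "i = q") simp_all
    have eT: "ext_sign T I = - 1"
    proof -
      have "inv_sign (unsigned T) I = inv_sign (transpose p q) I"
        unfolding T(2) using T(3) I by (intro inv_sign_cong) blast
      moreover have "sgn (T i) = 1" if "i \<in> I" for i
        using unsigned_pos[OF T(1), of i] that I unfolding T(2) by auto
      ultimately show ?thesis unfolding ext_sign_def using inv_sign_transpose[OF fin pq(1-3)] by simp
    qed
    have TT: "T \<circ> T = id"
    proof (rule signed_perms_eqI[OF signed_perms_comp[OF T(1) T(1)] signed_perms_id])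
      fix i assume i: "i \<in> {1..int m}"
      have "T i \<in> {1..int m}" using unsigned_mem[OF T(1) i] unfolding T(2) .
      then show "(T \<circ> T) i = id i" using T(3) i by simp
    qed
    have "sum ?t ?S = 0"
    proof (rule sum_involution_cancel[of _ "\<lambda>w. w \<circ> T"])
      fix w assume w: "w \<in> ?S"
      note G = SG[OF w]
      have u: "unsigned (w \<circ> T) = unsigned w \<circ> T"
        using unsigned_comp[OF G T(1)] unfolding T(2) .
      have "c (unsigned (w \<circ> T) i) = c i" if i: "i \<in> {1..int m}" for i
      proof -
        have "T i \<in> {1..int m}" using unsigned_mem[OF T(1) i] unfolding T(2) .
        then show ?thesis unfolding u comp_apply using Sc[OF w] cT[OF i] by simp
      qed
      moreover have "unsigned (w \<circ> T) ` I = I"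
        unfolding u image_comp[symmetric] using TI SI[OF w] unfolding T(2) by simp
      ultimately show "w \<circ> T \<in> ?S"
        using signed_perms_comp[OF G T(1)] by (simp add: colour_stabilizer_def)
      show "w \<circ> T \<circ> T = w" by (simp add: comp_assoc TT)
      have "colour_sign {1..int m} c (w \<circ> T) = colour_sign {1..int m} c w"
      proof -
        have inj: "inj_on T I" using signed_permsD(4)[OF T(1)] inj_on_subset by blast
        have "colour_sign {1..int m} c (w \<circ> T) = (\<Prod>i\<in>I. sgn (w (T i)))"
          unfolding 2(1) Yc_def by (simp add: colour_sign_eq_prod)
        also have "\<dots> = (\<Prod>i\<in>T ` I. sgn (w i))" by (simp add: prod.reindex[OF inj])
        also have "T ` I = I" using TI unfolding T(2) .
        also have "(\<Prod>i\<in>I. sgn (w i)) = colour_sign {1..int m} c w"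
          unfolding 2(1) Yc_def by (simp add: colour_sign_eq_prod)
        finally show ?thesis .
      qed
      then show "?t (w \<circ> T) = - ?t w"
        using ext_sign_comp[OF G T(1) I] unfolding TI eT by simp
    qed
    then show ?thesis using 2 by simp
  next
    case 3
    have fixed: "unsigned w i = i" if w: "w \<in> colour_stabilizer m c" and i: "i \<in> I" for w i
    proof -
      have G: "w \<in> signed_perms m" using w by (simp add: colour_stabilizer_def)
      have im: "i \<in> {1..int m}" using i I by blast
      have ci: "c (unsigned w i) = c i" using w im by (simp add: colour_stabilizer_def)
      moreover have "\<not> is_X (c i)" using i unfolding 3(1) Yc_def by simp
      ultimately have "unsigned w i \<in> I"
        using unsigned_mem[OF G im] unfolding 3(1) Yc_def by simp
      then show ?thesis using inj_onD[OF 3(2) ci _ i] by blast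
    qed
    have S: "?S = colour_stabilizer m c" using fixed by auto
    have "?t w = 1" if w: "w \<in> colour_stabilizer m c" for w
    proof -
      have G: "w \<in> signed_perms m" using w by (simp add: colour_stabilizer_def)
      have "ext_sign w I = (\<Prod>i\<in>I. sgn (w i))"
        unfolding ext_sign_def using inv_sign_id[OF fin, of "unsigned w"] fixed[OF w] by simp
      moreover have "colour_sign {1..int m} c w = (\<Prod>i\<in>I. sgn (w i))"
        unfolding 3(1) Yc_def by (simp add: colour_sign_eq_prod)
      ultimately have "?t w = (\<Prod>i\<in>I. sgn (w i) * sgn (w i))" by (simp only: prod.distrib)
      also have "\<dots> = 1"
      proof (rule prod.neutral, rule ballI)
        fix i assume "i \<in> I"
        then have "w i \<noteq> 0" using I signed_perms_eq_0_iff[OF G, of i] by auto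
        then show "sgn (w i) * sgn (w i) = 1" by (auto simp: sgn_if)
      qed
      finally show ?thesis .
    qed
    then show ?thesis unfolding S using 3 by simp
  qed
qed

lemma colour_transport:
  assumes "c \<in> colourings {1..int m} M" "c' \<in> colourings {1..int m} M"
  obtains u where "u \<in> signed_perms m" "unsigned u = u" "\<And>i. i \<in> {1..int m} \<Longrightarrow> c (u i) = c' i"
proof -
  have "image_mset c' (mset_set {1..int m}) = image_mset c (mset_set {1..int m})"
    using assms by (simp add: colourings_def)
  then obtain p where p: "p permutes {1..int m}" "\<forall>i\<in>{1..int m}. c' i = c (p i)"
    using image_mset_eq_implies_permutes[of "{1..int m}" c' c] by auto
  show ?thesis
  proof (rule that)
    show "odd_extension m p \<in> signed_perms m" "unsigned (odd_extension m p) = odd_extension m p"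
      using odd_extension_permutes[OF p(1)] by blast+
    show "c (odd_extension m p i) = c' i" if "i \<in> {1..int m}" for i
      unfolding odd_extension_permutes(3)[OF p(1) that] using p(2) that by simp
  qed
qed

text \<open>The group is partitioned according to the colouring that \<open>w\<close> makes out of
  \<open>c0\<close>, and the class of \<open>c\<close> is a left coset of the stabilizer of
  \<open>c\<close>.\<close>

lemma sum_card_colour_stabilizer:
  assumes "c0 \<in> colourings {1..int m} M"
  shows "(\<Sum>c\<in>colourings {1..int m} M. card (colour_stabilizer m c)) = card (signed_perms m)"
proof -
  let ?C = "colourings {1..int m} M" and ?G = "signed_perms m"
  define F where "F c = {w \<in> ?G. \<forall>i\<in>{1..int m}. c0 (unsigned w i) = c i}" for c
  have G: "?G = (\<Union>c\<in>?C. F c)"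
  proof (intro equalityI subsetI)
    fix w assume w: "w \<in> ?G"
    define c where "c = (\<lambda>i\<in>{1..int m}. c0 (unsigned w i))"
    have inj: "inj_on (unsigned w) {1..int m}"
      using signed_permsD(4)[OF unsigned_signed_perm[OF w]] inj_on_subset by blast
    have "image_mset c (mset_set {1..int m}) = image_mset (\<lambda>i. c0 (unsigned w i)) (mset_set {1..int m})"
      by (rule image_mset_cong) (simp add: c_def)
    also have "\<dots> = image_mset c0 (image_mset (unsigned w) (mset_set {1..int m}))"
      by (simp add: image_mset.compositionality comp_def)
    also have "\<dots> = M"
      unfolding image_mset_mset_set[OF inj] unsigned_permutes_image[OF w] using assms by (simp add: colourings_def)
    finally have "c \<in> ?C" by (simp add: colourings_def c_def)
    moreover have "w \<in> F c" using w by (simp add: F_def c_def)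
    ultimately show "w \<in> (\<Union>c\<in>?C. F c)" by blast
  qed (auto simp: F_def)
  have "card ?G = (\<Sum>c\<in>?C. card (F c))"
    unfolding G
  proof (rule card_UN_disjoint)
    show "finite ?C" by (rule finite_colourings) simp
    show "\<forall>c\<in>?C. finite (F c)" using finite_signed_perms[of m] by (auto simp: F_def)
    show "\<forall>c\<in>?C. \<forall>c'\<in>?C. c \<noteq> c' \<longrightarrow> F c \<inter> F c' = {}"
    proof (intro ballI impI)
      fix c c' assume c: "c \<in> ?C" "c' \<in> ?C" "c \<noteq> c'"
      show "F c \<inter> F c' = {}"
      proof (rule ccontr)
        assume "F c \<inter> F c' \<noteq> {}"
        then obtain w where "w \<in> F c" "w \<in> F c'" by blast
        then have eq: "c0 (unsigned w i) = c i" "c0 (unsigned w i) = c' i" if "i \<in> {1..int m}" for i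
          using that unfolding F_def by blast+
        have ext: "c \<in> {1..int m} \<rightarrow>\<^sub>E UNIV" "c' \<in> {1..int m} \<rightarrow>\<^sub>E UNIV" using c by (simp_all add: colourings_def)
        have "c = c'" by (rule PiE_ext[OF ext]) (use eq in simp)
        then show False using c(3) by simp
      qed
    qed
  qed
  also have "\<dots> = (\<Sum>c\<in>?C. card (colour_stabilizer m c))"
  proof (rule sum.cong[OF refl])
    fix c assume c: "c \<in> ?C"
    obtain u where u: "u \<in> ?G" "unsigned u = u" "\<And>i. i \<in> {1..int m} \<Longrightarrow> c0 (u i) = c i"
      by (rule colour_transport[OF assms c]) (rule that)
    let ?v = "inv_into UNIV u"
    note v = signed_perms_inv[OF u(1)] and i = signed_perms_inv_comp[OF u(1)]
    have comp: "unsigned (u \<circ> w) = u \<circ> unsigned w" if "w \<in> ?G" for w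
      using unsigned_comp[OF u(1) that] unfolding u(2) .
    have "bij_betw (\<lambda>w. u \<circ> w) (colour_stabilizer m c) (F c)"
    proof (rule bij_betw_byWitness[where f' = "\<lambda>w. ?v \<circ> w"])
      show "\<forall>w\<in>colour_stabilizer m c. ?v \<circ> (u \<circ> w) = w" unfolding comp_assoc[symmetric] i(1) by simp
      show "\<forall>w\<in>F c. u \<circ> (?v \<circ> w) = w" unfolding comp_assoc[symmetric] i(2) by simp
      show "(\<lambda>w. u \<circ> w) ` colour_stabilizer m c \<subseteq> F c"
      proof (rule image_subsetI)
        fix w assume w: "w \<in> colour_stabilizer m c"
        then have wG: "w \<in> ?G" by (simp add: colour_stabilizer_def)
        have "c0 (unsigned (u \<circ> w) k) = c k" if k: "k \<in> {1..int m}" for k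
          unfolding comp[OF wG] comp_apply u(3)[OF unsigned_mem[OF wG k]]
          using w k by (simp add: colour_stabilizer_def)
        then show "u \<circ> w \<in> F c" using signed_perms_comp[OF u(1) wG] by (simp add: F_def)
      qed
      show "(\<lambda>w. ?v \<circ> w) ` F c \<subseteq> colour_stabilizer m c"
      proof (rule image_subsetI)
        fix w assume w: "w \<in> F c"
        then have wG: "w \<in> ?G" by (simp add: F_def)
        note vw = signed_perms_comp[OF v wG]
        have "c (unsigned (?v \<circ> w) k) = c k" if k: "k \<in> {1..int m}" for k
        proof -
          have "c (unsigned (?v \<circ> w) k) = c0 (u (unsigned (?v \<circ> w) k))" using u(3)[OF unsigned_mem[OF vw k]] by simp
          also have "u (unsigned (?v \<circ> w) k) = unsigned (u \<circ> (?v \<circ> w)) k" unfolding comp[OF vw] by simp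
          also have "u \<circ> (?v \<circ> w) = w" unfolding comp_assoc[symmetric] i(2) by simp
          also have "c0 (unsigned w k) = c k" using w k by (simp add: F_def)
          finally show ?thesis .
        qed
        then show "?v \<circ> w \<in> colour_stabilizer m c" using vw by (simp add: colour_stabilizer_def)
      qed
    qed
    then show "card (F c) = card (colour_stabilizer m c)" by (simp add: bij_betw_same_card)
  qed
  finally show ?thesis by simp
qed

text \<open>Of all the subsets of size \<open>j\<close> only the set of \<open>y\<close>-coloured
  positions survives.\<close>

lemma sum_stabilizer_ext_power_char:
  fixes c :: "int \<Rightarrow> var" and m :: nat
  defines "Yc \<equiv> {i \<in> {1..int m}. \<not> is_X (c i)}"
  shows "(\<Sum>w\<in>colour_stabilizer m c. ext_power_char m j w * of_int (colour_sign {1..int m} c w))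
    = (if card Yc = j \<and> inj_on c Yc then of_nat (card (colour_stabilizer m c)) else 0)"
proof -
  let ?S = "colour_stabilizer m c" and ?J = "{I. I \<subseteq> {1..int m} \<and> card I = j}"
  let ?t = "\<lambda>w I. ext_sign w I * colour_sign {1..int m} c w"
  have finS: "finite ?S" using finite_signed_perms[of m] by (simp add: colour_stabilizer_def)
  have finJ: "finite ?J" by (rule finite_subset[of _ "Pow {1..int m}"]) auto
  have "(\<Sum>w\<in>?S. ext_power_char m j w * of_int (colour_sign {1..int m} c w))
      = of_int (\<Sum>w\<in>?S. \<Sum>I\<in>?J. if unsigned w ` I = I then ?t w I else 0)"
    unfolding of_int_sum[of _ ?S]
  proof (rule sum.cong[OF refl])
    fix w assume "w \<in> ?S"
    then have w: "w \<in> signed_perms m" by (simp add: colour_stabilizer_def)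
    have "{I. I \<subseteq> {1..int m} \<and> card I = j \<and> unsigned w ` I = I} = {I \<in> ?J. unsigned w ` I = I}" by blast
    then have "ext_power_char m j w * of_int (colour_sign {1..int m} c w) = of_int (\<Sum>I\<in>{I \<in> ?J. unsigned w ` I = I}. ?t w I)"
      using w by (simp add: ext_power_char_def sum_distrib_right)
    also have "(\<Sum>I\<in>{I \<in> ?J. unsigned w ` I = I}. ?t w I) = (\<Sum>I\<in>?J. if unsigned w ` I = I then ?t w I else 0)"
      by (rule sum.inter_filter[OF finJ])
    finally show "ext_power_char m j w * of_int (colour_sign {1..int m} c w) = of_int \<dots>" .
  qed
  also have "(\<Sum>w\<in>?S. \<Sum>I\<in>?J. if unsigned w ` I = I then ?t w I else 0)
      = (\<Sum>I\<in>?J. \<Sum>w\<in>?S. if unsigned w ` I = I then ?t w I else 0)"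
    by (rule sum.swap)
  also have "\<dots> = (\<Sum>I\<in>?J. if I = Yc then (if inj_on c Yc then int (card ?S) else 0) else 0)"
  proof (rule sum.cong[OF refl])
    fix I assume "I \<in> ?J"
    then have I: "I \<subseteq> {1..int m}" by blast
    have "(\<Sum>w\<in>?S. if unsigned w ` I = I then ?t w I else 0) = (\<Sum>w\<in>{w \<in> ?S. unsigned w ` I = I}. ?t w I)"
      by (rule sum.inter_filter[OF finS, symmetric])
    also have "\<dots> = (if I = Yc \<and> inj_on c I then int (card ?S) else 0)"
      unfolding Yc_def by (rule sum_stabilizer_ext_sign[OF I])
    finally show "(\<Sum>w\<in>?S. if unsigned w ` I = I then ?t w I else 0)
        = (if I = Yc then (if inj_on c Yc then int (card ?S) else 0) else 0)" by simp
  qed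
  also have "\<dots> = (if Yc \<in> ?J then (if inj_on c Yc then int (card ?S) else 0) else 0)"
    by (rule sum.delta[OF finJ])
  also have "Yc \<in> ?J \<longleftrightarrow> card Yc = j" by (auto simp: Yc_def)
  finally show ?thesis by simp
qed

text \<open>Whether a colouring contributes depends only on its content \<open>M\<close>. If it
  does, every colouring contributes the order of its stabilizer; these add up to the order of the
  group, which leaves the coefficient 1.\<close>

lemma ch_ext_power_char:
  assumes "k + j = m"
  shows "ch m (ext_power_char m j) = schur X [k] * schur Y (replicate j 1)"
proof (rule mseries_eqI)
  fix M
  let ?C = "colourings {1..int m} M"
  let ?q = "size (filter_mset (\<lambda>x. \<not> is_X x) M) = j \<and> y_squarefree M"
  have q: "card {i \<in> {1..int m}. \<not> is_X (c i)} = j \<and> inj_on c {i \<in> {1..int m}. \<not> is_X (c i)} \<longleftrightarrow> ?q"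
    if c: "c \<in> ?C" for c
  proof -
    let ?Y = "{i \<in> {1..int m}. \<not> is_X (c i)}"
    have M: "M = image_mset c (mset_set {1..int m})" using c by (simp add: colourings_def)
    have "size (filter_mset (\<lambda>x. \<not> is_X x) M) = card ?Y"
      unfolding M filter_mset_image_mset by simp
    moreover have "y_squarefree M \<longleftrightarrow> inj_on c ?Y"
    proof -
      have count: "count M x = card {i \<in> {1..int m}. c i = x}" for x
        unfolding M by (simp add: count_image_mset_eq_card_vimage)
      have fin: "finite {i \<in> {1..int m}. c i = x}" for x
        by (rule finite_subset[of _ "{1..int m}"]) auto
      have "y_squarefree M \<longleftrightarrow> (\<forall>a. \<forall>i\<in>{i \<in> {1..int m}. c i = Y a}. \<forall>k\<in>{i \<in> {1..int m}. c i = Y a}. i = k)"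
        unfolding y_squarefree_def count One_nat_def card_le_Suc0_iff_eq[OF fin] ..
      also have "\<dots> \<longleftrightarrow> inj_on c ?Y"
      proof
        assume L: "\<forall>a. \<forall>i\<in>{i \<in> {1..int m}. c i = Y a}. \<forall>k\<in>{i \<in> {1..int m}. c i = Y a}. i = k"
        show "inj_on c ?Y"
        proof (rule inj_onI)
          fix i k assume i: "i \<in> ?Y" "k \<in> ?Y" "c i = c k"
          obtain a where "c i = Y a" using i(1) by (cases "c i") simp_all
          then show "i = k" using L i by simp
        qed
      next
        assume "inj_on c ?Y"
        then show "\<forall>a. \<forall>i\<in>{i \<in> {1..int m}. c i = Y a}. \<forall>k\<in>{i \<in> {1..int m}. c i = Y a}. i = k"
          unfolding inj_on_def by simp
      qed
      finally show ?thesis .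
    qed
    ultimately show ?thesis by simp
  qed
  have "mcoeff (ch m (ext_power_char m j)) M
      = (\<Sum>c\<in>?C. if ?q then of_nat (card (colour_stabilizer m c)) else 0) / of_nat (card (signed_perms m))"
    unfolding mcoeff_ch_colourings sum_stabilizer_ext_power_char
    using q by (intro arg_cong2[of _ _ _ _ "(/)"] sum.cong refl) simp
  also have "\<dots> = (if ?q \<and> ?C \<noteq> {} then 1 else 0)"
  proof (cases "?q \<and> ?C \<noteq> {}")
    case True
    then obtain c0 where "c0 \<in> ?C" by blast
    have "card (signed_perms m) \<noteq> 0" by (simp add: card_signed_perms)
    then show ?thesis using True sum_card_colour_stabilizer[OF \<open>c0 \<in> ?C\<close>]
      by (simp add: of_nat_sum[symmetric] del: of_nat_sum)
  next
    case False
    then show ?thesis by auto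
  qed
  also have "?C \<noteq> {} \<longleftrightarrow> size M = m"
  proof
    assume "?C \<noteq> {}"
    then obtain c where "M = image_mset c (mset_set {1..int m})" by (auto simp: colourings_def)
    then show "size M = m" by simp
  next
    assume m: "size M = m"
    obtain xs where xs: "mset xs = M" using ex_mset by blast
    define c where "c = (\<lambda>i\<in>{1..int m}. xs ! nat (i - 1))"
    have "{1..int m} = (\<lambda>i. int i + 1) ` {0..<m}"
    proof (intro equalityI subsetI)
      fix x assume "x \<in> {1..int m}"
      then have "x = int (nat (x - 1)) + 1" "nat (x - 1) \<in> {0..<m}" by auto
      then show "x \<in> (\<lambda>i. int i + 1) ` {0..<m}" by (rule image_eqI)
    qed auto
    then have "mset_set {1..int m} = image_mset (\<lambda>i. int i + 1) (mset_set {0..<m})"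
      by (simp add: image_mset_mset_set inj_on_def)
    then have "image_mset c (mset_set {1..int m}) = image_mset (\<lambda>i. c (int i + 1)) (mset_set {0..<m})"
      by (simp add: image_mset.compositionality comp_def)
    also have "\<dots> = image_mset (\<lambda>i. xs ! i) (mset_set {0..<m})"
      by (rule image_mset_cong) (simp add: c_def)
    also have "\<dots> = mset (map (\<lambda>i. xs ! i) [0..<m])" by simp
    also have "map (\<lambda>i. xs ! i) [0..<m] = xs" using m xs by (metis map_nth size_mset)
    finally have "image_mset c (mset_set {1..int m}) = M" unfolding xs .
    moreover have "c \<in> {1..int m} \<rightarrow>\<^sub>E UNIV" by (simp add: c_def)
    ultimately have "c \<in> ?C" unfolding colourings_def by blast
    then show "?C \<noteq> {}" by blast
  qed
  also have "(if ?q \<and> size M = m then 1 else 0) = mcoeff (schur X [k] * schur Y (replicate j 1)) M"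
  proof -
    have "size M = size (filter_mset is_X M) + size (filter_mset (\<lambda>x. \<not> is_X x) M)"
      by (metis multiset_partition size_union)
    then show ?thesis unfolding schur_row_column_coeff using assms by auto
  qed
  finally show "mcoeff (ch m (ext_power_char m j)) M = mcoeff (schur X [k] * schur Y (replicate j 1)) M" .
qed

section \<open>The characteristic determines a class function\<close>

lemma funpow_mod_least_power:
  assumes "permutation p" shows "(p ^^ j) a = (p ^^ (j mod least_power p a)) a"
  by (rule funpow_mod_eq[OF least_power_of_permutation(1)[OF assms], symmetric])

text \<open>The conjugating element sends the \<open>k\<close>-th iterate of \<open>w\<close> at a
  base point of the cycle to the \<open>k\<close>-th iterate of \<open>v\<close> there. It is
  consistent because a full turn multiplies both sides by the same cycle sign.\<close>

lemma same_cycles_conjugate: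
  assumes w: "w \<in> signed_perms m" and v: "v \<in> signed_perms m"
    and P: "abs_cycles m w = abs_cycles m v"
    and sign: "\<And>b. b \<in> abs_cycles m w \<Longrightarrow> cycle_sign w b = cycle_sign v b"
  obtains u where "u \<in> signed_perms m" "u \<circ> w = v \<circ> u"
proof -
  let ?W = "unsigned w" and ?V = "unsigned v"
  note pW = unsigned_permutation[OF w] and pV = unsigned_permutation[OF v]
  define blk where "blk i = orbit ?W i" for i
  define a where "a i = Min (blk i)" for i
  have blkP: "blk i \<in> abs_cycles m w" if "i \<in> {1..int m}" for i
    using that unfolding blk_def abs_cycles_def by blast
  have self: "i \<in> blk i" if "i \<in> {1..int m}" for i unfolding blk_def using abs_cycle_mem[OF w that] .
  have a_mem: "a i \<in> blk i" if "i \<in> {1..int m}" for i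
    unfolding a_def using abs_cycle_subset(2,4)[OF w blkP[OF that]] by (rule Min_in)
  have a_m: "a i \<in> {1..int m}" if "i \<in> {1..int m}" for i
    using abs_cycle_subset(1)[OF w blkP[OF that]] a_mem[OF that] by blast
  have orbW: "orbit ?W (a i) = blk i" if "i \<in> {1..int m}" for i
    using abs_cycle_subset(5)[OF w blkP[OF that] a_mem[OF that]] by simp
  have orbV: "orbit ?V (a i) = blk i" if "i \<in> {1..int m}" for i
    using abs_cycle_subset(5)[OF v blkP[OF that, unfolded P] a_mem[OF that]] by simp
  define r where "r i = card (blk i)" for i
  have rW: "least_power ?W (a i) = r i" and rV: "least_power ?V (a i) = r i" if "i \<in> {1..int m}" for i
    using orbit_least_power(3)[OF pW, of "a i"] orbit_least_power(3)[OF pV, of "a i"]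
      orbW[OF that] orbV[OF that] by (simp_all add: r_def)
  \<comment> \<open>The number of steps of \<open>unsigned w\<close> from the base point, the
    minimum of the cycle, to \<open>i\<close>.\<close>
  define k where "k i = inv_into {..<r i} (\<lambda>t. (?W ^^ t) (a i)) i" for i
  have injW: "inj_on (\<lambda>t. (?W ^^ t) (a i)) {..<r i}" and injV: "inj_on (\<lambda>t. (?V ^^ t) (a i)) {..<r i}"
    and imW: "(\<lambda>t. (?W ^^ t) (a i)) ` {..<r i} = blk i" if "i \<in> {1..int m}" for i
    using orbit_least_power(1,2)[OF pW, of "a i"] orbit_least_power(1)[OF pV, of "a i"]
    unfolding rW[OF that] rV[OF that] orbW[OF that] by blast+
  have k: "k i < r i" "(?W ^^ k i) (a i) = i" if "i \<in> {1..int m}" for i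
    using inv_into_into[of i "\<lambda>t. (?W ^^ t) (a i)" "{..<r i}"] f_inv_into_f[of i "\<lambda>t. (?W ^^ t) (a i)" "{..<r i}"]
      self[OF that] unfolding imW[OF that] k_def by simp_all
  \<comment> \<open>The iterate of \<open>w\<close> is \<open>i\<close> or \<open>- i\<close>; its
    sign moves to the other side, so that the value is prescribed at \<open>i\<close>
    itself.\<close>
  define g where "g i = sgn ((w ^^ k i) (a i)) * (v ^^ k i) (a i)" for i
  have absw: "\<bar>(w ^^ k i) (a i)\<bar> = i" if "i \<in> {1..int m}" for i
    using abs_funpow[OF w a_m[OF that]] k(2)[OF that] by simp
  have wk: "(w ^^ k i) (a i) = sgn ((w ^^ k i) (a i)) * i" if "i \<in> {1..int m}" for i
    using absw[OF that] by (metis sgn_mult_abs)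
  have sg: "sgn ((w ^^ k i) (a i)) = 1 \<or> sgn ((w ^^ k i) (a i)) = - 1" if "i \<in> {1..int m}" for i
    using absw[OF that] that by (auto simp: sgn_if)
  have absg: "\<bar>g i\<bar> = (?V ^^ k i) (a i)" if "i \<in> {1..int m}" for i
    using abs_funpow[OF v a_m[OF that], of "k i"] sg[OF that] by (auto simp: g_def)
  define u where "u = odd_extension m g"
  have u: "u \<in> signed_perms m"
    unfolding u_def
  proof (rule odd_extension_signed_perm)
    show "\<bar>g i\<bar> \<in> {1..int m}" if "i \<in> {1..int m}" for i
      unfolding absg[OF that] by (rule unsigned_funpow_mem[OF v a_m[OF that]])
    show "inj_on (\<lambda>i. \<bar>g i\<bar>) {1..int m}"
    proof (rule inj_onI)
      fix i j assume ij: "i \<in> {1..int m}" "j \<in> {1..int m}" "\<bar>g i\<bar> = \<bar>g j\<bar>"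
      then have e: "(?V ^^ k i) (a i) = (?V ^^ k j) (a j)" using absg by simp
      have "(?V ^^ k i) (a i) \<in> blk i" "(?V ^^ k j) (a j) \<in> blk j"
        unfolding orbV[OF ij(1), symmetric] orbV[OF ij(2), symmetric] orbit_eq_range[OF pV] by blast+
      then have bb: "blk i = blk j" using e abs_cycles_disjoint[OF w blkP[OF ij(1)] blkP[OF ij(2)]] by auto
      then have aa: "a i = a j" "r i = r j" by (simp_all add: a_def r_def)
      have kk: "k i = k j"
        using inj_onD[OF injV[OF ij(1)], of "k i" "k j"] e k(1)[OF ij(1)] k(1)[OF ij(2)] aa by simp
      have "i = (?W ^^ k i) (a i)" by (rule k(2)[OF ij(1), symmetric])
      also have "\<dots> = (?W ^^ k j) (a j)" unfolding kk aa(1) ..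
      also have "\<dots> = j" by (rule k(2)[OF ij(2)])
      finally show "i = j" .
    qed
  qed
  have ug: "u i = g i" if "i \<in> {1..int m}" for i unfolding u_def odd_extension_eq[OF that] ..
  \<comment> \<open>By definition this holds for less than one turn. For general \<open>j\<close>
    the \<open>q\<close> full turns give the factor \<open>d ^ q\<close> on both sides, where
    \<open>d\<close> is the common cycle sign.\<close>
  have key: "u ((w ^^ j) (a i)) = (v ^^ j) (a i)" if i: "i \<in> {1..int m}" for i j
  proof -
    let ?x = "(w ^^ j) (a i)"
    define h where "h = (?W ^^ j) (a i)"
    have hx: "\<bar>?x\<bar> = h" unfolding h_def by (rule abs_funpow[OF w a_m[OF i]])
    have hm: "h \<in> {1..int m}" unfolding h_def by (rule unsigned_funpow_mem[OF w a_m[OF i]])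
    have "h \<in> blk i" unfolding h_def orbW[OF i, symmetric] orbit_eq_range[OF pW] by blast
    then have bh: "blk h = blk i" unfolding blk_def using orbit_eq_of_mem[OF pW] by blast
    then have ah: "a h = a i" "r h = r i" by (simp_all add: a_def r_def)
    have r0: "r i > 0" using k(1)[OF i] by simp
    have "(?W ^^ k h) (a i) = h" using k(2)[OF hm] unfolding ah(1) .
    also have "h = (?W ^^ (j mod r i)) (a i)"
      unfolding h_def using funpow_mod_least_power[OF pW, of j "a i"] unfolding rW[OF i] .
    finally have "(?W ^^ k h) (a i) = (?W ^^ (j mod r i)) (a i)" .
    then have kh: "k h = j mod r i"
      using inj_onD[OF injW[OF i], of "k h" "j mod r i"] k(1)[OF hm] ah r0 by simp
    define q where "q = j div r i"
    have j: "j = k h + q * r i" unfolding kh q_def by simp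
    have b: "blk i \<in> abs_cycles m w" by (rule blkP[OF i])
    define d where "d = cycle_sign w (blk i)"
    have d: "d = cycle_sign v (blk i)" unfolding d_def by (rule sign[OF b])
    have xw: "?x = d ^ q * (w ^^ k h) (a i)"
      using signed_perm_funpow_mult[OF w a_m[OF i], of "k h" q] unfolding orbW[OF i] r_def[symmetric] j[symmetric] d_def[symmetric] .
    have xv: "(v ^^ j) (a i) = d ^ q * (v ^^ k h) (a i)"
      using signed_perm_funpow_mult[OF v a_m[OF i], of "k h" q] unfolding orbV[OF i] r_def[symmetric] j[symmetric] d[symmetric] .
    have "d = 1 \<or> d = - 1" unfolding d_def using cycle_sign_cases[OF w abs_cycle_subset(1)[OF w b]] .
    then have dq: "d ^ q = 1 \<or> d ^ q = - 1" by (metis minus_one_power_iff power_one)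
    have "u ?x = sgn ?x * g h" using signed_perms_sgn_abs[OF u, of ?x] ug[OF hm] hx by simp
    also have "\<dots> = d ^ q * (v ^^ k h) (a i)"
    proof -
      have "sgn ?x = d ^ q * sgn ((w ^^ k h) (a i))" using xw dq by (auto simp: sgn_minus)
      moreover have "sgn ((w ^^ k h) (a i)) * sgn ((w ^^ k h) (a i)) = 1" using sg[OF hm] unfolding ah(1) by auto
      ultimately show ?thesis unfolding g_def ah(1) by (metis mult.assoc mult.right_neutral)
    qed
    finally show ?thesis using xv by simp
  qed
  have "u \<circ> w = v \<circ> u"
  proof (rule signed_perms_eqI[OF signed_perms_comp[OF u w] signed_perms_comp[OF v u]])
    fix i assume i: "i \<in> {1..int m}"
    define s where "s = sgn ((w ^^ k i) (a i))"
    have s: "s = 1 \<or> s = - 1" unfolding s_def by (rule sg[OF i])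
    have ii: "i = s * (w ^^ k i) (a i)" using wk[OF i] s unfolding s_def[symmetric] by auto
    have lin: "f (s * x) = s * f x" if "f \<in> signed_perms m" for f x using s signed_permsD(2)[OF that] by auto
    have "u (w i) = u (w (s * (w ^^ k i) (a i)))" using ii by simp
    also have "\<dots> = s * u ((w ^^ Suc (k i)) (a i))" by (simp add: lin[OF w] lin[OF u])
    also have "\<dots> = s * v ((v ^^ k i) (a i))" unfolding key[OF i] by simp
    also have "\<dots> = v (s * (v ^^ k i) (a i))" by (simp add: lin[OF v])
    also have "s * (v ^^ k i) (a i) = u i" unfolding ug[OF i] g_def s_def ..
    finally show "(u \<circ> w) i = (v \<circ> u) i" by simp
  qed
  then show ?thesis using that u by blast
qed

section \<open>Class functions with vanishing characteristic\<close>

lemma colour_conjugation: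
  assumes u: "u \<in> signed_perms m" "unsigned u = u" "\<And>i. i \<in> {1..int m} \<Longrightarrow> c (u i) = c' i"
    and v: "v \<in> colour_stabilizer m c'"
  shows "u \<circ> v \<circ> inv_into UNIV u \<in> colour_stabilizer m c"
    "colour_sign {1..int m} c (u \<circ> v \<circ> inv_into UNIV u) = colour_sign {1..int m} c' v"
proof -
  let ?i = "inv_into UNIV u"
  have vG: "v \<in> signed_perms m" using v by (simp add: colour_stabilizer_def)
  note i = signed_perms_inv[OF u(1)] and ic = signed_perms_inv_comp[OF u(1)]
  have iu: "?i (u x) = x" for x using fun_cong[OF ic(1), of x] by simp
  have uw: "u \<circ> v \<in> signed_perms m" by (rule signed_perms_comp[OF u(1) vG])
  have G: "u \<circ> v \<circ> ?i \<in> signed_perms m" by (rule signed_perms_comp[OF uw i])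
  have ui: "unsigned ?i (u x) = x" for x
  proof -
    have "unsigned ?i \<circ> u = id" using unsigned_comp[OF i u(1)] unfolding u(2) ic(1) unsigned_id by simp
    then show ?thesis by (metis comp_apply id_apply)
  qed
  have uim: "u ` {1..int m} = {1..int m}" using unsigned_permutes_image[OF u(1)] unfolding u(2) .
  have "c (unsigned (u \<circ> v \<circ> ?i) k) = c k" if k: "k \<in> {1..int m}" for k
  proof -
    have "k \<in> u ` {1..int m}" unfolding uim by (rule k)
    then obtain x where x: "x \<in> {1..int m}" "k = u x" by blast
    have "unsigned (u \<circ> v \<circ> ?i) k = u (unsigned v x)"
      unfolding unsigned_comp[OF uw i] unsigned_comp[OF u(1) vG] x(2) comp_apply ui u(2) ..
    also have "c \<dots> = c' (unsigned v x)" by (rule u(3)[OF unsigned_mem[OF vG x(1)]])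
    also have "\<dots> = c' x" using v x(1) by (simp add: colour_stabilizer_def)
    also have "\<dots> = c k" unfolding x(2) by (rule u(3)[OF x(1), symmetric])
    finally show ?thesis .
  qed
  then show "u \<circ> v \<circ> ?i \<in> colour_stabilizer m c" using G by (simp add: colour_stabilizer_def)
  have inj: "inj_on u {1..int m}" using signed_permsD(4)[OF u(1)] inj_on_subset by blast
  have sgnu: "sgn (u x) = sgn x" for x
  proof -
    have "u x = sgn x * \<bar>u x\<bar>" using fun_cong[OF u(2), of x] by (simp add: unsigned_def)
    then have "sgn (u x) = sgn x * sgn \<bar>u x\<bar>" by (metis sgn_mult sgn_sgn)
    then show ?thesis using signed_perms_eq_0_iff[OF u(1), of x] by (cases "x = 0") simp_all
  qed
  have "colour_sign {1..int m} c (u \<circ> v \<circ> ?i)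
      = (\<Prod>k\<in>u ` {1..int m}. if is_X (c k) then 1 else sgn ((u \<circ> v \<circ> ?i) k))"
    unfolding colour_sign_def uim ..
  also have "\<dots> = (\<Prod>x\<in>{1..int m}. if is_X (c (u x)) then 1 else sgn ((u \<circ> v \<circ> ?i) (u x)))"
    by (simp add: prod.reindex[OF inj])
  also have "\<dots> = colour_sign {1..int m} c' v"
    unfolding colour_sign_def using u(3) by (intro prod.cong refl) (simp add: iu sgnu)
  finally show "colour_sign {1..int m} c (u \<circ> v \<circ> ?i) = colour_sign {1..int m} c' v" .
qed

text \<open>A coefficient of \<open>ch m f\<close> only controls the sum over all colourings of the
  same content. These are related by permutations, under which the stabilizers are conjugate and the
  signs correspond, so all summands are equal and each one is zero.\<close>

lemma colour_sum_eq_0: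
  assumes cl: "\<And>u h. u \<in> signed_perms m \<Longrightarrow> h \<in> signed_perms m \<Longrightarrow> f (u \<circ> h \<circ> inv_into UNIV u) = f h"
    and ch: "ch m f = 0" and c: "c \<in> {1..int m} \<rightarrow>\<^sub>E UNIV"
  shows "(\<Sum>w\<in>colour_stabilizer m c. f w * of_int (colour_sign {1..int m} c w)) = 0"
proof -
  define M where "M = image_mset c (mset_set {1..int m})"
  let ?C = "colourings {1..int m} M"
  let ?s = "\<lambda>c. \<Sum>w\<in>colour_stabilizer m c. f w * of_int (colour_sign {1..int m} c w)"
  have cC: "c \<in> ?C" using c by (simp add: colourings_def M_def)
  have "?s c' = ?s c" if c': "c' \<in> ?C" for c'
  proof -
    obtain u where u: "u \<in> signed_perms m" "unsigned u = u" "\<And>i. i \<in> {1..int m} \<Longrightarrow> c (u i) = c' i"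
      by (rule colour_transport[OF cC c']) (rule that)
    let ?i = "inv_into UNIV u"
    note i = signed_perms_inv[OF u(1)] and ic = signed_perms_inv_comp[OF u(1)]
    have ii: "inv_into UNIV ?i = u" using permutes_inv_inv[OF signed_permsD(1)[OF u(1)]] .
    have ui: "unsigned ?i = ?i"
    proof -
      have "unsigned ?i \<circ> u = id" using unsigned_comp[OF i u(1)] unfolding u(2) ic(1) unsigned_id by simp
      then show ?thesis using ic by (metis comp_assoc comp_id id_comp)
    qed
    have u3: "c' (?i k) = c k" if "k \<in> {1..int m}" for k
    proof -
      have "?i k \<in> {1..int m}" using unsigned_mem[OF i that] unfolding ui .
      then have "c' (?i k) = c (u (?i k))" using u(3) by simp
      also have "u (?i k) = k" using fun_cong[OF ic(2), of k] by simp
      finally show ?thesis .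
    qed
    show ?thesis
    proof (rule sum.reindex_bij_witness[of _ "\<lambda>w. ?i \<circ> w \<circ> u" "\<lambda>v. u \<circ> v \<circ> ?i"])
      fix v assume v: "v \<in> colour_stabilizer m c'"
      show "?i \<circ> (u \<circ> v \<circ> ?i) \<circ> u = v" using ic by (metis comp_assoc comp_id id_comp)
      show "u \<circ> v \<circ> ?i \<in> colour_stabilizer m c" by (rule colour_conjugation(1)[OF u v])
      have "v \<in> signed_perms m" using v by (simp add: colour_stabilizer_def)
      from cl[OF u(1) this] colour_conjugation(2)[OF u v]
      show "f (u \<circ> v \<circ> ?i) * of_int (colour_sign {1..int m} c (u \<circ> v \<circ> ?i)) = f v * of_int (colour_sign {1..int m} c' v)"
        by (simp only:)
    next
      fix w assume w: "w \<in> colour_stabilizer m c"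
      show "u \<circ> (?i \<circ> w \<circ> u) \<circ> ?i = w" using ic by (metis comp_assoc comp_id id_comp)
      show "?i \<circ> w \<circ> u \<in> colour_stabilizer m c'"
        using colour_conjugation(1)[OF i ui u3 w] unfolding ii .
    qed
  qed
  then have "(\<Sum>c'\<in>?C. ?s c') = of_nat (card ?C) * ?s c" by simp
  moreover have "(\<Sum>c'\<in>?C. ?s c') = 0"
  proof -
    have "mcoeff (ch m f) M = 0" unfolding ch by (rule mcoeff_0)
    moreover have "card (signed_perms m) \<noteq> 0" by (simp add: card_signed_perms)
    ultimately show ?thesis unfolding mcoeff_ch_colourings by simp
  qed
  moreover have "card ?C \<noteq> 0" using cC finite_colourings[of "{1..int m}" M] by auto
  ultimately show ?thesis by simp
qed

text \<open>The hypothesis \<open>ref\<close> says that each cycle of \<open>w\<close> lies in a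
  cycle of \<open>v\<close>. The map to the containing cycle is onto, so if \<open>w\<close> has at
  most as many cycles it is also injective, and the cycles coincide.\<close>

lemma abs_cycles_refine_eq:
  assumes w: "w \<in> signed_perms m" and v: "v \<in> signed_perms m"
    and ref: "\<And>i. i \<in> {1..int m} \<Longrightarrow> orbit (unsigned v) (unsigned w i) = orbit (unsigned v) i"
    and card: "card (abs_cycles m w) \<le> card (abs_cycles m v)"
  shows "abs_cycles m w = abs_cycles m v"
proof -
  let ?A = "abs_cycles m w" and ?B = "abs_cycles m v"
  have sub: "orbit (unsigned v) y = orbit (unsigned v) x \<and> y \<in> {1..int m}"
    if x: "x \<in> {1..int m}" and y: "y \<in> orbit (unsigned w) x" for x y
    using y
    by (induction rule: orbit.induct)
      (use x ref unsigned_mem[OF w] in \<open>simp_all del: atLeastAtMost_iff\<close>)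
  define h where "h b = orbit (unsigned v) (Min b)" for b
  have hb: "h (orbit (unsigned w) x) = orbit (unsigned v) x" if x: "x \<in> {1..int m}" for x
  proof -
    have "orbit (unsigned w) x \<in> ?A" using x unfolding abs_cycles_def by blast
    then have "Min (orbit (unsigned w) x) \<in> orbit (unsigned w) x"
      using abs_cycle_subset(2,4)[OF w] by (intro Min_in)
    then show ?thesis unfolding h_def using sub[OF x] by blast
  qed
  have him: "h ` ?A = ?B"
  proof -
    have "h ` ?A = (\<lambda>x. h (orbit (unsigned w) x)) ` {1..int m}" by (simp add: abs_cycles_def image_image)
    also have "\<dots> = (\<lambda>x. orbit (unsigned v) x) ` {1..int m}" by (intro image_cong refl hb)
    finally show ?thesis by (simp add: abs_cycles_def)
  qed
  have "card ?A = card (h ` ?A)" using card him card_image_le[OF finite_abs_cycles[of m w], of h] by simp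
  then have inj: "inj_on h ?A" by (intro eq_card_imp_inj_on finite_abs_cycles) simp
  have eq: "orbit (unsigned w) x = orbit (unsigned v) x" if x: "x \<in> {1..int m}" for x
  proof (intro equalityI subsetI)
    fix y assume "y \<in> orbit (unsigned w) x"
    then have y: "orbit (unsigned v) y = orbit (unsigned v) x" "y \<in> {1..int m}" using sub[OF x] by blast+
    then show "y \<in> orbit (unsigned v) x" using abs_cycle_mem[OF v y(2)] by simp
  next
    fix y assume y: "y \<in> orbit (unsigned v) x"
    have "orbit (unsigned v) x \<in> ?B" using x unfolding abs_cycles_def by blast
    then have ym: "y \<in> {1..int m}" using abs_cycle_subset(1)[OF v] y by blast
    have "orbit (unsigned v) y = orbit (unsigned v) x" by (rule orbit_eq_of_mem[OF unsigned_permutation[OF v] y])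
    then have "h (orbit (unsigned w) y) = h (orbit (unsigned w) x)" using hb x ym by simp
    moreover have "orbit (unsigned w) y \<in> ?A" "orbit (unsigned w) x \<in> ?A"
      using x ym unfolding abs_cycles_def by blast+
    ultimately have "orbit (unsigned w) y = orbit (unsigned w) x" using inj_onD[OF inj] by blast
    then show "y \<in> orbit (unsigned w) x" using abs_cycle_mem[OF w ym] by simp
  qed
  show ?thesis unfolding abs_cycles_def by (rule image_cong[OF refl eq])
qed

text \<open>Colour the cycles of \<open>v\<close> by different variables, each cycle by an \<open>x\<close> or a \<open>y\<close>. Summing the
  resulting equations over the \<open>x\<close>-\<open>y\<close>-choices with suitable signs isolates those \<open>w\<close> whose cycles
  refine the cycles of \<open>v\<close> and have the same signs on them; all of them but the conjugates of \<open>v\<close>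
  have more cycles than \<open>v\<close>.\<close>

lemma ch_eq_0_imp_eq_0:
  assumes cl: "\<And>u h. u \<in> signed_perms m \<Longrightarrow> h \<in> signed_perms m \<Longrightarrow> f (u \<circ> h \<circ> inv_into UNIV u) = f h"
    and ch: "ch m f = 0" and "v \<in> signed_perms m"
  shows "f v = 0"
  using assms(3)
\<comment> \<open>Elements with more cycles come first, so that the properly finer ones are already
  known to have value zero.\<close>
proof (induction "m - card (abs_cycles m v)" arbitrary: v rule: less_induct)
  case less
  note v = less.prems
  let ?P = "abs_cycles m v" and ?m = "{1..int m}"
  have card_le: "card (abs_cycles m w) \<le> m" for w
    using card_image_le[of ?m "orbit (unsigned w)"] by (simp add: abs_cycles_def)
  define blk where "blk i = orbit (unsigned v) i" for i
  define ix where "ix i = nat (Min (blk i))" for i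
  have blkP: "blk i \<in> ?P" if "i \<in> ?m" for i using that unfolding blk_def abs_cycles_def by blast
  have blkb: "blk i = b" if "b \<in> ?P" "i \<in> b" for b i
    unfolding blk_def using abs_cycle_subset(5)[OF v that] by simp
  have self: "i \<in> blk i" if "i \<in> ?m" for i unfolding blk_def by (rule abs_cycle_mem[OF v that])
  have mi: "Min (blk i) \<in> blk i" "Min (blk i) \<in> ?m" if i: "i \<in> ?m" for i
  proof -
    note sub = abs_cycle_subset[OF v blkP[OF i]]
    show "Min (blk i) \<in> blk i" using sub(2,4) by (rule Min_in)
    then show "Min (blk i) \<in> ?m" using sub(1) by (rule set_mp[rotated])
  qed
  have ix: "ix i = ix j \<longleftrightarrow> blk i = blk j" if i: "i \<in> ?m" and j: "j \<in> ?m" for i j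
  proof
    assume "ix i = ix j"
    then have eq: "Min (blk i) = Min (blk j)" using mi(2)[OF i] mi(2)[OF j] by (simp add: ix_def nat_eq_iff)
    have "blk i = blk (Min (blk i))" by (rule blkb[OF blkP[OF i] mi(1)[OF i], symmetric])
    also have "\<dots> = blk j" unfolding eq by (rule blkb[OF blkP[OF j] mi(1)[OF j]])
    finally show "blk i = blk j" .
  qed (simp add: ix_def)
  \<comment> \<open>\<open>T\<close> is the set of cycles coloured by a \<open>y\<close>. The index
    \<open>ix\<close> alone tells the cycles apart, hence the stabilizer \<open>S\<close> is the
    same for all \<open>T\<close> and only the signs vary.\<close>
  define c where "c T = (\<lambda>i\<in>?m. if blk i \<in> T then Y (ix i) else X (ix i))" for T
  define S where "S = {w \<in> signed_perms m. \<forall>i\<in>?m. blk (unsigned w i) = blk i}"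
  have finS: "finite S" unfolding S_def using finite_signed_perms[of m] by simp
  have vS: "v \<in> S"
    unfolding S_def blk_def
    using v orbit_eq_of_mem[OF unsigned_permutation[OF v] orbit.base] by (intro CollectI conjI ballI)
  have cc: "c T i = c T j \<longleftrightarrow> blk i = blk j" if "i \<in> ?m" "j \<in> ?m" for T i j
    using ix[OF that] that by (auto simp: c_def)
  have stab: "colour_stabilizer m (c T) = S" for T
    unfolding colour_stabilizer_def S_def
  proof (rule Collect_cong)
    fix w show "(w \<in> signed_perms m \<and> (\<forall>i\<in>?m. c T (unsigned w i) = c T i))
      \<longleftrightarrow> (w \<in> signed_perms m \<and> (\<forall>i\<in>?m. blk (unsigned w i) = blk i))"
    proof (rule conj_cong[OF refl], rule ball_cong[OF refl])
      fix i assume "w \<in> signed_perms m" and i: "i \<in> ?m"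
      then show "c T (unsigned w i) = c T i \<longleftrightarrow> blk (unsigned w i) = blk i"
        by (intro cc unsigned_mem)
    qed
  qed
  have csign: "colour_sign ?m (c T) w = (\<Prod>b\<in>T. cycle_sign w b)" if T: "T \<subseteq> ?P" for T w
  proof -
    have "{i \<in> ?m. \<not> is_X (c T i)} = \<Union>T"
    proof (intro equalityI subsetI)
      fix i assume i: "i \<in> {i \<in> ?m. \<not> is_X (c T i)}"
      then have "blk i \<in> T" by (simp add: c_def split: if_splits)
      then show "i \<in> \<Union>T" using self i by blast
    next
      fix i assume "i \<in> \<Union>T"
      then obtain b where b: "b \<in> T" "i \<in> b" by blast
      then have "i \<in> ?m" "blk i = b" using abs_cycle_subset(1)[OF v] blkb T by blast+
      then show "i \<in> {i \<in> ?m. \<not> is_X (c T i)}" using b(1) by (simp add: c_def)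
    qed
    then have "colour_sign ?m (c T) w = (\<Prod>i\<in>\<Union>T. sgn (w i))" by (simp add: colour_sign_eq_prod)
    also have "\<dots> = (\<Prod>b\<in>T. \<Prod>i\<in>b. sgn (w i))"
      using prod.Union_disjoint[of T "\<lambda>i. sgn (w i)"] abs_cycle_subset(2)[OF v] abs_cycles_disjoint[OF v] T
      by (simp add: subset_iff)
    finally show ?thesis by (simp add: cycle_sign_def)
  qed
  define d where "d w b = complex_of_int (cycle_sign w b)" for w b
  have dcases: "d w b = 1 \<or> d w b = - 1" if "w \<in> signed_perms m" "b \<in> ?P" for w b
    using cycle_sign_cases[OF that(1) abs_cycle_subset(1)[OF v that(2)]] by (auto simp: d_def)
  have eqT: "(\<Sum>w\<in>S. f w * (\<Prod>b\<in>T. d w b)) = 0" if T: "T \<subseteq> ?P" for T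
  proof -
    have "c T \<in> ?m \<rightarrow>\<^sub>E UNIV" by (simp add: c_def)
    from colour_sum_eq_0[OF cl ch this] show ?thesis
      unfolding stab csign[OF T] by (simp add: d_def)
  qed
  define S' where "S' = {w \<in> S. \<forall>b\<in>?P. d w b = d v b}"
  \<comment> \<open>The equation for \<open>T\<close> is weighted by the signs of \<open>v\<close>
    on \<open>T\<close>. Summed over \<open>T\<close>, the element \<open>w\<close> gets the product
    of \<open>d v b * d w b + 1\<close> over the cycles, which is a power of 2 if all signs agree
    and zero otherwise.\<close>
  have "0 = (\<Sum>T\<in>Pow ?P. (\<Prod>b\<in>T. d v b) * (\<Sum>w\<in>S. f w * (\<Prod>b\<in>T. d w b)))"
    using eqT by (intro sum.neutral[symmetric]) simp
  also have "\<dots> = (\<Sum>T\<in>Pow ?P. \<Sum>w\<in>S. f w * (\<Prod>b\<in>T. d v b * d w b))"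
    by (simp add: sum_distrib_left prod.distrib mult_ac)
  also have "\<dots> = (\<Sum>w\<in>S. \<Sum>T\<in>Pow ?P. f w * (\<Prod>b\<in>T. d v b * d w b))" by (rule sum.swap)
  also have "\<dots> = (\<Sum>w\<in>S. f w * (\<Prod>b\<in>?P. d v b * d w b + 1))"
    by (simp add: prod_add[OF finite_abs_cycles] sum_distrib_left)
  also have "\<dots> = (\<Sum>w\<in>S. if \<forall>b\<in>?P. d w b = d v b then f w * 2 ^ card ?P else 0)"
  proof (rule sum.cong[OF refl])
    fix w assume "w \<in> S"
    then have w: "w \<in> signed_perms m" by (simp add: S_def)
    show "f w * (\<Prod>b\<in>?P. d v b * d w b + 1) = (if \<forall>b\<in>?P. d w b = d v b then f w * 2 ^ card ?P else 0)"
    proof (cases "\<forall>b\<in>?P. d w b = d v b")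
      case True
      have "(\<Prod>b\<in>?P. d v b * d w b + 1) = (\<Prod>b\<in>?P. 2)"
        using True dcases[OF v] by (intro prod.cong refl) fastforce
      then show ?thesis using True by simp
    next
      case False
      then obtain b where b: "b \<in> ?P" "d w b \<noteq> d v b" by blast
      then have "d v b * d w b + 1 = 0" using dcases[OF v b(1)] dcases[OF w b(1)] by auto
      then have "(\<Prod>b\<in>?P. d v b * d w b + 1) = 0" using b(1) finite_abs_cycles[of m v] by (intro prod_zero) blast+
      then show ?thesis unfolding if_not_P[OF False] by simp
    qed
  qed
  also have "\<dots> = (\<Sum>w\<in>S'. f w * 2 ^ card ?P)"
    unfolding S'_def by (rule sum.inter_filter[OF finS, symmetric])
  also have "\<dots> = (\<Sum>w\<in>{w \<in> S'. abs_cycles m w = ?P}. f w * 2 ^ card ?P)"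
  proof (rule sum.mono_neutral_right)
    show "finite S'" unfolding S'_def using finS by simp
    show "\<forall>w\<in>S' - {w \<in> S'. abs_cycles m w = ?P}. f w * 2 ^ card ?P = 0"
    proof
      fix w assume w: "w \<in> S' - {w \<in> S'. abs_cycles m w = ?P}"
      then have wG: "w \<in> signed_perms m" and ref: "\<And>i. i \<in> ?m \<Longrightarrow> blk (unsigned w i) = blk i"
        and ne: "abs_cycles m w \<noteq> ?P" by (auto simp: S'_def S_def)
      have "card ?P < card (abs_cycles m w)"
        using abs_cycles_refine_eq[OF wG v ref[unfolded blk_def]] ne by fastforce
      then have "m - card (abs_cycles m w) < m - card ?P" using card_le[of w] by simp
      then have "f w = 0" using less.hyps wG by blast
      then show "f w * 2 ^ card ?P = 0" by simp
    qed
  qed auto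
  also have "\<dots> = (\<Sum>w\<in>{w \<in> S'. abs_cycles m w = ?P}. f v * 2 ^ card ?P)"
  proof (rule sum.cong[OF refl])
    fix w assume w: "w \<in> {w \<in> S'. abs_cycles m w = ?P}"
    then have wG: "w \<in> signed_perms m" and P: "abs_cycles m w = ?P" by (simp_all add: S'_def S_def)
    have sg: "cycle_sign w b = cycle_sign v b" if "b \<in> abs_cycles m w" for b
    proof -
      have "d w b = d v b" using w that P by (simp add: S'_def)
      then show ?thesis by (simp add: d_def)
    qed
    obtain u where u: "u \<in> signed_perms m" "u \<circ> w = v \<circ> u"
      by (rule same_cycles_conjugate[OF wG v P sg]) (assumption, rule that)
    have "u \<circ> w \<circ> inv_into UNIV u = v"
      unfolding u(2) comp_assoc signed_perms_inv_comp(2)[OF u(1)] by simp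
    then have "f v = f w" using cl[OF u(1) wG] by simp
    then show "f w * 2 ^ card ?P = f v * 2 ^ card ?P" by simp
  qed
  also have "\<dots> = of_nat (card {w \<in> S'. abs_cycles m w = ?P}) * (f v * 2 ^ card ?P)" by (rule sum_constant)
  finally have "of_nat (card {w \<in> S'. abs_cycles m w = ?P}) * (f v * 2 ^ card ?P) = 0" by simp
  moreover have "card {w \<in> S'. abs_cycles m w = ?P} \<noteq> 0"
  proof -
    have "v \<in> {w \<in> S'. abs_cycles m w = ?P}" using vS by (simp add: S'_def)
    moreover have "finite {w \<in> S'. abs_cycles m w = ?P}" using finS by (simp add: S'_def)
    ultimately show ?thesis by auto
  qed
  ultimately show ?case by simp
qed

section \<open>The exterior powers are irreducible\<close>

lemma ext_sign_id:
  assumes "I \<subseteq> {1..int m}" shows "ext_sign id I = 1"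
proof -
  have "finite I" using assms finite_subset by blast
  moreover have "(\<Prod>i\<in>I. sgn i) = 1" using assms by (intro prod.neutral) auto
  ultimately show ?thesis by (simp add: ext_sign_def unsigned_id inv_sign_id)
qed

lemma ext_sign_nonzero:
  assumes "w \<in> signed_perms m" "I \<subseteq> {1..int m}" shows "ext_sign w I \<noteq> 0"
proof
  assume "ext_sign w I = 0"
  then have "ext_sign (inv_into UNIV w \<circ> w) I = 0"
    using ext_sign_comp[OF signed_perms_inv[OF assms(1)] assms] by simp
  then show False using signed_perms_inv_comp(1)[OF assms(1)] ext_sign_id[OF assms(2)] by simp
qed

lemma signed_perms_subset_transitive:
  assumes "A \<subseteq> {1..int m}" "B \<subseteq> {1..int m}" "card A = card B"
  obtains u where "u \<in> signed_perms m" "unsigned u ` A = B"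
proof -
  let ?m = "{1..int m}"
  \<comment> \<open>A subset is encoded as a colouring with two colours, so that transitivity on
    colourings of equal content gives transitivity on subsets of equal size.\<close>
  define c where "c E = (\<lambda>i\<in>?m. if i \<in> E then X 0 else X 1)" for E
  define M where "M = replicate_mset (card A) (X 0) + replicate_mset (m - card A) (X 1)"
  have c: "c E \<in> colourings ?m M" if E: "E \<subseteq> ?m" "card E = card A" for E
  proof -
    have fin: "finite E" using E(1) finite_subset by blast
    have "mset_set ?m = mset_set E + mset_set (?m - E)"
      using mset_set_Union[of E "?m - E"] fin E(1) by (simp add: Un_absorb1)
    moreover have "image_mset (c E) (mset_set E) = replicate_mset (card E) (X 0)"
      using E(1) by (intro image_mset_const_on) (auto simp: c_def)
    moreover have "image_mset (c E) (mset_set (?m - E)) = replicate_mset (card (?m - E)) (X 1)"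
      by (intro image_mset_const_on) (auto simp: c_def)
    ultimately have "image_mset (c E) (mset_set ?m) = M"
      using E fin by (simp add: M_def card_Diff_subset)
    then show ?thesis by (simp add: colourings_def c_def)
  qed
  obtain u where u: "u \<in> signed_perms m" "unsigned u = u" "\<And>i. i \<in> ?m \<Longrightarrow> c B (u i) = c A i"
    by (rule colour_transport[OF c[OF assms(2)] c[OF assms(1)]]) (use assms(3) in simp, rule refl, rule that)
  have um: "u i \<in> ?m" if "i \<in> ?m" for i using unsigned_mem[OF u(1) that] unfolding u(2) .
  have iff: "u i \<in> B \<longleftrightarrow> i \<in> A" if i: "i \<in> ?m" for i
    using u(3)[OF i] um[OF i] i by (simp add: c_def split: if_splits)
  have "u ` A = B"
  proof (intro equalityI subsetI)
    fix y assume "y \<in> u ` A"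
    then show "y \<in> B" using iff assms(1) by blast
  next
    fix y assume y: "y \<in> B"
    then have "y \<in> u ` ?m" using unsigned_permutes_image[OF u(1)] assms(2) unfolding u(2) by blast
    then obtain i where "i \<in> ?m" "y = u i" by blast
    then show "y \<in> u ` A" using iff y by blast
  qed
  then show ?thesis using that[OF u(1)] u(2) by simp
qed

lemma ext_power_irreducible:
  assumes "j \<le> m"
  shows "irreducible_character (signed_perms m) (ext_power_char m j)"
proof -
  let ?G = "signed_perms m" and ?m = "{1..int m}"
  define J where "J = {I. I \<subseteq> ?m \<and> card I = j}"
  define d where "d = card J"
  have finJ: "finite J" unfolding J_def by (rule finite_subset[of _ "Pow ?m"]) auto
  obtain e where e: "bij_betw e {..<d} J"
    using ex_bij_betw_nat_finite[OF finJ] unfolding d_def lessThan_atLeast0 by blast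
  have eJ: "e p \<in> J" if "p < d" for p using e that by (auto simp: bij_betw_def)
  have em: "e p \<subseteq> ?m" if "p < d" for p using eJ[OF that] by (simp add: J_def)
  have einj: "e p = e q \<longleftrightarrow> p = q" if "p < d" "q < d" for p q
    using e that by (auto simp: bij_betw_def inj_on_def)
  have esurj: "\<exists>p<d. e p = I" if "I \<in> J" for I using e that by (auto simp: bij_betw_def)
  have uJ: "unsigned w ` I \<in> J" if w: "w \<in> ?G" and I: "I \<in> J" for w I
  proof -
    have "unsigned w ` I \<subseteq> ?m" using I unsigned_permutes_image[OF w] unfolding J_def by blast
    moreover have "inj_on (unsigned w) I"
      using signed_permsD(4)[OF unsigned_signed_perm[OF w]] inj_on_subset by blast
    ultimately show ?thesis using I by (simp add: J_def card_image)
  qed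
  define \<rho> where "\<rho> w = mat d d (\<lambda>(p, q). if unsigned w ` e q = e p then complex_of_int (ext_sign w (e q)) else 0)" for w
  have \<rho>C: "\<rho> w \<in> carrier_mat d d" for w by (simp add: \<rho>_def)
  have dim: "dim_row (\<rho> w) = d" "dim_col (\<rho> w) = d" for w by (simp_all add: \<rho>_def)
  have \<rho>: "\<rho> w $$ (p, q) = (if unsigned w ` e q = e p then complex_of_int (ext_sign w (e q)) else 0)"
    if "p < d" "q < d" for w p q using that by (simp add: \<rho>_def)
  have act: "(\<rho> w *\<^sub>v x) $ p = of_int (ext_sign w (e q)) * x $ q"
    if w: "w \<in> ?G" and x: "x \<in> carrier_vec d" and pq: "p < d" "q < d" "unsigned w ` e q = e p" for w x p q
  proof -
    have inj: "inj (unsigned w)" by (rule signed_permsD(4)[OF unsigned_signed_perm[OF w]])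
    have "(\<rho> w *\<^sub>v x) $ p = (\<Sum>r = 0..<d. \<rho> w $$ (p, r) * x $ r)"
      using x pq(1) \<rho>C[of w] by (simp add: scalar_prod_def)
    also have "\<dots> = (\<Sum>r = 0..<d. if r = q then of_int (ext_sign w (e q)) * x $ q else 0)"
    proof (rule sum.cong[OF refl])
      fix r assume "r \<in> {0..<d}"
      then have r: "r < d" by simp
      have "unsigned w ` e r = e p \<longleftrightarrow> r = q"
        using inj_image_eq_iff[OF inj, of "e r" "e q"] einj[OF r pq(2)] pq(3) by simp
      then show "\<rho> w $$ (p, r) * x $ r = (if r = q then of_int (ext_sign w (e q)) * x $ q else 0)"
        unfolding \<rho>[OF pq(1) r] by simp
    qed
    also have "\<dots> = of_int (ext_sign w (e q)) * x $ q" using pq(2) by (simp add: sum.delta)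
    finally show ?thesis .
  qed
  have rep: "representation ?G d \<rho>"
    unfolding representation_def
  proof (intro conjI ballI)
    show "\<rho> w \<in> carrier_mat d d" for w by (rule \<rho>C)
    show "\<rho> id = 1\<^sub>m d"
    proof (rule eq_matI)
      fix p q assume "p < dim_row (1\<^sub>m d)" "q < dim_col (1\<^sub>m d)"
      then have pq: "p < d" "q < d" by simp_all
      show "\<rho> id $$ (p, q) = 1\<^sub>m d $$ (p, q)"
        unfolding \<rho>[OF pq] unsigned_id ext_sign_id[OF em[OF pq(2)]] using pq einj[OF pq(2,1)] by auto
    qed (simp_all add: dim)
    fix u v assume u: "u \<in> ?G" and v: "v \<in> ?G"
    show "\<rho> (u \<circ> v) = \<rho> u * \<rho> v"
    proof (rule eq_matI)
      fix p q assume "p < dim_row (\<rho> u * \<rho> v)" "q < dim_col (\<rho> u * \<rho> v)"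
      then have pq: "p < d" "q < d" by (simp_all add: dim)
      \<comment> \<open>Column \<open>q\<close> of \<open>\<rho> v\<close> has its only nonzero
        entry in row \<open>r\<close>, so the matrix product has a single term.\<close>
      obtain r where r: "r < d" "e r = unsigned v ` e q" using esurj[OF uJ[OF v eJ[OF pq(2)]]] by blast
      have "(\<rho> u * \<rho> v) $$ (p, q) = (\<Sum>s = 0..<d. \<rho> u $$ (p, s) * \<rho> v $$ (s, q))"
        using pq \<rho>C[of u] \<rho>C[of v] by (simp add: scalar_prod_def)
      also have "\<dots> = (\<Sum>s = 0..<d. if s = r then \<rho> u $$ (p, r) * of_int (ext_sign v (e q)) else 0)"
      proof (rule sum.cong[OF refl])
        fix s assume "s \<in> {0..<d}"
        then have s: "s < d" by simp
        have "unsigned v ` e q = e s \<longleftrightarrow> s = r" using einj[OF s r(1)] r(2) by auto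
        then show "\<rho> u $$ (p, s) * \<rho> v $$ (s, q) = (if s = r then \<rho> u $$ (p, r) * of_int (ext_sign v (e q)) else 0)"
          unfolding \<rho>[OF s pq(2)] by simp
      qed
      also have "\<dots> = \<rho> u $$ (p, r) * of_int (ext_sign v (e q))" using r(1) by (simp add: sum.delta)
      also have "\<dots> = \<rho> (u \<circ> v) $$ (p, q)"
        unfolding \<rho>[OF pq(1) r(1)] \<rho>[OF pq] unsigned_comp[OF u v] image_comp[symmetric] r(2)
          ext_sign_comp[OF u v em[OF pq(2)]] by simp
      finally show "\<rho> (u \<circ> v) $$ (p, q) = (\<rho> u * \<rho> v) $$ (p, q)" by simp
    qed (simp_all add: dim)
  qed
  have "d > 0"
  proof -
    obtain E where "E \<subseteq> ?m" "card E = j" using obtain_subset_with_card_n[of j ?m] assms by auto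
    then have "E \<in> J" by (simp add: J_def)
    then show ?thesis unfolding d_def using finJ by (auto simp: card_gt_0_iff)
  qed
  moreover have "W = {0\<^sub>v d} \<or> W = carrier_vec d" if inv: "invariant_subspace ?G d \<rho> W" for W
  proof (rule disjCI)
    have WC: "W \<subseteq> carrier_vec d" and W0: "0\<^sub>v d \<in> W" and Wadd: "\<And>x y. x \<in> W \<Longrightarrow> y \<in> W \<Longrightarrow> x + y \<in> W"
      and Wsm: "\<And>a x. x \<in> W \<Longrightarrow> a \<cdot>\<^sub>v x \<in> W" and Wact: "\<And>u x. u \<in> ?G \<Longrightarrow> x \<in> W \<Longrightarrow> \<rho> u *\<^sub>v x \<in> W"
      using inv unfolding invariant_subspace_def by blast+
    assume "W \<noteq> carrier_vec d"
    show "W = {0\<^sub>v d}"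
    proof (rule ccontr)
      assume "W \<noteq> {0\<^sub>v d}"
      then obtain x where x: "x \<in> W" "x \<noteq> 0\<^sub>v d" using W0 by blast
      have xC: "x \<in> carrier_vec d" using x(1) WC by blast
      obtain p where p: "p < d" "x $ p \<noteq> 0"
      proof (rule ccontr)
        assume "\<not> thesis"
        then have "x $ p = 0" if "p < d" for p using \<open>\<And>p. p < d \<Longrightarrow> x $ p \<noteq> 0 \<Longrightarrow> thesis\<close> that by blast
        then have "x = 0\<^sub>v d" using xC by (intro eq_vecI) auto
        then show False using x(2) by simp
      qed
      \<comment> \<open>Averaging a vector with its image under the sign change at \<open>k\<close>,
        with the sign that \<open>k\<close> has on \<open>e p\<close>, keeps the coordinates whose
        sets agree with \<open>e p\<close> at \<open>k\<close> and kills the others. With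
        \<open>F\<close> running up to all of \<open>{1..m}\<close> only the coordinate
        \<open>p\<close> survives.\<close>
      have proj: "vec d (\<lambda>q. if e q \<inter> F = e p \<inter> F then x $ q else 0) \<in> W" if F: "finite F" for F
        using F
      proof (induction F rule: finite_induct)
        case empty
        have "vec d (\<lambda>q. if e q \<inter> {} = e p \<inter> {} then x $ q else 0) = x" using xC by (intro eq_vecI) auto
        then show ?case using x(1) by simp
      next
        case (insert k F)
        define y where "y = vec d (\<lambda>q. if e q \<inter> F = e p \<inter> F then x $ q else 0)"
        define s where "s = (if k \<in> e p then - 1 else 1 :: complex)"
        have yW: "y \<in> W" unfolding y_def by (rule insert.IH)
        have yC: "y \<in> carrier_vec d" by (simp add: y_def)
        have fl: "(\<rho> (sign_flip m k) *\<^sub>v y) $ q = (if k \<in> e q then - 1 else 1) * y $ q" if q: "q < d" for q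
        proof -
          have "ext_sign (sign_flip m k) (e q) = (if k \<in> e q then - 1 else 1) * ext_sign id (e q)"
            using ext_sign_flip[OF signed_perms_id em[OF q], of k] by simp
          then show ?thesis
            using act[OF sign_flip(1) yC q q, of k] ext_sign_id[OF em[OF q]] by (simp add: sign_flip(2))
        qed
        have "(1 / 2) \<cdot>\<^sub>v (y + s \<cdot>\<^sub>v (\<rho> (sign_flip m k) *\<^sub>v y)) \<in> W"
          using yW sign_flip(1) by (intro Wsm Wadd Wact)
        also have "(1 / 2) \<cdot>\<^sub>v (y + s \<cdot>\<^sub>v (\<rho> (sign_flip m k) *\<^sub>v y))
            = vec d (\<lambda>q. if e q \<inter> insert k F = e p \<inter> insert k F then x $ q else 0)"
        proof (rule eq_vecI)
          fix q assume "q < dim_vec (vec d (\<lambda>q. if e q \<inter> insert k F = e p \<inter> insert k F then x $ q else 0))"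
          then have q: "q < d" by simp
          have dims: "dim_vec (\<rho> (sign_flip m k) *\<^sub>v y) = d" "dim_vec y = d" using yC by (simp_all add: dim)
          have "((1 / 2) \<cdot>\<^sub>v (y + s \<cdot>\<^sub>v (\<rho> (sign_flip m k) *\<^sub>v y))) $ q
              = (1 / 2) * (y $ q + s * ((if k \<in> e q then - 1 else 1) * y $ q))"
            using q dims fl[OF q] by simp
          also have "\<dots> = (if k \<in> e q \<longleftrightarrow> k \<in> e p then y $ q else 0)" by (auto simp: s_def)
          also have "\<dots> = (if e q \<inter> insert k F = e p \<inter> insert k F then x $ q else 0)"
          proof -
            have "e q \<inter> insert k F = e p \<inter> insert k F \<longleftrightarrow> (k \<in> e q \<longleftrightarrow> k \<in> e p) \<and> e q \<inter> F = e p \<inter> F"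
              using insert(2) by blast
            then show ?thesis using q by (simp add: y_def)
          qed
          finally show "((1 / 2) \<cdot>\<^sub>v (y + s \<cdot>\<^sub>v (\<rho> (sign_flip m k) *\<^sub>v y))) $ q
              = vec d (\<lambda>q. if e q \<inter> insert k F = e p \<inter> insert k F then x $ q else 0) $ q" using q by simp
        qed (simp add: dim)
        finally show ?case .
      qed
      have up: "unit_vec d p \<in> W"
      proof -
        have "(1 / x $ p) \<cdot>\<^sub>v vec d (\<lambda>q. if e q \<inter> ?m = e p \<inter> ?m then x $ q else 0) \<in> W"
          by (intro Wsm proj) simp
        also have "(1 / x $ p) \<cdot>\<^sub>v vec d (\<lambda>q. if e q \<inter> ?m = e p \<inter> ?m then x $ q else 0) = unit_vec d p"
        proof (rule eq_vecI)
          fix q assume "q < dim_vec (unit_vec d p :: complex vec)"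
          then have q: "q < d" by simp
          have "e q \<inter> ?m = e p \<inter> ?m \<longleftrightarrow> q = p" using einj[OF q p(1)] em[OF q] em[OF p(1)] by (simp add: Int_absorb2)
          then show "((1 / x $ p) \<cdot>\<^sub>v vec d (\<lambda>q. if e q \<inter> ?m = e p \<inter> ?m then x $ q else 0)) $ q = unit_vec d p $ q"
            using q p by simp
        qed simp
        finally show ?thesis .
      qed
      have units: "unit_vec d q \<in> W" if q: "q < d" for q
      proof -
        have "card (e p) = card (e q)" using eJ[OF p(1)] eJ[OF q] by (simp add: J_def)
        then obtain u where u: "u \<in> ?G" "unsigned u ` e p = e q"
          using signed_perms_subset_transitive[OF em[OF p(1)] em[OF q]] by blast
        let ?K = "complex_of_int (ext_sign u (e p))"
        have K: "?K \<noteq> 0" using ext_sign_nonzero[OF u(1) em[OF p(1)]] by simp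
        have "(1 / ?K) \<cdot>\<^sub>v (\<rho> u *\<^sub>v unit_vec d p) \<in> W" using up u(1) by (intro Wsm Wact)
        also have "(1 / ?K) \<cdot>\<^sub>v (\<rho> u *\<^sub>v unit_vec d p) = unit_vec d q"
        proof (rule eq_vecI)
          fix r assume "r < dim_vec (unit_vec d q :: complex vec)"
          then have r: "r < d" by simp
          obtain t where t: "t < d" "unsigned u ` e t = e r"
          proof -
            have inv: "inv_into UNIV u \<in> ?G" by (rule signed_perms_inv[OF u(1)])
            obtain t where t: "t < d" "e t = unsigned (inv_into UNIV u) ` e r" using esurj[OF uJ[OF inv eJ[OF r]]] by blast
            have "unsigned u ` unsigned (inv_into UNIV u) ` e r = e r"
              unfolding image_comp unsigned_comp[OF u(1) inv, symmetric] signed_perms_inv_comp(2)[OF u(1)] unsigned_id by simp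
            then show thesis using that t by simp
          qed
          have "t = p \<longleftrightarrow> r = q"
            using einj[OF t(1) p(1)] einj[OF r q] t(2) u(2)
              inj_image_eq_iff[OF signed_permsD(4)[OF unsigned_signed_perm[OF u(1)]], of "e t" "e p"] by simp
          then show "((1 / ?K) \<cdot>\<^sub>v (\<rho> u *\<^sub>v unit_vec d p)) $ r = unit_vec d q $ r"
            using act[OF u(1) _ r t(1) t(2), of "unit_vec d p"] K r t(1) p(1) q by (auto simp: dim)
        qed (simp add: dim)
        finally show ?thesis .
      qed
      have "y \<in> W" if y: "y \<in> carrier_vec d" for y
      proof -
        have "vec d (\<lambda>q. if q < k then y $ q else 0) \<in> W" if "k \<le> d" for k
          using that
        proof (induction k)
          case 0
          have "vec d (\<lambda>q. if q < 0 then y $ q else 0) = 0\<^sub>v d" by (intro eq_vecI) auto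
          then show ?case using W0 by simp
        next
          case (Suc k)
          have "vec d (\<lambda>q. if q < k then y $ q else 0) + y $ k \<cdot>\<^sub>v unit_vec d k \<in> W"
            using Suc units by (intro Wadd Wsm) auto
          also have "vec d (\<lambda>q. if q < k then y $ q else 0) + y $ k \<cdot>\<^sub>v unit_vec d k
              = vec d (\<lambda>q. if q < Suc k then y $ q else 0)"
            using Suc.prems by (intro eq_vecI) (auto simp: less_Suc_eq)
          finally show ?case .
        qed
        from this[OF order_refl] have "vec d (\<lambda>q. if q < d then y $ q else 0) \<in> W" .
        also have "vec d (\<lambda>q. if q < d then y $ q else 0) = y" using y by (intro eq_vecI) auto
        finally show ?thesis .
      qed
      then show False using WC \<open>W \<noteq> carrier_vec d\<close> by blast
    qed
  qed
  ultimately have irr: "irreducible_representation ?G d \<rho>" using rep by (simp add: irreducible_representation_def)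
  have "ext_power_char m j = (\<lambda>u. if u \<in> ?G then \<Sum>i<d. \<rho> u $$ (i, i) else 0)"
  proof
    fix u
    show "ext_power_char m j u = (if u \<in> ?G then \<Sum>i<d. \<rho> u $$ (i, i) else 0)"
    proof (cases "u \<in> ?G")
      case True
      have "(\<Sum>i<d. \<rho> u $$ (i, i)) = (\<Sum>i<d. if unsigned u ` e i = e i then of_int (ext_sign u (e i)) else 0)"
        by (intro sum.cong refl) (simp add: \<rho>)
      also have "\<dots> = (\<Sum>I\<in>J. if unsigned u ` I = I then of_int (ext_sign u I) else 0)"
        by (rule sum.reindex_bij_betw[OF e])
      also have "\<dots> = (\<Sum>I\<in>{I \<in> J. unsigned u ` I = I}. of_int (ext_sign u I))"
        by (rule sum.inter_filter[OF finJ, symmetric])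
      also have "{I \<in> J. unsigned u ` I = I} = {I. I \<subseteq> ?m \<and> card I = j \<and> unsigned u ` I = I}"
        unfolding J_def by blast
      finally show ?thesis using True by (simp add: ext_power_char_def)
    qed (simp add: ext_power_char_def)
  qed
  then show ?thesis unfolding irreducible_character_def using irr by blast
qed

section \<open>The irreducible characters of the exterior powers\<close>

text \<open>Cyclicity of the trace.\<close>

lemma irreducible_character_class_function:
  assumes "irreducible_character (signed_perms m) \<chi>" "u \<in> signed_perms m" "h \<in> signed_perms m"
  shows "\<chi> (u \<circ> h \<circ> inv_into UNIV u) = \<chi> h"
proof -
  let ?G = "signed_perms m" and ?i = "inv_into UNIV u"
  obtain d \<rho> where rep: "representation ?G d \<rho>" and chi: "\<chi> = (\<lambda>u. if u \<in> ?G then \<Sum>i<d. \<rho> u $$ (i, i) else 0)"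
    using assms(1) unfolding irreducible_character_def irreducible_representation_def by blast
  have C: "\<rho> w \<in> carrier_mat d d" if "w \<in> ?G" for w using rep that unfolding representation_def by blast
  have mult: "\<rho> (v \<circ> w) = \<rho> v * \<rho> w" if "v \<in> ?G" "w \<in> ?G" for v w
    using rep that unfolding representation_def by blast
  have tr: "\<chi> (v \<circ> w) = (\<Sum>i<d. \<Sum>k<d. \<rho> v $$ (i, k) * \<rho> w $$ (k, i))" if v: "v \<in> ?G" and w: "w \<in> ?G" for v w
  proof -
    have "\<chi> (v \<circ> w) = (\<Sum>i<d. (\<rho> v * \<rho> w) $$ (i, i))"
      using signed_perms_comp[OF v w] mult[OF v w] by (simp add: chi)
    also have "\<dots> = (\<Sum>i<d. \<Sum>k<d. \<rho> v $$ (i, k) * \<rho> w $$ (k, i))"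
      using C[OF v] C[OF w] by (intro sum.cong refl) (auto simp: scalar_prod_def lessThan_atLeast0 intro!: sum.cong)
    finally show ?thesis .
  qed
  have comm: "\<chi> (v \<circ> w) = \<chi> (w \<circ> v)" if "v \<in> ?G" "w \<in> ?G" for v w
    unfolding tr[OF that] tr[OF that(2,1)] by (subst sum.swap) (simp add: mult.commute)
  have uh: "u \<circ> h \<in> ?G" by (rule signed_perms_comp[OF assms(2,3)])
  have "\<chi> (u \<circ> h \<circ> ?i) = \<chi> (?i \<circ> (u \<circ> h))" by (rule comm[OF uh signed_perms_inv[OF assms(2)]])
  also have "?i \<circ> (u \<circ> h) = h" unfolding comp_assoc[symmetric] signed_perms_inv_comp(1)[OF assms(2)] by simp
  finally show ?thesis .
qed

lemma ch_diff: "ch n (\<lambda>w. f w - g w) = ch n f - ch n g"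
  by (rule mseries_eqI) (simp add: mcoeff_ch mcoeff_diff left_diff_distrib sum_subtractf diff_divide_distrib)

lemma ch_sum: "ch n (\<lambda>w. \<Sum>k\<in>K. f k w) = (\<Sum>k\<in>K. ch n (f k))"
proof (rule mseries_eqI)
  fix M
  have "(\<Sum>w\<in>signed_perms n. (\<Sum>k\<in>K. f k w) * mcoeff (type_series (signed_cycle_type n w)) M)
      = (\<Sum>k\<in>K. \<Sum>w\<in>signed_perms n. f k w * mcoeff (type_series (signed_cycle_type n w)) M)"
    unfolding sum_distrib_right by (rule sum.swap)
  then show "mcoeff (ch n (\<lambda>w. \<Sum>k\<in>K. f k w)) M = mcoeff (\<Sum>k\<in>K. ch n (f k)) M"
    unfolding mcoeff_ch mcoeff_sum by (simp add: sum_divide_distrib)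
qed

text \<open>Two irreducible characters with the same characteristic differ by a class function of
  characteristic zero, so they agree on the group; outside the group both vanish by convention. This
  makes the description definite, with the exterior power as witness.\<close>

lemma irr_char_eq:
  assumes "k + j = m"
  shows "irr_char m [k] (replicate j 1) = ext_power_char m j"
  unfolding irr_char_def
proof (rule the_equality)
  have irr: "irreducible_character (signed_perms m) (ext_power_char m j)"
    using ext_power_irreducible[of j m] assms by simp
  have ch: "ch m (ext_power_char m j) = schur X [k] * schur Y (replicate j 1)"
    by (rule ch_ext_power_char[OF assms])
  show "irreducible_character (signed_perms m) (ext_power_char m j)
      \<and> ch m (ext_power_char m j) = schur X [k] * schur Y (replicate j 1)"
    using irr ch by blast
  fix \<chi> assume \<chi>: "irreducible_character (signed_perms m) \<chi> \<and> ch m \<chi> = schur X [k] * schur Y (replicate j 1)"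
  let ?f = "\<lambda>w. \<chi> w - ext_power_char m j w"
  have "ch m ?f = 0" unfolding ch_diff using \<chi> ch by simp
  moreover have "?f (u \<circ> h \<circ> inv_into UNIV u) = ?f h" if "u \<in> signed_perms m" "h \<in> signed_perms m" for u h
    using irreducible_character_class_function[OF conjunct1[OF \<chi>] that]
      irreducible_character_class_function[OF irr that] by simp
  ultimately have zero: "?f w = 0" if "w \<in> signed_perms m" for w
    using ch_eq_0_imp_eq_0[of m ?f w] that by blast
  show "\<chi> = ext_power_char m j"
  proof
    fix w show "\<chi> w = ext_power_char m j w"
    proof (cases "w \<in> signed_perms m")
      case True
      then show ?thesis using zero by simp
    next
      case False
      then show ?thesis using \<chi> by (auto simp: irreducible_character_def ext_power_char_def)
    qed
  qed
qed

theorem theorem8p3: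
  fixes n :: nat
  assumes "n \<ge> 2"
  shows "fine_set n (signed_arc_perms n) (sDes n)
           (induced (signed_perms (n - 1)) (signed_perms n) (ext_char (n - 1))) \<and>
         (\<Sum>w \<in> signed_arc_perms n. F_fun n (sDes n w)) =
           ch n (\<lambda>w. \<Sum>k = 0..n - 1.
             induced (signed_perms (n - 1)) (signed_perms n)
               (irr_char (n - 1) [k] (replicate (n - k - 1) 1)) w)"
proof
  show "fine_set n (signed_arc_perms n) (sDes n)
      (induced (signed_perms (n - 1)) (signed_perms n) (ext_char (n - 1)))"
    by (rule fine_set_signed_arc_perms[OF assms])
  have "ch n (\<lambda>w. \<Sum>k = 0..n - 1. induced (signed_perms (n - 1)) (signed_perms n)
        (irr_char (n - 1) [k] (replicate (n - k - 1) 1)) w)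
      = (\<Sum>k = 0..n - 1. p_plus 1 * (schur X [k] * schur Y (replicate (n - 1 - k) 1)))"
    unfolding ch_sum
  proof (rule sum.cong[OF refl])
    fix k assume "k \<in> {0..n - 1}"
    then have kj: "k + (n - k - 1) = n - 1" and eq: "n - k - 1 = n - 1 - k" using assms by auto
    have "n \<ge> 1" using assms by simp
    from ch_induced[OF this] ch_ext_power_char[OF kj] irr_char_eq[OF kj]
    show "ch n (induced (signed_perms (n - 1)) (signed_perms n) (irr_char (n - 1) [k] (replicate (n - k - 1) 1)))
        = p_plus 1 * (schur X [k] * schur Y (replicate (n - 1 - k) 1))"
      unfolding eq by (simp only:)
  qed
  then show "(\<Sum>w \<in> signed_arc_perms n. F_fun n (sDes n w)) = ch n (\<lambda>w. \<Sum>k = 0..n - 1.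
        induced (signed_perms (n - 1)) (signed_perms n)
          (irr_char (n - 1) [k] (replicate (n - k - 1) 1)) w)"
    unfolding sum_F_signed_arc_perms[OF assms] sum_distrib_left by (rule sym)
qed

end
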